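(* Let $N \geq 1$ be an integer, let $1 \leq p < +\infty$ and suppose $f \in L^p(\mathbb{R}^N)$. Then $f \in W^{1,p}(\mathbb{R}^N)$ if and only if there exists $v \in L^p(\mathbb{R}^N; \mathbb{R}^N)$ such that $$\lim_{\epsilon \to 0^+} \int_{\mathbb{R}^N} \left( \frac{1}{|B(0,\epsilon)|}\int_{B(0,\epsilon)} \frac{|f(x+h) - f(x) - v(x) \cdot h|^{pq}}{|h|^{pq}} \, dh \right)^{\frac{1}{q}} dx = 0$$ for every $q$ satisfying $1 \leq q \leq \frac{N}{N-p}$ if $1 \leq p < N$, $1 \leq q < \infty$ if $p = N$, and $1 \leq q \leq \infty$ if $p > N$. Here, for $q=\infty$ (possible only when $p>N$), the inner expression $\left( \cdots \right)^{1/q}$ is understood as $$\left(\operatorname*{ess\,sup}_{h \in B(0,\epsilon)} \frac{|f(x+h) - f(x) - v(x) \cdot h|}{|h|}\right)^{p}.$$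
   Context: $W^{1,p}(\mathbb{R}^N)$ is the Sobolev space of real-valued functions in $L^p(\mathbb{R}^N)$ whose distributional gradient belongs to $L^p(\mathbb{R}^N;\mathbb{R}^N)$. $B(0,\epsilon)$ is the ball in $\mathbb{R}^N$ of radius $\epsilon$ centered at the origin, and $|B(0,\epsilon)|$ is its Lebesgue measure. *)

theory Defs
  imports "HOL-Analysis.Analysis" "HOL-Probability.Essential_Supremum"
begin

(* Elements of L^p are represented by Lebesgue measurable functions. Membership in Lp and W1, and
   the integral over x of local_remainder, do not change when f or v is modified on a null set. *)
definition Lp :: "real \<Rightarrow> ('a::euclidean_space \<Rightarrow> 'b::euclidean_space) set" where
  "Lp p = {f. f \<in> borel_measurable lebesgue \<and> integrable lebesgue (\<lambda>x. norm (f x) powr p)}"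

definition partial_deriv :: "'a::euclidean_space \<Rightarrow> ('a \<Rightarrow> real) \<Rightarrow> 'a \<Rightarrow> real" where
  "partial_deriv b \<phi> x = frechet_derivative \<phi> (at x) b"

primrec Ck :: "nat \<Rightarrow> ('a::euclidean_space \<Rightarrow> real) \<Rightarrow> bool" where
  "Ck 0 \<phi> \<longleftrightarrow> continuous_on UNIV \<phi>"
| "Ck (Suc k) \<phi> \<longleftrightarrow> (\<forall>x. \<phi> differentiable (at x)) \<and> (\<forall>b\<in>Basis. Ck k (partial_deriv b \<phi>))"

definition test_functions :: "('a::euclidean_space \<Rightarrow> real) set" where
  "test_functions = {\<phi>. (\<forall>k. Ck k \<phi>) \<and> compact (closure {x. \<phi> x \<noteq> 0})}"

(* Used only for f and g in L^p with p at least 1, which are locally integrable, so that both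
   Bochner integrals exist. *)
definition distributional_gradient ::
    "('a::euclidean_space \<Rightarrow> real) \<Rightarrow> ('a \<Rightarrow> 'a) \<Rightarrow> bool" where
  "distributional_gradient f g \<longleftrightarrow>
     (\<forall>\<phi>\<in>test_functions. \<forall>b\<in>Basis.
        (LINT x|lebesgue. f x * partial_deriv b \<phi> x) = - (LINT x|lebesgue. (g x \<bullet> b) * \<phi> x))"

definition W1 :: "real \<Rightarrow> ('a::euclidean_space \<Rightarrow> real) set" where
  "W1 p = {f \<in> Lp p. \<exists>g \<in> Lp p. distributional_gradient f g}"

(* Powers of extended nonnegative reals with exponent r > 0. *)
definition ennpowr :: "ennreal \<Rightarrow> real \<Rightarrow> ennreal" where
  "ennpowr x r = (if x = \<infinity> then \<infinity> else ennreal (enn2real x powr r))"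

(* The expression to the power 1/q under the outer integral, with its convention for infinite q.
   It is extended-valued, so that a divergent integral counts as infinity; only finite q and
   q = infinity are relevant. At h = 0 the quotients are 0 by totality of division; this affects
   only a null set. *)
definition local_remainder ::
    "real \<Rightarrow> ereal \<Rightarrow> ('a::euclidean_space \<Rightarrow> real) \<Rightarrow> ('a \<Rightarrow> 'a) \<Rightarrow> real \<Rightarrow> 'a \<Rightarrow> ennreal" where
  "local_remainder p q f v \<epsilon> x =
     (if q = \<infinity> then
        ennpowr
          (esssup (restrict_space lebesgue (ball 0 \<epsilon>))
             (\<lambda>h. ennreal (\<bar>f (x + h) - f x - v x \<bullet> h\<bar> / norm h)))
          p
      else
        ennpowr
          (1 / emeasure lebesgue (ball (0::'a) \<epsilon>) *
           (\<integral>\<^sup>+h\<in>ball 0 \<epsilon>.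
              ennreal (\<bar>f (x + h) - f x - v x \<bullet> h\<bar> powr (p * real_of_ereal q)
                       / norm h powr (p * real_of_ereal q)) \<partial>lebesgue))
          (1 / real_of_ereal q))"

end

theory Submission
  imports Defs
begin

text \<open>
  If \<open>v\<close> satisfies the limit condition, then Tonelli's theorem and \<open>q = 1\<close> show that
  \<open>\<parallel>f(\<cdot> + h) - f - v \<bullet> h\<parallel>\<^sub>p\<^sup>p / \<bar>h\<bar>\<^sup>p\<close> tends to 0 on average over \<open>h \<in> B(0,\<epsilon>)\<close>. Testing with \<open>\<phi>\<close>, the
  vector \<open>w = \<integral> f \<nabla>\<phi> + \<integral> \<phi> v\<close> has \<open>w \<bullet> h / \<bar>h\<bar>\<close> small on average, which forces \<open>w = 0\<close>.

  Conversely let \<open>v\<close> be the weak gradient of \<open>f\<close> and \<open>R(x,h) = f(x + h) - f(x) - v(x) \<bullet> h\<close>. For \<open>p \<le> N\<close> the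
  Sobolev inequality is applied to \<open>h \<mapsto> \<psi>(h/r) R(x,h)\<close> with a cutoff \<open>\<psi>\<close>. After integration in \<open>x\<close> both terms on its
  right-hand side are controlled by \<open>\<parallel>v(\<cdot> + k) - v\<parallel>\<^sub>p\<close> with \<open>\<bar>k\<bar> \<le> 2 r\<close>, which is small because translations are
  continuous in \<open>L\<^sup>p\<close>. The weight \<open>1 / \<bar>h\<bar>\<close> costs a sum over the dyadic balls \<open>B(0,\<epsilon> / 2\<^sup>k)\<close>, which converges thanks to
  the volume factor \<open>2 powr (- k N / q)\<close>; smaller \<open>q\<close> follow from Jensen's inequality. For \<open>p > N\<close> and \<open>q = \<infinity>\<close> this
  factor is lost. Instead Morrey's estimate with an exponent \<open>s\<close> between \<open>N\<close> and \<open>p\<close> bounds \<open>\<bar>R(x,h)\<bar> / \<bar>h\<bar>\<close> by a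
  maximal function of \<open>\<bar>v - v(x)\<bar>\<^sup>s\<close>, and the maximal inequality in \<open>L\<close> with exponent \<open>p / s > 1\<close>, together with the
  density of continuous functions with compact support, gives the limit.
\<close>

section \<open>Powers of extended nonnegative reals\<close>

text \<open>Sizes are measured in \<open>ennreal\<close> by p-th powers instead of norms, so
  divergent integrals need no separate treatment and a factor \<open>2 powr p\<close> replaces
  Minkowski's inequality. The obstacle on the way from the gradient to the limit is that
  \<open>R(x,h)\<close> has neither compact support nor mean value 0 in \<open>h\<close>, so no
  Sobolev or Poincare inequality applies to it directly. The cutoff repairs the support at the price
  of a term containing \<open>R\<close> itself. That term is harmless because, for fixed
  \<open>h\<close>, the p-th power integral of \<open>R\<close> in \<open>x\<close> is at most a
  multiple of \<open>|h| powr p\<close> times the translation modulus of \<open>v\<close>. Local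
  estimates are first proved with an arbitrary vector \<open>a\<close> in place of the gradient at
  \<open>x\<close> and, for the Sobolev estimate, an arbitrary number \<open>c\<close> in place of
  the value there, since pointwise values survive a limit only almost everywhere. For
  \<open>p = N\<close> the Sobolev exponent would be infinite, so a smaller exponent adapted to
  \<open>q\<close> is used. For \<open>p > N\<close> the choice \<open>s < p\<close> is forced:
  \<open>s = p\<close> would require the maximal inequality for integrable functions, where it
  fails.\<close>

text \<open>Unlike \<^const>\<open>powr\<close> and \<^const>\<open>ennpowr\<close>, the exponent 0 gives 1 also at the bases 0 and \<open>\<infinity>\<close>; hence exponents add up.\<close>

definition epow :: "ennreal \<Rightarrow> real \<Rightarrow> ennreal" where
  "epow x r = (if r = 0 then 1 else ennpowr x r)"

lemma epow_0 [simp]: "epow x 0 = 1"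
  by (simp add: epow_def)

lemma epow_1 [simp]: "epow x 1 = x"
  by (cases x rule: ennreal_cases) (simp_all add: epow_def ennpowr_def infinity_ennreal_def)

lemma epow_ennreal: "0 \<le> c \<Longrightarrow> 0 < r \<Longrightarrow> epow (ennreal c) r = ennreal (c powr r)"
  by (simp add: epow_def ennpowr_def)

lemma epow_ennreal_pos: "0 < c \<Longrightarrow> epow (ennreal c) r = ennreal (c powr r)"
  by (simp add: epow_def ennpowr_def)

lemma epow_top [simp]: "0 < r \<Longrightarrow> epow top r = top"
  by (simp add: epow_def ennpowr_def infinity_ennreal_def)

lemma epow_zero [simp]: "0 < r \<Longrightarrow> epow 0 r = 0"
  by (simp add: epow_def ennpowr_def)

lemma epow_one [simp]: "epow 1 r = 1"
  by (simp add: epow_def ennpowr_def)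

lemma epow_eq_ennpowr: "r \<noteq> 0 \<Longrightarrow> epow x r = ennpowr x r"
  by (simp add: epow_def)

lemma epow_eq_0_iff: "0 < r \<Longrightarrow> epow x r = 0 \<longleftrightarrow> x = 0"
  by (cases x rule: ennreal_cases) (auto simp: epow_ennreal ennreal_eq_0_iff)

lemma epow_eq_top_iff: "0 < r \<Longrightarrow> epow x r = top \<longleftrightarrow> x = top"
  by (cases x rule: ennreal_cases) (auto simp: epow_ennreal)

lemma epow_mono: "x \<le> y \<Longrightarrow> 0 \<le> r \<Longrightarrow> epow x r \<le> epow y r"
proof (cases "r = 0")
  case False
  assume "x \<le> y" "0 \<le> r"
  with False show ?thesis
    by (cases x rule: ennreal_cases; cases y rule: ennreal_cases)
       (auto simp: epow_ennreal top_unique ennreal_le_iff intro!: ennreal_leI powr_mono2)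
qed simp

lemma epow_mult: "0 \<le> r \<Longrightarrow> epow (x * y) r = epow x r * epow y r"
proof (cases "r = 0")
  case False
  assume "0 \<le> r"
  with False have r: "0 < r" by simp
  show ?thesis
    by (cases x rule: ennreal_cases; cases y rule: ennreal_cases)
      (use r in \<open>auto simp: epow_ennreal ennreal_mult[symmetric] powr_mult epow_eq_0_iff ennreal_mult_eq_top_iff
      ennreal_top_mult ennreal_mult_top ennreal_eq_0_iff split: if_splits\<close>)
qed simp

lemma epow_add: assumes "0 \<le> a" "0 \<le> b" shows "epow x (a + b) = epow x a * epow x b"
proof (cases "a = 0 \<or> b = 0")
  case False
  with assms have "0 < a" "0 < b" by auto
  then show ?thesis
    by (cases x rule: ennreal_cases)
      (auto simp: epow_ennreal ennreal_mult[symmetric] powr_add)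
qed auto

lemma epow_epow: assumes "0 \<le> a" "0 \<le> b" shows "epow (epow x a) b = epow x (a * b)"
proof (cases "a = 0 \<or> b = 0")
  case False
  with assms have "0 < a" "0 < b" by auto
  then show ?thesis
    by (cases x rule: ennreal_cases)
      (auto simp: epow_ennreal powr_powr)
qed auto

lemma measurable_epow [measurable (raw)]:
  assumes [measurable]: "f \<in> borel_measurable M" shows "(\<lambda>x. epow (f x) r) \<in> borel_measurable M"
  unfolding epow_def ennpowr_def infinity_ennreal_def by measurable

lemma epow_double_add: "0 \<le> r \<Longrightarrow> epow (x + y) r \<le> ennreal (2 powr r) * (epow x r + epow y r)"
proof -
  assume r: "0 \<le> r"
  have "epow (x + y) r \<le> epow (ennreal 2 * max x y) r"
    by (intro epow_mono r) (auto simp: max_def mult_2 intro: add_mono)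
  also have "\<dots> = ennreal (2 powr r) * epow (max x y) r"
    using r by (subst epow_mult) (auto simp: epow_ennreal_pos simp flip: ennreal_numeral)
  also have "\<dots> \<le> ennreal (2 powr r) * (epow x r + epow y r)"
    by (intro mult_left_mono) (auto simp: max_def add_increasing add_increasing2)
  finally show ?thesis .
qed

text \<open>After division by \<open>(a + b) powr r\<close> both summands are powers of numbers in
  the unit interval, where lowering the exponent to \<open>r\<close> increases the value; the
  numbers themselves add up to 1.\<close>

lemma powr_add_le_add_powr:
  fixes a b r :: real assumes "0 \<le> a" "0 \<le> b" "0 < r" "r \<le> 1"
  shows "(a + b) powr r \<le> a powr r + b powr r"
proof (cases "a = 0 \<or> b = 0")
  case False
  with assms have ab: "0 < a" "0 < b" by auto
  have A: "x powr r \<ge> x" if "0 < x" "x \<le> 1" for x :: real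
    using powr_mono'[of r 1 x] that assms by simp
  have "1 = a / (a + b) + b / (a + b)" using ab by (simp flip: add_divide_distrib)
  also have "\<dots> \<le> (a / (a + b)) powr r + (b / (a + b)) powr r"
    using ab by (intro add_mono A) auto
  also have "\<dots> = (a powr r + b powr r) / (a + b) powr r"
    using ab by (simp add: powr_divide add_divide_distrib)
  finally show ?thesis using ab by (simp add: field_simps)
qed (use assms in auto)

lemma epow_subadd: assumes "0 < r" "r \<le> 1" shows "epow (x + y) r \<le> epow x r + epow y r"
  using assms by (cases x rule: ennreal_cases; cases y rule: ennreal_cases)
    (auto simp: epow_ennreal ennreal_plus[symmetric] simp del: ennreal_plus intro!: ennreal_leI powr_add_le_add_powr)

lemma epow_sum_le: assumes "0 < r" "r \<le> 1" shows "epow (\<Sum>i<(n::nat). x i) r \<le> (\<Sum>i<n. epow (x i) r)"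
  by (induction n) (use assms in \<open>auto intro: order_trans[OF epow_subadd] add_right_mono\<close>)

text \<open>Exponents \<open>r\<close> and \<open>1 / r\<close> give mutually inverse monotone maps
  of \<open>ennreal\<close>. Later estimates remove and restore roots by this rule, and it reduces
  continuity and countable subadditivity to order properties.\<close>

lemma epow_le_iff: "0 < r \<Longrightarrow> epow x r \<le> y \<longleftrightarrow> x \<le> epow y (1 / r)"
proof
  assume r: "0 < r"
  { assume "epow x r \<le> y"
    then have "epow (epow x r) (1/r) \<le> epow y (1/r)" using r by (intro epow_mono) auto
    then show "x \<le> epow y (1/r)" using r by (simp add: epow_epow) }
  { assume "x \<le> epow y (1/r)"
    then have "epow x r \<le> epow (epow y (1/r)) r" using r by (intro epow_mono) auto
    then show "epow x r \<le> y" using r by (simp add: epow_epow) }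
qed

text \<open>Moving the power to the right-hand side leaves a supremum of partial sums on the left,
  so the finite case suffices. This treats the outer exponent \<open>1 / q\<close> on a sum over
  dyadic balls.\<close>

lemma epow_suminf_le:
  assumes "0 < r" "r \<le> 1" shows "epow (\<Sum>i. x i) r \<le> (\<Sum>i. epow (x i) r)"
proof -
  have "(\<Sum>i<n. x i) \<le> epow (\<Sum>i. epow (x i) r) (1/r)" for n
  proof -
    have "epow (\<Sum>i<n. x i) r \<le> (\<Sum>i<n. epow (x i) r)" by (rule epow_sum_le[OF assms])
    also have "\<dots> \<le> (\<Sum>i. epow (x i) r)" by (rule sum_le_suminf) auto
    finally show ?thesis using assms by (simp add: epow_le_iff)
  qed
  then have "(\<Sum>i. x i) \<le> epow (\<Sum>i. epow (x i) r) (1/r)"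
    unfolding suminf_eq_SUP by (intro SUP_least)
  then show ?thesis using assms by (simp add: epow_le_iff)
qed

lemma le_epow_iff: "0 < r \<Longrightarrow> y \<le> epow x r \<longleftrightarrow> epow y (1 / r) \<le> x"
  using epow_le_iff[of "1/r" y x] by simp

text \<open>Preimages of open rays are open rays by the two order rules, so the points 0 and
  \<open>top\<close> require no case distinction.\<close>

lemma tendsto_epow:
  assumes r: "0 < r" and f: "(f \<longlongrightarrow> x) F"
  shows "((\<lambda>y. epow (f y) r) \<longlongrightarrow> epow x r) F"
proof (rule order_tendstoI)
  fix a assume "a < epow x r"
  then have "epow a (1/r) < x" using r by (simp add: not_le[symmetric] epow_le_iff)
  from order_tendstoD(1)[OF f this] show "\<forall>\<^sub>F y in F. a < epow (f y) r"
    using r by (auto elim!: eventually_mono simp: not_le[symmetric] epow_le_iff)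
next
  fix a assume "epow x r < a"
  then have "x < epow a (1/r)" using r by (simp add: not_le[symmetric] le_epow_iff)
  from order_tendstoD(2)[OF f this] show "\<forall>\<^sub>F y in F. epow (f y) r < a"
    using r by (auto elim!: eventually_mono simp: not_le[symmetric] le_epow_iff)
qed

lemma epow_tendsto_0:
  "0 < r \<Longrightarrow> (f \<longlongrightarrow> 0) F \<Longrightarrow> ((\<lambda>x. epow (f x) r) \<longlongrightarrow> 0) F"
  using tendsto_epow[of r f 0 F] by simp

text \<open>Smallness arguments below end in a bound by a fixed finite constant times an arbitrary
  \<open>d\<close>; finiteness of the constant lets the product drop below any positive
  number.\<close>

lemma tendsto_0_ennrealI:
  fixes f :: "'a \<Rightarrow> ennreal"
  assumes "\<And>d. 0 < d \<Longrightarrow> \<forall>\<^sub>F x in F. f x \<le> ennreal K * ennreal d"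
  shows "(f \<longlongrightarrow> 0) F"
proof (rule order_tendstoI)
  fix e :: ennreal assume e: "0 < e"
  have "((\<lambda>d. ennreal K * ennreal d) \<longlongrightarrow> ennreal K * ennreal 0) (at_right 0)"
    by (intro ennreal_tendsto_cmult tendsto_ennrealI tendsto_ident_at) auto
  then have "\<forall>\<^sub>F d in at_right 0. ennreal K * ennreal d < e" using e by (intro order_tendstoD(2)) auto
  then have "\<forall>\<^sub>F d in at_right 0. 0 < d \<and> ennreal K * ennreal d < e"
    using eventually_at_right_less[of 0] by eventually_elim auto
  then obtain d where d: "0 < d" "ennreal K * ennreal d < e"
    using eventually_happens[of _ "at_right (0::real)"] by auto
  show "\<forall>\<^sub>F x in F. f x < e" using assms[OF d(1)] by eventually_elim (use d(2) in auto)
qed simp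

section \<open>The inequalities of Hoelder and Jensen\<close>

text \<open>Convexity of \<open>exp\<close> at the points \<open>ln (x i)\<close>. A vanishing
  \<open>x i\<close> has no logarithm and is treated first; it makes the product 0.\<close>

lemma weighted_arith_geom_mean:
  fixes x w :: "'i \<Rightarrow> real"
  assumes "finite I" "\<And>i. i \<in> I \<Longrightarrow> 0 \<le> x i" "\<And>i. i \<in> I \<Longrightarrow> 0 < w i" "(\<Sum>i\<in>I. w i) = 1"
  shows "(\<Prod>i\<in>I. x i powr w i) \<le> (\<Sum>i\<in>I. w i * x i)"
proof (cases "\<exists>i\<in>I. x i = 0")
  case True
  then have "(\<Prod>i\<in>I. x i powr w i) = 0" using assms(1) by (auto simp: prod_zero_iff)
  also have "\<dots> \<le> (\<Sum>i\<in>I. w i * x i)" using assms by (intro sum_nonneg) (simp add: less_imp_le)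
  finally show ?thesis .
next
  case False
  then have pos: "0 < x i" if "i \<in> I" for i using assms(2)[OF that] that by force
  have "(\<Prod>i\<in>I. x i powr w i) = exp (\<Sum>i\<in>I. w i *\<^sub>R ln (x i))"
    using assms(1) pos by (auto simp: exp_sum powr_def dest!: pos intro!: prod.cong)
  also have "\<dots> \<le> (\<Sum>i\<in>I. w i * exp (ln (x i)))"
    using assms pos by (intro convex_on_sum[OF _ _ exp_convex]) (auto simp: less_imp_le)
  also have "\<dots> = (\<Sum>i\<in>I. w i * x i)" using pos by (intro sum.cong) auto
  finally show ?thesis .
qed

lemma epow_weighted_arith_geom_mean:
  fixes x :: "'i \<Rightarrow> ennreal" and w :: "'i \<Rightarrow> real"
  assumes "finite I" "\<And>i. i \<in> I \<Longrightarrow> 0 < w i" "(\<Sum>i\<in>I. w i) = 1"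
  shows "(\<Prod>i\<in>I. epow (x i) (w i)) \<le> (\<Sum>i\<in>I. ennreal (w i) * x i)"
proof (cases "\<exists>i\<in>I. x i = top")
  case True
  then obtain i where i: "i \<in> I" "x i = top" by blast
  then have "ennreal (w i) * x i = top" using assms(2)[of i] by (simp add: ennreal_mult_top)
  then have "(\<Sum>i\<in>I. ennreal (w i) * x i) = top"
    using i assms(1) by (simp add: sum.remove[of I i])
  then show ?thesis by simp
next
  case False
  define y where "y i = enn2real (x i)" for i
  have xy: "x i = ennreal (y i)" if "i \<in> I" for i
    using False that by (simp add: y_def less_top)
  have y: "0 \<le> y i" for i by (simp add: y_def)
  have "(\<Prod>i\<in>I. epow (x i) (w i)) = ennreal (\<Prod>i\<in>I. y i powr w i)"
    using assms y by (auto simp: xy epow_ennreal prod_ennreal[symmetric] intro!: prod.cong)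
  also have "\<dots> \<le> ennreal (\<Sum>i\<in>I. w i * y i)"
    using assms y by (intro ennreal_leI weighted_arith_geom_mean) auto
  also have "\<dots> = (\<Sum>i\<in>I. ennreal (w i) * x i)"
    using assms y by (auto simp: xy ennreal_mult' less_imp_le sum_ennreal[symmetric] intro!: sum.cong)
  finally show ?thesis .
qed

text \<open>Normalised by its integral, each factor has integral 1, and the pointwise inequality
  between geometric and arithmetic means integrates to the claim. Normalisation needs integrals
  other than 0 and \<open>top\<close>. A zero integral is treated before an infinite one, because
  \<open>0 * top = 0\<close> makes the right-hand side 0 as well.\<close>

lemma nn_integral_Holder_pos:
  fixes f :: "'i \<Rightarrow> 'a \<Rightarrow> ennreal" and w :: "'i \<Rightarrow> real"
  assumes I: "finite I" "\<And>i. i \<in> I \<Longrightarrow> 0 < w i" "(\<Sum>i\<in>I. w i) = 1"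
    and [measurable]: "\<And>i. i \<in> I \<Longrightarrow> f i \<in> borel_measurable M"
  shows "(\<integral>\<^sup>+x. (\<Prod>i\<in>I. epow (f i x) (w i)) \<partial>M) \<le> (\<Prod>i\<in>I. epow (\<integral>\<^sup>+x. f i x \<partial>M) (w i))"
proof -
  define A where "A i = (\<integral>\<^sup>+x. f i x \<partial>M)" for i
  consider (zero) i where "i \<in> I" "A i = 0" | (top) i where "i \<in> I" "A i = top" "\<forall>j\<in>I. A j \<noteq> 0"
    | (fin) "\<forall>j\<in>I. A j \<noteq> 0 \<and> A j \<noteq> top" by blast
  then show ?thesis
  proof cases
    case zero
    then have "AE x in M. f i x = 0" unfolding A_def by (subst (asm) nn_integral_0_iff_AE) auto
    then have "AE x in M. (\<Prod>i\<in>I. epow (f i x) (w i)) = 0"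
      by eventually_elim (use zero I in \<open>auto simp: prod_zero_iff intro!: bexI[of _ i]\<close>)
    then have "(\<integral>\<^sup>+x. (\<Prod>i\<in>I. epow (f i x) (w i)) \<partial>M) = (\<integral>\<^sup>+x. 0 \<partial>M)"
      by (rule nn_integral_cong_AE)
    then show ?thesis by simp
  next
    case top
    have "(\<Prod>i\<in>I. epow (A i) (w i)) = top"
      using top I by (subst ennreal_prod_eq_top) (auto simp: epow_eq_0_iff intro!: bexI[of _ i])
    then show ?thesis unfolding A_def by simp
  next
    case fin
    have "(\<Prod>i\<in>I. epow (f i x) (w i)) \<le> (\<Prod>i\<in>I. epow (A i) (w i)) * (\<Sum>i\<in>I. ennreal (w i) * (f i x / A i))" for x
    proof -
      have "(\<Prod>i\<in>I. epow (f i x) (w i)) = (\<Prod>i\<in>I. epow (A i * (f i x / A i)) (w i))"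
        using fin by (intro prod.cong refl arg_cong2[where f=epow])
          (auto simp: ennreal_times_divide mult.commute[of "A _"] ennreal_mult_divide_eq)
      also have "\<dots> = (\<Prod>i\<in>I. epow (A i) (w i)) * (\<Prod>i\<in>I. epow (f i x / A i) (w i))"
        using I by (simp add: epow_mult less_imp_le prod.distrib)
      also have "\<dots> \<le> (\<Prod>i\<in>I. epow (A i) (w i)) * (\<Sum>i\<in>I. ennreal (w i) * (f i x / A i))"
        using I by (intro mult_left_mono epow_weighted_arith_geom_mean) auto
      finally show ?thesis .
    qed
    then have "(\<integral>\<^sup>+x. (\<Prod>i\<in>I. epow (f i x) (w i)) \<partial>M) \<le>
        (\<integral>\<^sup>+x. (\<Prod>i\<in>I. epow (A i) (w i)) * (\<Sum>i\<in>I. ennreal (w i) * (f i x / A i)) \<partial>M)"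
      by (intro nn_integral_mono)
    also have "\<dots> = (\<Prod>i\<in>I. epow (A i) (w i)) * (\<Sum>i\<in>I. ennreal (w i) * (A i / A i))"
      unfolding A_def by (simp add: nn_integral_cmult nn_integral_sum nn_integral_divide)
    also have "(\<Sum>i\<in>I. ennreal (w i) * (A i / A i)) = (\<Sum>i\<in>I. ennreal (w i))"
      using fin by (intro sum.cong) (auto simp: ennreal_divide_self less_top zero_less_iff_neq_zero)
    also have "\<dots> = 1" using I by (subst sum_ennreal) (auto simp: less_imp_le)
    finally show ?thesis unfolding A_def by simp
  qed
qed

text \<open>A factor with weight 0 equals 1 by the convention for \<open>epow\<close> and drops out
  on both sides. Zero weights do occur in \<open>grid_lines\<close>, namely when the exponent left
  for \<open>F\<close> is 0.\<close>

lemma nn_integral_Holder: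
  fixes f :: "'i \<Rightarrow> 'a \<Rightarrow> ennreal" and w :: "'i \<Rightarrow> real"
  assumes I: "finite I" "\<And>i. i \<in> I \<Longrightarrow> 0 \<le> w i" "(\<Sum>i\<in>I. w i) = 1"
    and meas: "\<And>i. i \<in> I \<Longrightarrow> f i \<in> borel_measurable M"
  shows "(\<integral>\<^sup>+x. (\<Prod>i\<in>I. epow (f i x) (w i)) \<partial>M) \<le> (\<Prod>i\<in>I. epow (\<integral>\<^sup>+x. f i x \<partial>M) (w i))"
proof -
  define J where "J = {i\<in>I. 0 < w i}"
  have eq: "(\<Prod>i\<in>I. epow (g i) (w i)) = (\<Prod>i\<in>J. epow (g i) (w i))" for g :: "'i \<Rightarrow> ennreal"
    using I(1,2) by (intro prod.mono_neutral_right) (auto simp: J_def, metis epow_0 order_less_le)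
  have "(\<Sum>i\<in>J. w i) = (\<Sum>i\<in>I. w i)"
    using I(1,2) by (intro sum.mono_neutral_left) (auto simp: J_def, metis order_less_le)
  with I meas show ?thesis unfolding eq
    by (intro nn_integral_Holder_pos) (auto simp: J_def)
qed

lemma nn_integral_Holder2:
  fixes f g :: "'a \<Rightarrow> ennreal"
  assumes "0 \<le> a" "a \<le> 1" and [measurable]: "f \<in> borel_measurable M" "g \<in> borel_measurable M"
  shows "(\<integral>\<^sup>+x. epow (f x) a * epow (g x) (1 - a) \<partial>M) \<le>
    epow (\<integral>\<^sup>+x. f x \<partial>M) a * epow (\<integral>\<^sup>+x. g x \<partial>M) (1 - a)"
  using nn_integral_Holder[of "UNIV :: bool set" "\<lambda>b. if b then a else 1 - a" "\<lambda>b. if b then f else g" M] assms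
  by (simp add: UNIV_bool if_distribR mult.commute cong: if_cong)

text \<open>Hoelder's inequality for the splitting of \<open>f * g\<close> into the power
  \<open>1/t\<close> of \<open>epow f t * g\<close> and the power \<open>1 - 1/t\<close> of
  \<open>g\<close>. In the applications the weight \<open>g\<close> has mass 1 and the first factor
  disappears.\<close>

lemma nn_integral_Jensen:
  fixes f g :: "'a \<Rightarrow> ennreal"
  assumes "1 \<le> t" and [measurable]: "f \<in> borel_measurable M" "g \<in> borel_measurable M"
  shows "epow (\<integral>\<^sup>+x. f x * g x \<partial>M) t \<le> epow (\<integral>\<^sup>+x. g x \<partial>M) (t - 1) * (\<integral>\<^sup>+x. epow (f x) t * g x \<partial>M)"
proof -
  have "f x * g x = epow (epow (f x) t * g x) (1/t) * epow (g x) (1 - 1/t)" for x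
    using assms(1) epow_add[of "1/t" "1 - 1/t" "g x"] by (simp add: epow_mult epow_epow mult.assoc)
  then have "(\<integral>\<^sup>+x. f x * g x \<partial>M) \<le> epow (\<integral>\<^sup>+x. epow (f x) t * g x \<partial>M) (1/t) * epow (\<integral>\<^sup>+x. g x \<partial>M) (1 - 1/t)"
    using assms(1) by (simp only:) (rule nn_integral_Holder2, auto)
  then have "epow (\<integral>\<^sup>+x. f x * g x \<partial>M) t \<le> epow (epow (\<integral>\<^sup>+x. epow (f x) t * g x \<partial>M) (1/t) * epow (\<integral>\<^sup>+x. g x \<partial>M) (1 - 1/t)) t"
    using assms(1) by (intro epow_mono) auto
  also have "\<dots> = epow (\<integral>\<^sup>+x. g x \<partial>M) (t - 1) * (\<integral>\<^sup>+x. epow (f x) t * g x \<partial>M)"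
    using assms(1) by (simp add: epow_mult epow_epow mult.commute right_diff_distrib)
  finally show ?thesis .
qed

section \<open>The Sobolev inequality\<close>

text \<open>A Loomis--Whitney inequality. For each new coordinate, Hoelder's inequality in that coordinate alone
  reproduces the statement for the partial integral of \<open>F\<close>; the exponent of \<open>F\<close> makes the weights add up to 1.\<close>

lemma grid_lines:
  fixes F :: "('i \<Rightarrow> real) \<Rightarrow> ennreal"
  assumes "finite I" "0 \<le> p" "(real (card I) - 1) * p \<le> 1"
    and "F \<in> borel_measurable (PiM I (\<lambda>_. lborel))"
  shows "(\<integral>\<^sup>+x. epow (F x) (1 - (real (card I) - 1) * p) *
      (\<Prod>i\<in>I. epow (\<integral>\<^sup>+t. F (x(i := t)) \<partial>lborel) p) \<partial>PiM I (\<lambda>_. lborel))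
    \<le> epow (\<integral>\<^sup>+x. F x \<partial>PiM I (\<lambda>_. lborel)) (1 + p)"
  using assms
proof (induction I arbitrary: F rule: finite_induct)
  case empty
  interpret finite_product_sigma_finite "\<lambda>_::'i. lborel :: real measure" "{}" by standard simp
  have "(\<integral>\<^sup>+x. G x \<partial>PiM {} (\<lambda>_. lborel :: real measure)) = G (\<lambda>_. undefined)" for G :: "('i \<Rightarrow> real) \<Rightarrow> ennreal"
  proof -
    have "(\<integral>\<^sup>+x. G x \<partial>PiM {} (\<lambda>_. lborel :: real measure)) = (\<integral>\<^sup>+(x :: 'i \<Rightarrow> real). G (\<lambda>_. undefined) \<partial>PiM {} (\<lambda>_. lborel :: real measure))"
      by (intro nn_integral_cong) (auto simp: space_PiM_empty)
    then show ?thesis by (simp add: space_PiM_empty)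
  qed
  then show ?case by simp
next
  case (insert i I)
  interpret product_sigma_finite "\<lambda>_::'i. lborel :: real measure" by standard
  interpret I: finite_product_sigma_finite "\<lambda>_::'i. lborel :: real measure" I by standard fact
  interpret pair_sigma_finite "PiM I (\<lambda>_::'i. lborel :: real measure)" "lborel :: real measure" ..
  note [measurable] = insert.prems(3)
  let ?n = "real (card I)"
  have np: "?n * p \<le> 1" "0 \<le> p" using insert by simp_all
  have "(?n - 1) * p \<le> 1" using np by (simp add: algebra_simps)
  have m1[measurable]: "(\<lambda>x. F ((g x)(i := h x))) \<in> borel_measurable M"
    if [measurable]: "g \<in> measurable M (PiM I (\<lambda>_. lborel))" "h \<in> measurable M (lborel::real measure)" for g h and M :: "'b measure"
  proof -
    have [measurable]: "(\<lambda>x. (g x)(i := h x)) \<in> measurable M (PiM (insert i I) (\<lambda>_. lborel))"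
      by (rule measurable_fun_upd[where J=I, OF _ that]) auto
    show ?thesis by measurable
  qed
  have m2[measurable]: "(\<lambda>x. (g x)(j := h x)) \<in> measurable M (PiM I (\<lambda>_. lborel))"
    if "j \<in> I" and [measurable]: "g \<in> measurable M (PiM I (\<lambda>_. lborel))" "h \<in> measurable M (lborel::real measure)"
    for g h j and M :: "'b measure"
    using that by (intro measurable_fun_upd[where J=I]) auto
  define G where "G x = (\<integral>\<^sup>+t. F (x(i := t)) \<partial>lborel)" for x
  have G_meas[measurable]: "(\<lambda>x. G (g x)) \<in> borel_measurable M"
    if [measurable]: "g \<in> measurable M (PiM I (\<lambda>_. lborel))" for g and M :: "'b measure"
    unfolding G_def by measurable
  let ?L = "\<lambda>x. epow (F x) (1 - (real (card (insert i I)) - 1) * p) *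
      (\<Prod>j\<in>insert i I. epow (\<integral>\<^sup>+t. F (x(j := t)) \<partial>lborel) p)"
  have upd[measurable]: "(\<lambda>x. (g x)(j := h x)) \<in> measurable M (PiM (insert i I) (\<lambda>_. lborel))"
    if "j \<in> insert i I" and [measurable]: "g \<in> measurable M (PiM (insert i I) (\<lambda>_. lborel))" "h \<in> measurable M (lborel::real measure)"
    for g h j and M :: "'b measure"
    using that by (intro measurable_fun_upd[where J="insert i I"]) auto
  have [measurable]: "?L \<in> borel_measurable (PiM (insert i I) (\<lambda>_. lborel))"
    by (intro borel_measurable_times_ennreal borel_measurable_prod_ennreal measurable_epow
        lborel.borel_measurable_nn_integral insert.prems)
      (auto simp: case_prod_beta' intro!: measurable_compose[OF upd insert.prems(3)])
  have "(\<integral>\<^sup>+x. ?L x \<partial>PiM (insert i I) (\<lambda>_. lborel)) =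
      (\<integral>\<^sup>+x. (\<integral>\<^sup>+y. ?L (x(i := y)) \<partial>lborel) \<partial>PiM I (\<lambda>_. lborel))"
    using insert.hyps by (intro product_nn_integral_insert) auto
  also have "\<dots> \<le> (\<integral>\<^sup>+x. epow (G x) (1 - (?n - 1) * p) *
      (\<Prod>j\<in>I. epow (\<integral>\<^sup>+t. G (x(j := t)) \<partial>lborel) p) \<partial>PiM I (\<lambda>_. lborel))"
  proof (rule nn_integral_mono)
    fix x :: "'i \<Rightarrow> real" assume x: "x \<in> space (PiM I (\<lambda>_. lborel))"
    \<comment> \<open>In the new coordinate \<open>y\<close> the line integral in direction
      \<open>i\<close> is constant and equals \<open>G x\<close>. What remains is a product of
      powers of the functions \<open>H k\<close>: exponent \<open>1 - ?n * p\<close> for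
      \<open>F\<close> itself and \<open>p\<close> for each of the \<open>?n\<close> old directions,
      which add up to 1.\<close>
    define H where "H k y = (if k = i then F (x(i := y)) else \<integral>\<^sup>+s. F (x(k := s, i := y)) \<partial>lborel)" for k y
    define w where "w k = (if k = i then 1 - ?n * p else p)" for k
    have xm: "(\<lambda>_. x) \<in> measurable M (PiM I (\<lambda>_. lborel))" for M :: "'b measure"
      using x by (intro measurable_const)
    have xm2: "(\<lambda>y. x(k := h y)) \<in> measurable M (PiM I (\<lambda>_. lborel))" if "k \<in> I" "h \<in> measurable M (lborel::real measure)" for k h and M :: "'b measure"
      by (rule m2[OF that(1) xm that(2)])
    have Hm: "H k \<in> borel_measurable lborel" if k: "k \<in> insert i I" for k
    proof (cases "k = i")
      case True
      then show ?thesis unfolding H_def by (simp, intro m1 xm) auto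
    next
      case False
      have "(\<lambda>z. F (x(k := snd z, i := fst z))) \<in> borel_measurable (lborel \<Otimes>\<^sub>M lborel)"
        using k False by (intro m1 xm2) auto
      then have "(\<lambda>y. \<integral>\<^sup>+s. F (x(k := s, i := y)) \<partial>lborel) \<in> borel_measurable lborel"
        by (intro lborel.borel_measurable_nn_integral) (simp add: case_prod_beta')
      then show ?thesis using False by (simp add: H_def[abs_def])
    qed
    have wsum: "(\<Sum>k\<in>insert i I. w k) = 1"
    proof -
      have "(\<Sum>k\<in>I. w k) = (\<Sum>k\<in>I. p)" using insert.hyps by (intro sum.cong) (auto simp: w_def)
      then show ?thesis using insert.hyps by (simp add: w_def)
    qed
    have eq: "?L (x(i := y)) = epow (G x) p * (\<Prod>k\<in>insert i I. epow (H k y) (w k))" for y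
    proof -
      have "(\<Prod>j\<in>I. epow (\<integral>\<^sup>+t. F (x(i := y, j := t)) \<partial>lborel) p) = (\<Prod>k\<in>I. epow (H k y) (w k))"
        using insert.hyps by (intro prod.cong refl) (auto simp: H_def w_def fun_upd_twist)
      then show ?thesis
        using insert.hyps by (simp add: H_def w_def G_def mult_ac)
    qed
    have "(\<integral>\<^sup>+y. ?L (x(i := y)) \<partial>lborel) = epow (G x) p * (\<integral>\<^sup>+y. (\<Prod>k\<in>insert i I. epow (H k y) (w k)) \<partial>lborel)"
      unfolding eq using insert.hyps
      by (intro nn_integral_cmult borel_measurable_prod_ennreal measurable_epow Hm) auto
    also have "\<dots> \<le> epow (G x) p * (\<Prod>k\<in>insert i I. epow (\<integral>\<^sup>+y. H k y \<partial>lborel) (w k))"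
      using insert.hyps np wsum Hm by (intro mult_left_mono nn_integral_Holder) (auto simp: w_def)
    also have "(\<Prod>k\<in>insert i I. epow (\<integral>\<^sup>+y. H k y \<partial>lborel) (w k)) =
        epow (G x) (1 - ?n * p) * (\<Prod>k\<in>I. epow (\<integral>\<^sup>+t. G (x(k := t)) \<partial>lborel) p)"
    proof -
      have "epow (\<integral>\<^sup>+y. H k y \<partial>lborel) (w k) = epow (\<integral>\<^sup>+t. G (x(k := t)) \<partial>lborel) p" if "k \<in> I" for k
      proof -
        have "(\<integral>\<^sup>+y. H k y \<partial>lborel) = (\<integral>\<^sup>+y. \<integral>\<^sup>+s. F (x(k := s, i := y)) \<partial>lborel \<partial>lborel)"
          using that insert.hyps by (intro nn_integral_cong) (auto simp: H_def)
        also have "\<dots> = (\<integral>\<^sup>+s. \<integral>\<^sup>+y. F (x(k := s, i := y)) \<partial>lborel \<partial>lborel)"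
          using that by (intro lborel_pair.Fubini') (auto simp: case_prod_beta' intro!: m1 xm2)
        finally show ?thesis using that insert.hyps by (auto simp: w_def G_def)
      qed
      then show ?thesis using insert.hyps by (simp add: H_def w_def G_def)
    qed
    \<comment> \<open>The constant factor raises the exponent of \<open>G x\<close> from
      \<open>1 - ?n * p\<close> to the value required for the smaller index set.\<close>
    also have "epow (G x) p * (epow (G x) (1 - ?n * p) * (\<Prod>k\<in>I. epow (\<integral>\<^sup>+t. G (x(k := t)) \<partial>lborel) p)) =
        epow (G x) (1 - (?n - 1) * p) * (\<Prod>k\<in>I. epow (\<integral>\<^sup>+t. G (x(k := t)) \<partial>lborel) p)"
    proof -
      have "p + (1 - ?n * p) = 1 - (?n - 1) * p" by (simp add: algebra_simps)
      moreover have "epow (G x) (p + (1 - ?n * p)) = epow (G x) p * epow (G x) (1 - ?n * p)"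
        using np by (intro epow_add) auto
      ultimately have "epow (G x) (1 - (?n - 1) * p) = epow (G x) p * epow (G x) (1 - ?n * p)"
        by (simp only:)
      then show ?thesis by (simp only: mult.assoc)
    qed
    finally show "(\<integral>\<^sup>+y. ?L (x(i := y)) \<partial>lborel) \<le> \<dots>" .
  qed
  also have "\<dots> \<le> epow (\<integral>\<^sup>+x. G x \<partial>PiM I (\<lambda>_. lborel)) (1 + p)"
    using \<open>(?n - 1) * p \<le> 1\<close> np by (intro insert.IH) auto
  also have "(\<integral>\<^sup>+x. G x \<partial>PiM I (\<lambda>_. lborel)) = (\<integral>\<^sup>+x. F x \<partial>PiM (insert i I) (\<lambda>_. lborel))"
    unfolding G_def using insert.hyps by (subst product_nn_integral_insert) auto
  finally show ?case .
qed

section \<open>Lebesgue measure in coordinates and the product bound over lines\<close>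

lemma nn_integral_lborel_PiM:
  fixes F :: "'a::euclidean_space \<Rightarrow> ennreal"
  assumes "F \<in> borel_measurable borel"
  shows "(\<integral>\<^sup>+x. F x \<partial>lborel) = (\<integral>\<^sup>+f. F (\<Sum>b\<in>Basis. f b *\<^sub>R b) \<partial>PiM Basis (\<lambda>_. lborel))"
  using assms by (subst lborel_def) (simp add: nn_integral_distr lborel_eq_real)

lemma nn_integral_shift:
  fixes F :: "'a::euclidean_space \<Rightarrow> ennreal"
  assumes [measurable]: "F \<in> borel_measurable borel"
  shows "(\<integral>\<^sup>+x. F (c + x) \<partial>lborel) = (\<integral>\<^sup>+x. F x \<partial>lborel)"
  by (subst (2) lborel_distr_plus[of c, symmetric]) (simp add: nn_integral_distr)

lemma sum_Basis_upd:
  fixes f :: "'a::euclidean_space \<Rightarrow> real"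
  assumes "i \<in> Basis"
  shows "(\<Sum>b\<in>Basis. (f(i := t)) b *\<^sub>R b) = (\<Sum>b\<in>Basis. f b *\<^sub>R b) + (t - f i) *\<^sub>R i"
proof -
  have "(\<Sum>b\<in>Basis. (f(i := t)) b *\<^sub>R b) = (\<Sum>b\<in>Basis. f b *\<^sub>R b + (if b = i then (t - f i) *\<^sub>R i else 0))"
    by (intro sum.cong) (auto simp: algebra_simps)
  then show ?thesis using assms by (simp add: sum.distrib sum.delta)
qed

text \<open>Replacing a coordinate and adding a multiple of the basis vector parametrise the same
  line, with parameters that differ by \<open>f i\<close>.\<close>

lemma nn_integral_line:
  fixes F :: "'a::euclidean_space \<Rightarrow> ennreal"
  assumes [measurable]: "F \<in> borel_measurable borel" and i: "i \<in> Basis"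
  shows "(\<integral>\<^sup>+t. F (\<Sum>b\<in>Basis. (f(i := t)) b *\<^sub>R b) \<partial>lborel) = (\<integral>\<^sup>+t. F ((\<Sum>b\<in>Basis. f b *\<^sub>R b) + t *\<^sub>R i) \<partial>lborel)"
  unfolding sum_Basis_upd[OF i]
  by (subst (2) nn_integral_shift[of _ "- f i", symmetric]) (auto intro!: nn_integral_cong simp: algebra_simps)

text \<open>Gagliardo's argument: the power \<open>N / (N - 1)\<close> of \<open>u\<close> is a
  product of \<open>N\<close> factors with exponent \<open>1 / (N - 1)\<close>, and each direction
  bounds one of them. With this exponent \<open>p\<close> the power of \<open>F\<close> itself in
  \<open>grid_lines\<close> is 0.\<close>

lemma nn_integral_line_prod_le:
  fixes u F :: "'a::euclidean_space \<Rightarrow> ennreal"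
  assumes n: "2 \<le> DIM('a)" and [measurable]: "F \<in> borel_measurable borel" "u \<in> borel_measurable borel"
    and le: "\<And>x i. i \<in> Basis \<Longrightarrow> u x \<le> (\<integral>\<^sup>+t. F (x + t *\<^sub>R i) \<partial>lborel)"
  shows "(\<integral>\<^sup>+x. epow (u x) (real DIM('a) / (real DIM('a) - 1)) \<partial>lborel) \<le> epow (\<integral>\<^sup>+x. F x \<partial>lborel) (real DIM('a) / (real DIM('a) - 1))"
proof -
  let ?n = "real DIM('a)"
  define p where "p = 1 / (?n - 1)"
  have p: "0 \<le> p" "(?n - 1) * p = 1" "1 + p = ?n / (?n - 1)" "?n * p = ?n / (?n - 1)"
    using n by (auto simp: p_def field_simps)
  define T :: "('a \<Rightarrow> real) \<Rightarrow> 'a" where "T f = (\<Sum>b\<in>Basis. f b *\<^sub>R b)" for f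
  have T[measurable]: "T \<in> measurable (PiM Basis (\<lambda>_. lborel)) borel"
    unfolding T_def by measurable
  have "(\<integral>\<^sup>+x. epow (u x) (?n / (?n - 1)) \<partial>lborel) = (\<integral>\<^sup>+f. epow (u (T f)) (?n / (?n - 1)) \<partial>PiM Basis (\<lambda>_. lborel))"
    unfolding T_def by (rule nn_integral_lborel_PiM) measurable
  also have "\<dots> \<le> (\<integral>\<^sup>+f. epow (F (T f)) (1 - (real (card (Basis :: 'a set)) - 1) * p) *
      (\<Prod>i\<in>Basis. epow (\<integral>\<^sup>+t. F (T (f(i := t))) \<partial>lborel) p) \<partial>PiM Basis (\<lambda>_. lborel))"
  proof (rule nn_integral_mono)
    fix f :: "'a \<Rightarrow> real"
    have "epow (u (T f)) (?n / (?n - 1)) = (\<Prod>i\<in>(Basis :: 'a set). epow (u (T f)) p)"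
    proof -
      have "epow (\<Prod>i\<in>(Basis :: 'a set). epow (u (T f)) p) 1 = epow (u (T f)) (?n * p)" 
      proof -
        have "epow (u (T f)) (real k * p) = epow (u (T f)) p ^ k" for k
          using p by (induction k) (auto simp: distrib_right epow_add)
        then show ?thesis by simp
      qed
      then show ?thesis using p by simp
    qed
    also have "\<dots> \<le> (\<Prod>i\<in>(Basis :: 'a set). epow (\<integral>\<^sup>+t. F (T (f(i := t))) \<partial>lborel) p)"
    proof (intro prod_mono_ennreal epow_mono p)
      fix i :: 'a assume i: "i \<in> Basis"
      have "u (T f) \<le> (\<integral>\<^sup>+t. F (T f + t *\<^sub>R i) \<partial>lborel)" using i by (rule le)
      also have "\<dots> = (\<integral>\<^sup>+t. F (T (f(i := t))) \<partial>lborel)"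
        unfolding T_def using i by (intro nn_integral_line[symmetric]) auto
      finally show "u (T f) \<le> \<dots>" .
    qed
    finally show "epow (u (T f)) (?n / (?n - 1)) \<le> epow (F (T f)) (1 - (real (card (Basis :: 'a set)) - 1) * p) *
      (\<Prod>i\<in>Basis. epow (\<integral>\<^sup>+t. F (T (f(i := t))) \<partial>lborel) p)"
      using p by simp
  qed
  also have "\<dots> \<le> epow (\<integral>\<^sup>+f. F (T f) \<partial>PiM Basis (\<lambda>_. lborel)) (1 + p)"
    using p by (intro grid_lines) auto
  also have "(\<integral>\<^sup>+f. F (T f) \<partial>PiM Basis (\<lambda>_. lborel)) = (\<integral>\<^sup>+x. F x \<partial>lborel)"
    unfolding T_def by (rule nn_integral_lborel_PiM[symmetric]) measurable
  finally show ?thesis using p by simp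
qed

section \<open>Continuously differentiable functions along lines\<close>

lemma FTC_norm_le:
  fixes F f :: "real \<Rightarrow> 'a::euclidean_space"
  assumes "a \<le> b" "\<And>x. a \<le> x \<Longrightarrow> x \<le> b \<Longrightarrow> (F has_vector_derivative f x) (at x)" "continuous_on {a..b} f"
  shows "ennreal (norm (F b - F a)) \<le> (\<integral>\<^sup>+x. ennreal (norm (f x)) * indicator {a..b} x \<partial>lborel)"
proof -
  have h: "has_bochner_integral lborel (\<lambda>x. indicator {a .. b} x *\<^sub>R f x) (F b - F a)"
    using assms by (intro has_bochner_integral_FTC_Icc) (auto intro: has_vector_derivative_at_within)
  then have "ennreal (norm (F b - F a)) \<le> (\<integral>\<^sup>+x. norm (indicator {a .. b} x *\<^sub>R f x) \<partial>lborel)"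
    using integral_norm_bound_ennreal[of lborel "\<lambda>x. indicator {a .. b} x *\<^sub>R f x"]
    by (simp add: has_bochner_integral_iff)
  also have "\<dots> = (\<integral>\<^sup>+x. ennreal (norm (f x)) * indicator {a..b} x \<partial>lborel)"
    by (intro nn_integral_cong) (auto simp: indicator_def)
  finally show ?thesis .
qed

text \<open>Continuity of \<open>g\<close> is included so that differences of \<open>u\<close> are
  integrals of \<open>g\<close> along segments. The derivative is given as a vector field, which can
  be mollified, translated and compared with a fixed vector.\<close>

definition has_gradient :: "('a::euclidean_space \<Rightarrow> real) \<Rightarrow> ('a \<Rightarrow> 'a) \<Rightarrow> bool" where
  "has_gradient u g \<longleftrightarrow> continuous_on UNIV g \<and> (\<forall>x. (u has_derivative (\<lambda>h. g x \<bullet> h)) (at x))"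

lemma has_gradient_continuous: "has_gradient u g \<Longrightarrow> continuous_on UNIV u"
  unfolding has_gradient_def by (auto intro!: continuous_at_imp_continuous_on dest: has_derivative_continuous)

lemma has_gradient_line:
  assumes "has_gradient u g"
  shows "((\<lambda>t. u (x + t *\<^sub>R h)) has_vector_derivative (g (x + t *\<^sub>R h) \<bullet> h)) (at t)"
proof -
  have "((\<lambda>t. x + t *\<^sub>R h) has_derivative (\<lambda>s. s *\<^sub>R h)) (at t)"
    by (auto intro!: derivative_eq_intros)
  then have "(u \<circ> (\<lambda>t. x + t *\<^sub>R h) has_derivative ((\<lambda>k. g (x + t *\<^sub>R h) \<bullet> k) \<circ> (\<lambda>s. s *\<^sub>R h))) (at t)"
    using assms by (intro diff_chain_at) (auto simp: has_gradient_def)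
  then show ?thesis by (simp add: has_vector_derivative_def o_def)
qed

lemma has_gradient_line_bound:
  fixes u :: "'a::euclidean_space \<Rightarrow> real"
  assumes u: "has_gradient u g" and supp: "bounded {x. u x \<noteq> 0}" and i: "norm i = 1"
  shows "ennreal \<bar>u x\<bar> \<le> (\<integral>\<^sup>+t. ennreal (norm (g (x + t *\<^sub>R i))) \<partial>lborel)"
proof -
  obtain M where M: "\<And>y. u y \<noteq> 0 \<Longrightarrow> norm y \<le> M" using supp by (auto simp: bounded_iff)
  \<comment> \<open>So far out that \<open>x + a *\<^sub>R i\<close> lies outside the bounded
    support.\<close>
  define a where "a = - (norm x + \<bar>M\<bar> + 1)"
  have "a \<le> 0" unfolding a_def using norm_ge_zero[of x] by linarith
  have "\<bar>a\<bar> - norm x \<le> norm (x + a *\<^sub>R i)"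
    using norm_triangle_ineq2[of "a *\<^sub>R i" "- x"] i by (simp add: add.commute)
  then have "u (x + a *\<^sub>R i) = 0" using M[of "x + a *\<^sub>R i"] norm_ge_zero[of x] unfolding a_def by linarith
  have c: "continuous_on S (\<lambda>t. g (x + t *\<^sub>R i))" for S
    using u unfolding has_gradient_def by (auto intro!: continuous_intros continuous_on_compose2[of UNIV g])
  have "ennreal (norm (u (x + 0 *\<^sub>R i) - u (x + a *\<^sub>R i))) \<le> (\<integral>\<^sup>+t. ennreal (norm (g (x + t *\<^sub>R i) \<bullet> i)) * indicator {a..0} t \<partial>lborel)"
    using \<open>a \<le> 0\<close> by (intro FTC_norm_le has_gradient_line[OF u] continuous_intros c) auto
  also have "\<dots> \<le> (\<integral>\<^sup>+t. ennreal (norm (g (x + t *\<^sub>R i))) \<partial>lborel)"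
  proof (intro nn_integral_mono)
    fix t show "ennreal (norm (g (x + t *\<^sub>R i) \<bullet> i)) * indicator {a..0} t \<le> ennreal (norm (g (x + t *\<^sub>R i)))"
      using Cauchy_Schwarz_ineq2[of "g (x + t *\<^sub>R i)" i] i by (auto simp: indicator_def intro!: ennreal_leI)
  qed
  finally show ?thesis using \<open>u (x + a *\<^sub>R i) = 0\<close> by simp
qed

lemma has_gradient_measurable:
  assumes "has_gradient u g" shows "u \<in> borel_measurable borel" "g \<in> borel_measurable borel"
  using assms has_gradient_continuous[OF assms] by (auto simp: has_gradient_def intro: borel_measurable_continuous_onI)

lemma gagliardo_nirenberg_1:
  fixes u :: "'a::euclidean_space \<Rightarrow> real"
  assumes n: "2 \<le> DIM('a)" and u: "has_gradient u g" and supp: "bounded {x. u x \<noteq> 0}"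
  shows "(\<integral>\<^sup>+x. epow (ennreal \<bar>u x\<bar>) (real DIM('a) / (real DIM('a) - 1)) \<partial>lborel) \<le> epow (\<integral>\<^sup>+x. ennreal (norm (g x)) \<partial>lborel) (real DIM('a) / (real DIM('a) - 1))"
proof -
  note [measurable] = has_gradient_measurable[OF u]
  show ?thesis using n supp
    by (intro nn_integral_line_prod_le has_gradient_line_bound[OF u]) auto
qed

text \<open>For \<open>r > 1\<close> the function \<open>|z| powr r\<close> is continuously
  differentiable even at 0, because its difference quotient there is \<open>|z| powr (r - 1)\<close>
  up to sign. Hence the inequality for exponent 1 can be applied to powers of
  \<open>|u|\<close>.\<close>

lemma has_gradient_abs_powr:
  fixes u :: "'a::euclidean_space \<Rightarrow> real"
  assumes u: "has_gradient u g" and r: "1 < r"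
  shows "has_gradient (\<lambda>x. \<bar>u x\<bar> powr r) (\<lambda>x. (r * \<bar>u x\<bar> powr (r - 1) * sgn (u x)) *\<^sub>R g x)"
proof -
  define D where "D z = r * \<bar>z\<bar> powr (r - 1) * sgn z" for z :: real
  have D: "((\<lambda>z. \<bar>z\<bar> powr r) has_real_derivative D z) (at z)" for z
  proof -
    consider "0 < z" | "z < 0" | "z = 0" by linarith
    then show ?thesis
    proof cases
      case 1
      have "((\<lambda>z. z powr r) has_real_derivative D z) (at z)"
        using 1 by (auto intro!: derivative_eq_intros simp: D_def powr_diff)
      moreover have "\<forall>\<^sub>F y in nhds z. \<bar>y\<bar> powr r = y powr r"
        using eventually_nhds_in_open[of "{0<..}" z] 1 by (auto elim!: eventually_mono)
      ultimately show ?thesis by (subst DERIV_cong_ev) auto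
    next
      case 2
      have "((\<lambda>z. (- z) powr r) has_real_derivative D z) (at z)"
        using 2 by (auto intro!: derivative_eq_intros simp: D_def powr_diff)
      moreover have "\<forall>\<^sub>F y in nhds z. \<bar>y\<bar> powr r = (- y) powr r"
        using eventually_nhds_in_open[of "{..<0}" z] 2 by (auto elim!: eventually_mono)
      ultimately show ?thesis by (subst DERIV_cong_ev) auto
    next
      case 3
      have "((\<lambda>y. \<bar>y\<bar> powr (r - 1)) \<longlongrightarrow> 0) (at (0::real))"
        using r tendsto_powr'[of "\<lambda>y. \<bar>y\<bar>" 0 "at (0::real)" "\<lambda>_. r - 1" "r - 1"]
        by (auto intro!: tendsto_eq_intros)
      then have "((\<lambda>y. \<bar>y\<bar> powr r / y) \<longlongrightarrow> 0) (at (0::real))"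
        by (rule tendsto_rabs_zero_cancel[OF Lim_transform_eventually])
           (auto simp: eventually_at_filter powr_diff abs_divide)
      then show ?thesis using 3 r by (simp add: DERIV_def D_def)
    qed
  qed
  have Dc: "continuous_on UNIV D"
  proof -
    have "continuous_on ({0..} \<union> {..0}) (\<lambda>z::real. if 0 \<le> z then r * \<bar>z\<bar> powr (r - 1) else - (r * \<bar>z\<bar> powr (r - 1)))"
      using r by (intro continuous_on_If continuous_intros continuous_on_powr') auto
    also have "{0::real..} \<union> {..0} = UNIV" by auto
    finally show ?thesis
      by (rule continuous_on_eq) (auto simp: D_def sgn_if)
  qed
  have "((\<lambda>x. \<bar>u x\<bar> powr r) has_derivative (\<lambda>h. (D (u x) *\<^sub>R g x) \<bullet> h)) (at x)" for x
  proof -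
    have "((\<lambda>z. \<bar>z\<bar> powr r) \<circ> u has_derivative ((*) (D (u x))) \<circ> (\<lambda>h. g x \<bullet> h)) (at x)"
      using u D[of "u x"] by (intro diff_chain_at) (auto simp: has_gradient_def has_field_derivative_def)
    then show ?thesis by (simp add: o_def)
  qed
  moreover have "continuous_on UNIV (\<lambda>x. D (u x) *\<^sub>R g x)"
    using u has_gradient_continuous[OF u] unfolding has_gradient_def
    by (intro continuous_intros continuous_on_compose2[OF Dc]) auto
  ultimately show ?thesis unfolding has_gradient_def D_def by blast
qed

text \<open>Finiteness of this integral permits the cancellation of one of its powers in
  \<open>sobolev\<close>.\<close>

lemma nn_integral_bounded_support_finite:
  fixes u :: "'a::euclidean_space \<Rightarrow> real"
  assumes u: "continuous_on UNIV u" and supp: "bounded {x. u x \<noteq> 0}" and s: "0 < s"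
  shows "(\<integral>\<^sup>+x. epow (ennreal \<bar>u x\<bar>) s \<partial>lborel) < top"
proof -
  obtain M where M: "\<And>y. u y \<noteq> 0 \<Longrightarrow> y \<in> cball 0 M" using supp by (auto simp: bounded_iff)
  have "bounded (u ` cball 0 M)"
    by (intro compact_imp_bounded compact_continuous_image continuous_on_subset[OF u]) auto
  then obtain B where B: "\<And>y. y \<in> cball 0 M \<Longrightarrow> \<bar>u y\<bar> \<le> B" by (fastforce simp: bounded_iff)
  have "epow (ennreal \<bar>u x\<bar>) s \<le> epow (ennreal B) s * indicator (cball 0 M) x" for x
    using M[of x] B[of x] s by (cases "u x = 0") (auto intro!: epow_mono ennreal_leI simp: indicator_def)
  then have "(\<integral>\<^sup>+x. epow (ennreal \<bar>u x\<bar>) s \<partial>lborel) \<le> (\<integral>\<^sup>+(x :: 'a). epow (ennreal B) s * indicator (cball 0 M) x \<partial>lborel)"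
    by (auto intro!: nn_integral_mono)
  also have "\<dots> = epow (ennreal B) s * emeasure lborel (cball (0::'a) M)"
    by (intro nn_integral_cmult_indicator) auto
  also have "\<dots> < top"
    using s emeasure_bounded_finite[of "cball (0::'a) M"] epow_eq_top_iff[of s "ennreal B"]
    by (auto simp: ennreal_mult_less_top less_top)
  finally show ?thesis .
qed

text \<open>For \<open>p > 1\<close> the case \<open>p = 1\<close> is applied to \<open>\<bar>u\<bar>\<^sup>r\<close> with \<open>r = p (N - 1) / (N - p)\<close>.\<close>

lemma sobolev:
  fixes p :: real
  assumes p: "1 \<le> p" "p < DIM('a::euclidean_space)" and n: "2 \<le> DIM('a)"
  defines "s \<equiv> DIM('a) * p / (DIM('a) - p)"
  shows "\<exists>C\<ge>0. \<forall>u g. has_gradient (u :: 'a \<Rightarrow> real) g \<longrightarrow> bounded {x. u x \<noteq> 0} \<longrightarrow>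
    epow (\<integral>\<^sup>+x. epow (ennreal \<bar>u x\<bar>) s \<partial>lborel) (p / s) \<le> ennreal C * (\<integral>\<^sup>+x. epow (ennreal (norm (g x))) p \<partial>lborel)"
proof -
  let ?n = "real DIM('a)"
  \<comment> \<open>For \<open>p > 1\<close> this \<open>r\<close> solves
    \<open>(r - 1) * p / (p - 1) = s\<close>, so that Hoelder's inequality reproduces the integral
    \<open>A\<close> of the left-hand side. At the same time \<open>r * s1 = s\<close>, so the case
    of exponent 1, applied to the power of \<open>|u|\<close>, has \<open>A\<close> on its left-hand
    side too.\<close>
  define r where "r = p * (?n - 1) / (?n - p)"
  define s1 where "s1 = ?n / (?n - 1)"
  have [simp]: "?n - p \<noteq> 0" "?n - 1 \<noteq> 0" "p \<noteq> 0" "?n \<noteq> 0" "DIM('a) \<noteq> Suc 0" "?n \<noteq> p" using p n by linarith+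
  have rs: "r * s1 = s" by (simp add: r_def s1_def s_def)
  have s1: "1 < s1" using n by (simp add: s1_def field_simps)
  have s: "0 < s" using p n by (simp add: s_def)
  have r1: "r - 1 = s * (1 - 1/p)" unfolding r_def s_def by (simp add: divide_simps) (simp add: algebra_simps)
  have r_inv: "1 - s1 * (1 - 1/p) = 1/r" 
    unfolding r_def s1_def by (simp add: divide_simps) (simp add: algebra_simps)
  have "epow (\<integral>\<^sup>+x. epow (ennreal \<bar>u x\<bar>) s \<partial>lborel) (p / s) \<le> ennreal (r powr p) * (\<integral>\<^sup>+x. epow (ennreal (norm (g x))) p \<partial>lborel)"
    if u: "has_gradient u g" and supp: "bounded {x. u x \<noteq> 0}" for u :: "'a \<Rightarrow> real" and g
  proof -
    note [measurable] = has_gradient_measurable[OF u]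
    define A where "A = (\<integral>\<^sup>+x. epow (ennreal \<bar>u x\<bar>) s \<partial>lborel)"
    define G where "G = (\<integral>\<^sup>+x. epow (ennreal (norm (g x))) p \<partial>lborel)"
    show ?thesis
    proof (cases "p = 1")
      case True
      have "r = 1" "s = s1" using True by (auto simp: r_def s1_def s_def)
      then have "A \<le> epow G s1"
        using gagliardo_nirenberg_1[OF n u supp] True unfolding A_def G_def s1_def by simp
      then have "epow A (1 / s1) \<le> G" using s1 by (subst epow_le_iff) auto
      then show ?thesis using True \<open>r = 1\<close> \<open>s = s1\<close> by (simp add: A_def G_def)
    next
      case False
      then have p1: "1 < p" using p by simp
      have r: "1 < r"
      proof -
        have "?n - p < p * (?n - 1)" using p1 n by (simp add: algebra_simps)
        then show ?thesis using p by (simp add: r_def)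
      qed
      have "A = (\<integral>\<^sup>+x. epow (ennreal \<bar>\<bar>u x\<bar> powr r\<bar>) s1 \<partial>lborel)"
        unfolding A_def using r s1 rs by (intro nn_integral_cong) (simp add: epow_ennreal[symmetric] epow_epow)
      also have "\<dots> \<le> epow (\<integral>\<^sup>+x. ennreal (norm ((r * \<bar>u x\<bar> powr (r - 1) * sgn (u x)) *\<^sub>R g x)) \<partial>lborel) s1"
        unfolding s1_def by (rule gagliardo_nirenberg_1[OF n has_gradient_abs_powr[OF u r]]) (use supp in simp)
      also have "\<dots> \<le> epow (ennreal r * (epow G (1/p) * epow A (1 - 1/p))) s1"
      proof (intro epow_mono)
        have "(\<integral>\<^sup>+x. ennreal (norm ((r * \<bar>u x\<bar> powr (r - 1) * sgn (u x)) *\<^sub>R g x)) \<partial>lborel) \<le>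
          (\<integral>\<^sup>+x. ennreal r * (epow (epow (ennreal (norm (g x))) p) (1/p) * epow (epow (ennreal \<bar>u x\<bar>) s) (1 - 1/p)) \<partial>lborel)"
        proof (rule nn_integral_mono)
          fix x
          have "epow (epow (ennreal \<bar>u x\<bar>) s) (1 - 1/p) = ennreal (\<bar>u x\<bar> powr (r - 1))"
            using p1 s r by (subst epow_epow) (simp_all add: r1[symmetric] epow_ennreal)
          moreover have "epow (epow (ennreal (norm (g x))) p) (1/p) = ennreal (norm (g x))"
            using p1 by (simp add: epow_epow)
          moreover have "ennreal (norm ((r * \<bar>u x\<bar> powr (r - 1) * sgn (u x)) *\<^sub>R g x)) \<le> ennreal (r * (norm (g x) * \<bar>u x\<bar> powr (r - 1)))"
            using r by (intro ennreal_leI) (auto simp: abs_mult sgn_if)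
          ultimately show "ennreal (norm ((r * \<bar>u x\<bar> powr (r - 1) * sgn (u x)) *\<^sub>R g x)) \<le>
            ennreal r * (epow (epow (ennreal (norm (g x))) p) (1/p) * epow (epow (ennreal \<bar>u x\<bar>) s) (1 - 1/p))"
            using r by (simp add: ennreal_mult)
        qed
        also have "\<dots> = ennreal r * (\<integral>\<^sup>+x. epow (epow (ennreal (norm (g x))) p) (1/p) * epow (epow (ennreal \<bar>u x\<bar>) s) (1 - 1/p) \<partial>lborel)"
          by (intro nn_integral_cmult) measurable
        also have "\<dots> \<le> ennreal r * (epow G (1/p) * epow A (1 - 1/p))"
          unfolding G_def A_def using p1 by (intro mult_left_mono nn_integral_Holder2) auto
        finally show "(\<integral>\<^sup>+x. ennreal (norm ((r * \<bar>u x\<bar> powr (r - 1) * sgn (u x)) *\<^sub>R g x)) \<partial>lborel) \<le> \<dots>" .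
      qed (use s1 in simp)
      also have "\<dots> = (epow (ennreal r) s1 * epow G (s1/p)) * epow A (s1 * (1 - 1/p))"
        using s1 p1 by (simp add: epow_mult epow_epow mult_ac)
      finally have le: "A \<le> (epow (ennreal r) s1 * epow G (s1/p)) * epow A (s1 * (1 - 1/p))" .
      have e: "0 < s1 * (1 - 1/p)" using s1 p1 by simp
      have Afin: "A < top" unfolding A_def
        using has_gradient_continuous[OF u] supp s by (rule nn_integral_bounded_support_finite)
      \<comment> \<open>On the right \<open>A\<close> occurs with exponent
        \<open>s1 * (1 - 1/p)\<close>, which falls short of 1 by \<open>1/r\<close>. Cancelling it
        is possible because \<open>A\<close> is finite; the case \<open>A = 0\<close> is
        immediate.\<close>
      have "epow A (1 / r) \<le> epow (ennreal r) s1 * epow G (s1/p)"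
      proof (cases "A = 0")
        case False
        let ?Z = "epow A (s1 * (1 - 1/p))"
        have "?Z * epow A (1/r) = A"
        proof -
          have "s1 * (1 - 1/p) + 1/r = 1" using r_inv by linarith
          then show ?thesis using epow_add[of "s1 * (1 - 1/p)" "1/r" A] r e by (simp only: epow_1 less_imp_le divide_nonneg_pos)
        qed
        then have "?Z * epow A (1/r) \<le> ?Z * (epow (ennreal r) s1 * epow G (s1/p))"
          using le by (simp add: mult_ac)
        moreover have "?Z \<noteq> 0" "?Z \<noteq> top" using False Afin e by (simp_all add: epow_eq_0_iff epow_eq_top_iff)
        ultimately show ?thesis by (simp only: ennreal_mult_le_mult_iff not_False_eq_True)
      qed (use r in simp)
      \<comment> \<open>The power \<open>p / s1\<close> makes the right-hand side linear in
        \<open>G\<close> and produces the constant \<open>r powr p\<close>.\<close>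
      then have "epow (epow A (1/r)) (p / s1) \<le> epow (epow (ennreal r) s1 * epow G (s1/p)) (p / s1)"
        using p1 s1 by (intro epow_mono) auto
      moreover have "epow (epow A (1/r)) (p / s1) = epow A (p / s)"
        using r p1 s1 rs by (simp add: epow_epow)
      moreover have "epow (epow (ennreal r) s1 * epow G (s1/p)) (p / s1) = ennreal (r powr p) * G"
        using r p1 s1 by (simp add: epow_epow epow_mult epow_ennreal_pos powr_powr)
      ultimately have "epow A (p / s) \<le> ennreal (r powr p) * G" by (simp only:)
      then show ?thesis unfolding A_def G_def .
    qed
  qed
  then show ?thesis by (intro exI[of _ "r powr p"]) auto
qed

section \<open>Sobolev inequalities on balls with explicit dependence on the radius\<close>

lemma nn_integral_DIM1:
  fixes F :: "'a::euclidean_space \<Rightarrow> ennreal"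
  assumes "F \<in> borel_measurable borel" and b: "Basis = {b :: 'a}"
  shows "(\<integral>\<^sup>+x. F x \<partial>lborel) = (\<integral>\<^sup>+t. F (t *\<^sub>R b) \<partial>lborel)"
proof -
  interpret product_sigma_finite "\<lambda>_::'a. lborel :: real measure" by standard
  note [measurable] = assms(1)
  have "(\<integral>\<^sup>+x. F x \<partial>lborel) = (\<integral>\<^sup>+f. F (f b *\<^sub>R b) \<partial>PiM {b} (\<lambda>_. lborel))"
    using nn_integral_lborel_PiM[OF assms(1), unfolded b] by simp
  also have "\<dots> = (\<integral>\<^sup>+t. F (t *\<^sub>R b) \<partial>lborel)"
    by (rule product_nn_integral_singleton) simp
  finally show ?thesis .
qed

text \<open>The choice of \<open>q\<close> gives \<open>N / q = N - p\<close>, so the power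
  \<open>1 / q\<close> of the normalising factor is exactly \<open>r powr p / r ^ N\<close>. The
  scaling thus appears without rescaling \<open>u\<close>.\<close>

lemma sobolev_ball_less:
  fixes p q :: real
  assumes p: "1 \<le> p" "p < DIM('a::euclidean_space)" and q: "q = real DIM('a) / (real DIM('a) - p)"
  shows "\<exists>C\<ge>0. \<forall>r>0. \<forall>u g. has_gradient (u :: 'a \<Rightarrow> real) g \<longrightarrow> (\<forall>x. x \<notin> ball 0 r \<longrightarrow> u x = 0 \<and> g x = 0) \<longrightarrow>
    epow (ennreal (1 / r ^ DIM('a)) * (\<integral>\<^sup>+x. epow (ennreal \<bar>u x\<bar>) (p * q) \<partial>lborel)) (1 / q)
      \<le> ennreal (C * (r powr p / r ^ DIM('a))) * (\<integral>\<^sup>+x. epow (ennreal (norm (g x))) p \<partial>lborel)"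
proof -
  let ?n = "real DIM('a)"
  have n: "2 \<le> DIM('a)" using p by linarith
  define s where "s = p * q"
  have s: "s = ?n * p / (?n - p)" using q by (simp add: s_def)
  have qp: "p / s = 1 / q" "0 < q" using p q by (auto simp: s_def)
  obtain C where C: "0 \<le> C" "\<And>u g. has_gradient (u :: 'a \<Rightarrow> real) g \<Longrightarrow> bounded {x. u x \<noteq> 0} \<Longrightarrow>
    epow (\<integral>\<^sup>+x. epow (ennreal \<bar>u x\<bar>) s \<partial>lborel) (1 / q) \<le> ennreal C * (\<integral>\<^sup>+x. epow (ennreal (norm (g x))) p \<partial>lborel)"
    using sobolev[OF p n] unfolding s[symmetric] qp(1) by blast
  show ?thesis
  proof (intro exI[of _ C] conjI allI impI C)
    fix r :: real and u :: "'a \<Rightarrow> real" and g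
    assume r: "0 < r" and u: "has_gradient u g" and supp: "\<forall>x. x \<notin> ball 0 r \<longrightarrow> u x = 0 \<and> g x = 0"
    have "{x. u x \<noteq> 0} \<subseteq> ball 0 r" using supp by blast
    then have b: "bounded {x. u x \<noteq> 0}" using bounded_ball bounded_subset by blast
    have e: "epow (ennreal (1 / r ^ DIM('a))) (1/q) = ennreal (r powr p / r ^ DIM('a))"
    proof -
      have "(1 / r ^ DIM('a)) powr (1/q) = (r powr (- ?n)) powr (1/q)"
        using r by (simp add: powr_minus powr_realpow field_simps)
      also have "\<dots> = r powr (p - ?n)"
      proof -
        have "?n / q = ?n - p" using p q by simp
        then show ?thesis by (simp add: powr_powr)
      qed
      also have "\<dots> = r powr p / r ^ DIM('a)" using r by (simp add: powr_diff powr_realpow)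
      finally show ?thesis using r by (simp add: epow_ennreal_pos)
    qed
    have "epow (ennreal (1 / r ^ DIM('a)) * (\<integral>\<^sup>+x. epow (ennreal \<bar>u x\<bar>) (p * q) \<partial>lborel)) (1 / q) =
      ennreal (r powr p / r ^ DIM('a)) * epow (\<integral>\<^sup>+x. epow (ennreal \<bar>u x\<bar>) s \<partial>lborel) (1 / q)"
      using qp by (simp add: epow_mult e s_def)
    also have "\<dots> \<le> ennreal (r powr p / r ^ DIM('a)) * (ennreal C * (\<integral>\<^sup>+x. epow (ennreal (norm (g x))) p \<partial>lborel))"
      by (intro mult_left_mono C(2) u b) auto
    also have "\<dots> = ennreal (C * (r powr p / r ^ DIM('a))) * (\<integral>\<^sup>+x. epow (ennreal (norm (g x))) p \<partial>lborel)"
      using C r by (subst ennreal_mult) (auto simp: mult_ac)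
    finally show "epow (ennreal (1 / r ^ DIM('a)) * (\<integral>\<^sup>+x. epow (ennreal \<bar>u x\<bar>) (p * q) \<partial>lborel)) (1 / q) \<le> \<dots>" .
  qed
qed

text \<open>The exponent \<open>N q\<close> is the Sobolev exponent of \<open>N q / (1 + q) < N\<close>.\<close>

lemma sobolev_ball_eq:
  fixes q :: real
  assumes n: "2 \<le> DIM('a::euclidean_space)" and q: "1 \<le> q"
  shows "\<exists>C\<ge>0. \<forall>r>0. \<forall>u g. has_gradient (u :: 'a \<Rightarrow> real) g \<longrightarrow> (\<forall>x. x \<notin> ball 0 r \<longrightarrow> u x = 0 \<and> g x = 0) \<longrightarrow>
    epow (ennreal (1 / r ^ DIM('a)) * (\<integral>\<^sup>+x. epow (ennreal \<bar>u x\<bar>) (DIM('a) * q) \<partial>lborel)) (1 / q)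
      \<le> ennreal C * (\<integral>\<^sup>+x. epow (ennreal (norm (g x))) (DIM('a)) \<partial>lborel)"
proof -
  let ?n = "real DIM('a)"
  define p where "p = ?n * q / (1 + q)"
  have n2: "2 \<le> ?n" using n by simp
  have p: "1 \<le> p" "p < ?n"
  proof -
    have "1 + q \<le> ?n * q" using mult_mono[of 2 ?n 1 q] mult_mono[of 2 ?n q q] n2 q by linarith
    then show "1 \<le> p" using q by (simp add: p_def)
    show "p < ?n" using q n2 by (simp add: p_def field_simps)
  qed
  have np: "?n / p = 1 + 1/q" using q n2 by (simp add: p_def field_simps)
  have s: "?n * p / (?n - p) = ?n * q"
  proof -
    have "?n - p = ?n / (1 + q)" using q by (simp add: p_def field_simps)
    moreover have "?n * p = (?n * q) * (?n / (1 + q))" by (simp add: p_def)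
    moreover have "?n / (1 + q) \<noteq> 0" using q n2 by simp
    ultimately show ?thesis by (metis nonzero_mult_div_cancel_right)
  qed
  obtain C where C: "0 \<le> C" "\<And>u g. has_gradient (u :: 'a \<Rightarrow> real) g \<Longrightarrow> bounded {x. u x \<noteq> 0} \<Longrightarrow>
    epow (\<integral>\<^sup>+x. epow (ennreal \<bar>u x\<bar>) (?n * q) \<partial>lborel) (p / (?n * q)) \<le> ennreal C * (\<integral>\<^sup>+x. epow (ennreal (norm (g x))) p \<partial>lborel)"
    using sobolev[OF p n] unfolding s by blast
  define V where "V = unit_ball_vol ?n"
  have V: "0 < V" unfolding V_def by simp
  show ?thesis
  proof (intro exI[of _ "C powr (?n / p) * V powr (1/q)"] conjI allI impI)
    fix r :: real and u :: "'a \<Rightarrow> real" and g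
    assume r: "0 < r" and u: "has_gradient u g" and supp: "\<forall>x. x \<notin> ball 0 r \<longrightarrow> u x = 0 \<and> g x = 0"
    note [measurable] = has_gradient_measurable[OF u]
    have "{x. u x \<noteq> 0} \<subseteq> ball 0 r" using supp by blast
    then have b: "bounded {x. u x \<noteq> 0}" using bounded_ball bounded_subset by blast
    define A where "A = (\<integral>\<^sup>+x. epow (ennreal \<bar>u x\<bar>) (?n * q) \<partial>lborel)"
    define G where "G = (\<integral>\<^sup>+x. epow (ennreal (norm (g x))) ?n \<partial>lborel)"
    have pn: "0 \<le> p / ?n" "p / ?n \<le> 1" "0 < p" using p by auto
    \<comment> \<open>Bounded support lets Hoelder's inequality raise the exponent of the gradient
      from \<open>p\<close> to the dimension, at the price of a power of the volume of the
      ball.\<close>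
    have "(\<integral>\<^sup>+x. epow (ennreal (norm (g x))) p \<partial>lborel) =
       (\<integral>\<^sup>+x. epow (epow (ennreal (norm (g x))) ?n) (p / ?n) * epow (indicator (ball 0 r) x) (1 - p / ?n) \<partial>lborel)"
    proof (rule nn_integral_cong)
      fix x show "epow (ennreal (norm (g x))) p = epow (epow (ennreal (norm (g x))) ?n) (p / ?n) * epow (indicator (ball 0 r) x) (1 - p / ?n)"
        using supp pn by (cases "x \<in> ball 0 r") (auto simp: epow_epow)
    qed
    also have "\<dots> \<le> epow G (p / ?n) * epow (emeasure lborel (ball (0::'a) r)) (1 - p / ?n)"
      using nn_integral_Holder2[OF pn(1,2), of "\<lambda>x. epow (ennreal (norm (g x))) ?n" lborel "indicator (ball (0::'a) r)"]
      unfolding G_def by (simp add: borel_measurable_indicator)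
    finally have H: "(\<integral>\<^sup>+x. epow (ennreal (norm (g x))) p \<partial>lborel) \<le> epow G (p / ?n) * epow (emeasure lborel (ball (0::'a) r)) (1 - p / ?n)" .
    have "epow A (p / (?n * q)) \<le> ennreal C * (epow G (p / ?n) * epow (emeasure lborel (ball (0::'a) r)) (1 - p / ?n))"
      using order_trans[OF C(2)[OF u b] mult_left_mono[OF H]] unfolding A_def by auto
    then have "epow (epow A (p / (?n * q))) (?n / p) \<le>
        epow (ennreal C * (epow G (p / ?n) * epow (emeasure lborel (ball (0::'a) r)) (1 - p / ?n))) (?n / p)"
      using pn by (intro epow_mono) auto
    also have "\<dots> = epow (ennreal C) (?n / p) * (G * epow (emeasure lborel (ball (0::'a) r)) (1/q))"
    proof -
      have e2: "p / ?n * (?n / p) = 1" using pn by simp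
      have e: "(1 - p / ?n) * (?n / p) = 1 / q" by (simp only: left_diff_distrib e2) (simp add: np)
      have pos: "0 \<le> ?n / p" "0 \<le> 1 - p / ?n" using pn by simp_all
      show ?thesis
        by (simp only: epow_mult[OF pos(1)] epow_epow[OF pn(1) pos(1)] epow_epow[OF pos(2,1)] e e2 epow_1)
    qed
    also have "epow (emeasure lborel (ball (0::'a) r)) (1/q) = ennreal ((V * r ^ DIM('a)) powr (1/q))"
      using r V q by (simp add: emeasure_ball V_def epow_ennreal)
    also have "epow (epow A (p / (?n * q))) (?n / p) = epow A (1/q)"
      using q pn by (simp add: epow_epow)
    finally have le: "epow A (1/q) \<le> epow (ennreal C) (?n / p) * (G * ennreal ((V * r ^ DIM('a)) powr (1/q)))" .
    \<comment> \<open>The powers of \<open>r\<close> from the normalisation and from the volume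
      cancel, in accordance with the scale invariance of the critical case.\<close>
    have "epow (ennreal (1 / r ^ DIM('a)) * A) (1 / q) = ennreal ((1 / r ^ DIM('a)) powr (1/q)) * epow A (1/q)"
      using r q by (simp add: epow_mult epow_ennreal_pos)
    also have "\<dots> \<le> ennreal ((1 / r ^ DIM('a)) powr (1/q)) * (epow (ennreal C) (?n / p) * (G * ennreal ((V * r ^ DIM('a)) powr (1/q))))"
      by (intro mult_left_mono le) auto
    also have "\<dots> = epow (ennreal C) (?n / p) * ennreal ((1 / r ^ DIM('a)) powr (1/q) * (V * r ^ DIM('a)) powr (1/q)) * G"
      by (simp add: ennreal_mult mult_ac)
    also have "(1 / r ^ DIM('a)) powr (1/q) * (V * r ^ DIM('a)) powr (1/q) = V powr (1/q)"
      using r V by (simp add: powr_mult[symmetric])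
    also have "epow (ennreal C) (?n / p) * ennreal (V powr (1/q)) = ennreal (C powr (?n / p) * V powr (1/q))"
      using C pn by (simp add: epow_ennreal ennreal_mult)
    finally show "epow (ennreal (1 / r ^ DIM('a)) * (\<integral>\<^sup>+x. epow (ennreal \<bar>u x\<bar>) (?n * q) \<partial>lborel)) (1 / q)
      \<le> ennreal (C powr (?n / p) * V powr (1/q)) * (\<integral>\<^sup>+x. epow (ennreal (norm (g x))) (DIM('a)) \<partial>lborel)"
      unfolding A_def G_def .
  qed (use V in auto)
qed

text \<open>Integration along the only line bounds \<open>u\<close> pointwise by the integral of its
  gradient. Every exponent \<open>q\<close> follows by integrating over the ball, whose volume
  cancels \<open>1 / r\<close> up to a constant.\<close>

lemma sobolev_ball_DIM1:
  fixes q :: real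
  assumes n: "DIM('a::euclidean_space) = 1" and q: "1 \<le> q"
  shows "\<exists>C\<ge>0. \<forall>r>0. \<forall>u g. has_gradient (u :: 'a \<Rightarrow> real) g \<longrightarrow> (\<forall>x. x \<notin> ball 0 r \<longrightarrow> u x = 0 \<and> g x = 0) \<longrightarrow>
    epow (ennreal (1 / r) * (\<integral>\<^sup>+x. epow (ennreal \<bar>u x\<bar>) q \<partial>lborel)) (1 / q)
      \<le> ennreal C * (\<integral>\<^sup>+x. ennreal (norm (g x)) \<partial>lborel)"
proof -
  obtain b :: 'a where b: "Basis = {b}" using n card_1_singletonE by blast
  then have nb: "norm b = 1" using norm_Basis by blast
  define V where "V = unit_ball_vol (real DIM('a))"
  have V: "0 < V" unfolding V_def by simp
  show ?thesis
  proof (intro exI[of _ "V powr (1/q)"] conjI allI impI)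
    fix r :: real and u :: "'a \<Rightarrow> real" and g
    assume r: "0 < r" and u: "has_gradient u g" and supp: "\<forall>x. x \<notin> ball 0 r \<longrightarrow> u x = 0 \<and> g x = 0"
    note [measurable] = has_gradient_measurable[OF u]
    have "{x. u x \<noteq> 0} \<subseteq> ball 0 r" using supp by blast
    then have bd: "bounded {x. u x \<noteq> 0}" using bounded_ball bounded_subset by blast
    define G where "G = (\<integral>\<^sup>+x. ennreal (norm (g x)) \<partial>lborel)"
    have uG: "ennreal \<bar>u x\<bar> \<le> G" for x
    proof -
      have "ennreal \<bar>u x\<bar> \<le> (\<integral>\<^sup>+t. ennreal (norm (g (x + t *\<^sub>R b))) \<partial>lborel)"
        by (rule has_gradient_line_bound[OF u bd nb])
      also have "\<dots> = (\<integral>\<^sup>+y. ennreal (norm (g (x + y))) \<partial>lborel)"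
        using b by (subst nn_integral_DIM1[where b=b]) auto
      also have "\<dots> = G" unfolding G_def by (rule nn_integral_shift) measurable
      finally show ?thesis .
    qed
    have "(\<integral>\<^sup>+x. epow (ennreal \<bar>u x\<bar>) q \<partial>lborel) \<le> (\<integral>\<^sup>+(x :: 'a). epow G q * indicator (ball 0 r) x \<partial>lborel)"
    proof (rule nn_integral_mono)
      fix x show "epow (ennreal \<bar>u x\<bar>) q \<le> epow G q * indicator (ball 0 r) x"
        using supp uG[of x] q by (cases "x \<in> ball 0 r") (auto intro!: epow_mono)
    qed
    also have "\<dots> = epow G q * emeasure lborel (ball (0::'a) r)"
      by (intro nn_integral_cmult_indicator) auto
    also have "emeasure lborel (ball (0::'a) r) = ennreal (V * r)"
      using r n by (simp add: emeasure_ball V_def)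
    finally have "epow (ennreal (1 / r) * (\<integral>\<^sup>+x. epow (ennreal \<bar>u x\<bar>) q \<partial>lborel)) (1 / q) \<le>
        epow (ennreal (1 / r) * (epow G q * ennreal (V * r))) (1/q)"
      using q by (intro epow_mono mult_left_mono) auto
    also have "ennreal (1 / r) * (epow G q * ennreal (V * r)) = ennreal V * epow G q"
      using r V by (simp add: ennreal_mult[symmetric] mult.left_commute[of _ "epow G q"] mult.commute)
    also have "epow (ennreal V * epow G q) (1/q) = ennreal (V powr (1/q)) * G"
      using q V by (simp add: epow_mult epow_epow epow_ennreal_pos)
    finally show "epow (ennreal (1 / r) * (\<integral>\<^sup>+x. epow (ennreal \<bar>u x\<bar>) q \<partial>lborel)) (1 / q)
      \<le> ennreal (V powr (1/q)) * (\<integral>\<^sup>+x. ennreal (norm (g x)) \<partial>lborel)"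
      unfolding G_def .
  qed simp
qed

lemma sobolev_ball:
  fixes p q :: real
  assumes "1 \<le> p" "1 \<le> q" "p \<le> DIM('a::euclidean_space)"
    and "p < DIM('a) \<Longrightarrow> q = real DIM('a) / (real DIM('a) - p)"
  shows "\<exists>C\<ge>0. \<forall>r>0. \<forall>u g. has_gradient (u :: 'a \<Rightarrow> real) g \<longrightarrow> (\<forall>x. x \<notin> ball 0 r \<longrightarrow> u x = 0 \<and> g x = 0) \<longrightarrow>
    epow (ennreal (1 / r ^ DIM('a)) * (\<integral>\<^sup>+x. epow (ennreal \<bar>u x\<bar>) (p * q) \<partial>lborel)) (1 / q)
      \<le> ennreal (C * (r powr p / r ^ DIM('a))) * (\<integral>\<^sup>+x. epow (ennreal (norm (g x))) p \<partial>lborel)"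
proof -
  consider "p < DIM('a)" | "p = DIM('a)" "2 \<le> DIM('a)" | "p = 1" "DIM('a) = 1"
    using assms by force
  then show ?thesis
  proof cases
    case 1
    then show ?thesis using assms by (intro sobolev_ball_less) auto
  next
    case 2
    then have "r powr p / r ^ DIM('a) = 1" if "0 < r" for r
      using that by (simp add: powr_realpow)
    then show ?thesis using sobolev_ball_eq[OF 2(2) assms(2)] 2(1) by simp
  next
    case 3
    then show ?thesis using sobolev_ball_DIM1[OF 3(2) assms(2)] by simp
  qed
qed

section \<open>Mollifiers\<close>

text \<open>The factor \<open>1 / t ^ m\<close> is included because differentiating
  \<open>exp (- 1 / t)\<close> produces negative powers of \<open>t\<close>: derivatives of members
  of the family are linear combinations of members.\<close>

definition flat_exp :: "nat \<Rightarrow> real \<Rightarrow> real" where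
  "flat_exp m t = (if 0 < t then exp (- 1 / t) / t ^ m else 0)"

lemma flat_exp_deriv:
  "(flat_exp m has_real_derivative (flat_exp (m + 2) t - real m * flat_exp (m + 1) t)) (at t)"
proof -
  consider "0 < t" | "t < 0" | "t = 0" by linarith
  then show ?thesis
  proof cases
    case 1
    have "((\<lambda>t. exp (- 1 / t) / t ^ m) has_real_derivative
        ((exp (- 1 / t) * (1 / t\<^sup>2)) * t ^ m - exp (- 1 / t) * (real m * t ^ (m - 1))) / (t ^ m * t ^ m)) (at t)"
      using 1 by (auto intro!: derivative_eq_intros simp: power2_eq_square)
    moreover have "((exp (- 1 / t) * (1 / t\<^sup>2)) * t ^ m - exp (- 1 / t) * (real m * t ^ (m - 1))) / (t ^ m * t ^ m)
        = flat_exp (m + 2) t - real m * flat_exp (m + 1) t"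
    proof -
      have "real m * t ^ (m - 1) = real m * t ^ m / t" using 1 by (cases m) auto
      then show ?thesis using 1 by (simp only:) (simp add: flat_exp_def divide_simps power2_eq_square power_add, simp add: algebra_simps)
    qed
    ultimately have "((\<lambda>t. exp (- 1 / t) / t ^ m) has_real_derivative (flat_exp (m + 2) t - real m * flat_exp (m + 1) t)) (at t)"
      by (rule DERIV_cong)
    moreover have "\<forall>\<^sub>F y in nhds t. flat_exp m y = exp (- 1 / y) / y ^ m"
      using eventually_nhds_in_open[of "{0<..}" t] 1 by (auto elim!: eventually_mono simp: flat_exp_def)
    ultimately show ?thesis by (subst DERIV_cong_ev) auto
  next
    case 2
    have "((\<lambda>t::real. 0) has_real_derivative (flat_exp (m + 2) t - real m * flat_exp (m + 1) t)) (at t)"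
      using 2 by (auto simp: flat_exp_def)
    moreover have "\<forall>\<^sub>F y in nhds t. flat_exp m y = 0"
      using eventually_nhds_in_open[of "{..<0}" t] 2 by (auto elim!: eventually_mono simp: flat_exp_def)
    ultimately show ?thesis by (subst DERIV_cong_ev) auto
  next
    case 3
    have "((\<lambda>h. flat_exp m h / h) \<longlongrightarrow> 0) (at_right 0)"
    proof (rule Lim_transform_eventually)
      \<comment> \<open>In terms of \<open>inverse h\<close>, which tends to infinity, the
        exponential beats every power.\<close>
      show "((\<lambda>h::real. (inverse h) ^ (m + 1) / exp (inverse h)) \<longlongrightarrow> 0) (at_right 0)"
        by (rule filterlim_compose[OF tendsto_power_div_exp_0 filterlim_inverse_at_top_right])
      show "\<forall>\<^sub>F h in at_right 0. (inverse h) ^ (m + 1) / exp (inverse h) = flat_exp m h / h"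
        by (auto simp: eventually_at_filter flat_exp_def exp_minus field_simps)
    qed
    moreover have "((\<lambda>h. flat_exp m h / h) \<longlongrightarrow> 0) (at_left 0)"
      by (rule tendsto_eventually) (auto simp: eventually_at_filter flat_exp_def)
    ultimately have "((\<lambda>h. flat_exp m h / h) \<longlongrightarrow> 0) (at 0)"
      by (simp add: filterlim_split_at)
    then show ?thesis using 3 by (simp add: DERIV_def flat_exp_def)
  qed
qed

text \<open>A class of functions containing the bump \<open>exp (- 1 / (1 - c \<bar>y - a\<bar>\<^sup>2))\<close> and closed under partial derivatives.\<close>

inductive bump_class :: "real \<Rightarrow> 'a::euclidean_space \<Rightarrow> ('a \<Rightarrow> real) \<Rightarrow> bool" for c a where
  flat: "bump_class c a (\<lambda>y. flat_exp m (1 - c * ((y - a) \<bullet> (y - a))))"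
| const: "bump_class c a (\<lambda>y. k)"
| coord: "bump_class c a (\<lambda>y. y \<bullet> b)"
| add: "bump_class c a f \<Longrightarrow> bump_class c a g \<Longrightarrow> bump_class c a (\<lambda>y. f y + g y)"
| mult: "bump_class c a f \<Longrightarrow> bump_class c a g \<Longrightarrow> bump_class c a (\<lambda>y. f y * g y)"

lemma bump_class_derivative:
  assumes "bump_class c a f"
  shows "\<exists>D. (\<forall>x. (f has_derivative D x) (at x)) \<and> (\<forall>b. bump_class c a (\<lambda>x. D x b))"
  using assms
proof induction
  case (flat m)
  let ?T = "\<lambda>y. 1 - c * ((y - a) \<bullet> (y - a))"
  \<comment> \<open>Written with sums and products only, since these are the operations for which
    the class has closure rules.\<close>
  let ?D = "\<lambda>x h. (flat_exp (m + 2) (?T x) + (- real m) * flat_exp (m + 1) (?T x)) * ((- 2 * c) * (x \<bullet> h + (- (a \<bullet> h))))"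
  have "((\<lambda>y. flat_exp m (?T y)) has_derivative ?D x) (at x)" for x
  proof -
    have "(?T has_derivative (\<lambda>h. (- 2 * c) * (x \<bullet> h + (- (a \<bullet> h))))) (at x)"
      by (auto intro!: derivative_eq_intros simp: inner_commute algebra_simps)
    moreover have "(flat_exp m has_derivative (*) (flat_exp (m + 2) (?T x) - real m * flat_exp (m + 1) (?T x))) (at (?T x))"
      using flat_exp_deriv[of m "?T x"] by (simp add: has_field_derivative_def)
    ultimately have "(flat_exp m \<circ> ?T has_derivative (*) (flat_exp (m + 2) (?T x) - real m * flat_exp (m + 1) (?T x)) \<circ> (\<lambda>h. (- 2 * c) * (x \<bullet> h + (- (a \<bullet> h))))) (at x)"
      by (rule diff_chain_at)
    then show ?thesis by (simp add: o_def)
  qed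
  moreover have "bump_class c a (\<lambda>x. ?D x b)" for b
    by (intro bump_class.intros)
  ultimately show ?case by (intro exI[of _ ?D]) auto
next
  case (const k)
  show ?case by (intro exI[of _ "\<lambda>_ _. 0"]) (auto intro: bump_class.intros)
next
  case (coord b)
  show ?case by (intro exI[of _ "\<lambda>_ h. h \<bullet> b"]) (auto intro!: bump_class.intros derivative_eq_intros)
next
  case (add f g)
  then obtain D E where "\<And>x. (f has_derivative D x) (at x)" "\<And>b. bump_class c a (\<lambda>x. D x b)"
    "\<And>x. (g has_derivative E x) (at x)" "\<And>b. bump_class c a (\<lambda>x. E x b)" by metis
  then show ?case
    by (intro exI[of _ "\<lambda>x h. D x h + E x h"]) (auto intro!: bump_class.intros has_derivative_add)
next
  case (mult f g)
  then obtain D E where "\<And>x. (f has_derivative D x) (at x)" "\<And>b. bump_class c a (\<lambda>x. D x b)"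
    "\<And>x. (g has_derivative E x) (at x)" "\<And>b. bump_class c a (\<lambda>x. E x b)" by metis
  with mult.hyps show ?case
    by (intro exI[of _ "\<lambda>x h. f x * E x h + D x h * g x"]) (auto intro!: bump_class.intros has_derivative_mult)
qed

lemma bump_class_Ck: "bump_class c a f \<Longrightarrow> Ck k f"
proof (induction k arbitrary: f)
  case 0
  then obtain D where "\<And>x. (f has_derivative D x) (at x)" using bump_class_derivative by blast
  then show ?case by (auto intro!: continuous_at_imp_continuous_on has_derivative_continuous)
next
  case (Suc k)
  then obtain D where D: "\<And>x. (f has_derivative D x) (at x)" "\<And>b. bump_class c a (\<lambda>x. D x b)"
    using bump_class_derivative by blast
  have "partial_deriv b f = (\<lambda>x. D x b)" for b
    unfolding partial_deriv_def using frechet_derivative_at[OF D(1)] by auto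
  then show ?case using Suc.IH[OF D(2)] D(1) by (auto simp: differentiable_def)
qed

definition bump :: "real \<Rightarrow> 'a::euclidean_space \<Rightarrow> real" where
  "bump d z = flat_exp 0 (1 - (1 / d\<^sup>2) * (z \<bullet> z))"

lemma bump_nonneg: "0 \<le> bump d z" and bump_le_1: "bump d z \<le> 1"
  by (auto simp: bump_def flat_exp_def)

lemma bump_pos_iff: "0 < d \<Longrightarrow> 0 < bump d z \<longleftrightarrow> norm z < d"
proof -
  assume d: "0 < d"
  have "0 < bump d z \<longleftrightarrow> (norm z)\<^sup>2 < d\<^sup>2"
    using d by (auto simp: bump_def flat_exp_def field_simps power2_norm_eq_inner[symmetric])
  then show ?thesis using d abs_le_square_iff[of d "norm z"] by (auto simp: not_le[symmetric])
qed

lemma bump_eq_0: "0 < d \<Longrightarrow> d \<le> norm z \<Longrightarrow> bump d z = 0"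
  using bump_pos_iff[of d z] bump_nonneg[of d z] by linarith

lemma bump_minus [simp]: "bump d (- z) = bump d z"
  by (simp add: bump_def)

lemma continuous_bump: "continuous_on UNIV (bump d)"
  using bump_class_Ck[OF bump_class.flat[of "1/d\<^sup>2" 0 0], of 0] by (simp add: bump_def[abs_def])

lemma measurable_bump [measurable]: "bump d \<in> borel_measurable borel"
  by (intro borel_measurable_continuous_onI continuous_bump)

text \<open>The type argument fixes the space, which the radius alone does not determine.\<close>

definition bump_mass :: "'a::euclidean_space itself \<Rightarrow> real \<Rightarrow> real" where
  "bump_mass _ d = enn2real (\<integral>\<^sup>+z. ennreal (bump d (z :: 'a)) \<partial>lborel)"

lemma nn_integral_bump:
  assumes d: "0 < d"
  shows "(\<integral>\<^sup>+z. ennreal (bump d (z :: 'a::euclidean_space)) \<partial>lborel) = ennreal (bump_mass TYPE('a) d)"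
    and bump_mass_pos: "0 < bump_mass TYPE('a) d"
proof -
  let ?I = "\<integral>\<^sup>+z. ennreal (bump d (z :: 'a)) \<partial>lborel"
  have "?I \<le> (\<integral>\<^sup>+z. indicator (ball (0::'a) d) z \<partial>lborel)"
  proof (rule nn_integral_mono)
    fix z :: 'a show "ennreal (bump d z) \<le> indicator (ball 0 d) z"
      using bump_le_1[of d z] bump_eq_0[OF d, of z] by (auto simp: indicator_def ennreal_le_1)
  qed
  also have "\<dots> < top" using emeasure_bounded_finite[of "ball (0::'a) d"] by simp
  finally have fin: "?I < top" .
  have "?I \<noteq> 0"
  proof
    assume "?I = 0"
    then have "AE z in lborel. ennreal (bump d (z :: 'a)) = 0"
      by (subst (asm) nn_integral_0_iff_AE) auto
    then have "AE z in lborel. (z :: 'a) \<notin> ball 0 d"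
      by eventually_elim (use bump_pos_iff[OF d] in \<open>auto simp: ennreal_eq_0_iff not_less[symmetric]\<close>)
    then have "emeasure lborel {z :: 'a. norm z < d} = 0"
      by (subst (asm) AE_iff_measurable[OF _ refl]) auto
    moreover have "{x. norm x < d} = ball (0::'a) d" by auto
    ultimately show False using d unit_ball_vol_pos[of "real DIM('a)"] by (simp add: emeasure_ball)
  qed
  with fin show "?I = ennreal (bump_mass TYPE('a) d)" "0 < bump_mass TYPE('a) d"
    by (auto simp: bump_mass_def less_top enn2real_positive_iff zero_less_iff_neq_zero)
qed

definition mollifier :: "real \<Rightarrow> 'a::euclidean_space \<Rightarrow> real" where
  "mollifier d z = bump d z / bump_mass TYPE('a) d"

lemma mollifier_nonneg: "0 < d \<Longrightarrow> 0 \<le> mollifier d z"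
  using bump_nonneg[of d z] bump_mass_pos[where 'a='a, of d] by (simp add: mollifier_def)

lemma mollifier_eq_0: "0 < d \<Longrightarrow> d \<le> norm z \<Longrightarrow> mollifier d z = 0"
  by (simp add: mollifier_def bump_eq_0)

lemma mollifier_minus: "mollifier d (x - y) = mollifier d (y - x)"
  using bump_minus[of d "x - y"] by (simp add: mollifier_def)

lemma measurable_mollifier [measurable]: "mollifier d \<in> borel_measurable borel"
  unfolding mollifier_def[abs_def] by measurable

lemma nn_integral_mollifier:
  "0 < d \<Longrightarrow> (\<integral>\<^sup>+z. ennreal (mollifier d (z :: 'a::euclidean_space)) \<partial>lborel) = 1"
proof -
  assume d: "0 < d"
  have "(\<integral>\<^sup>+z. ennreal (mollifier d (z :: 'a)) \<partial>lborel) = (\<integral>\<^sup>+z. ennreal (bump d (z :: 'a)) / ennreal (bump_mass TYPE('a) d) \<partial>lborel)"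
    using bump_mass_pos[OF d, where 'a='a] by (simp add: mollifier_def divide_ennreal bump_nonneg)
  then show ?thesis using d bump_mass_pos[OF d, where 'a='a]
    by (simp add: nn_integral_divide nn_integral_bump divide_ennreal)
qed

text \<open>By the symmetry of the bump, the reflected and translated kernel is a multiple of a
  generator of the class centred at \<open>x\<close>.\<close>

lemma mollifier_test_function:
  assumes d: "0 < d" shows "(\<lambda>y. mollifier d (x - y)) \<in> test_functions"
proof -
  have "(\<lambda>y. mollifier d (x - y)) = (\<lambda>y. (1 / bump_mass TYPE('a) d) * flat_exp 0 (1 - (1 / d\<^sup>2) * ((y - x) \<bullet> (y - x))))"
    by (intro ext, subst mollifier_minus) (simp add: mollifier_def bump_def)
  then have "bump_class (1 / d\<^sup>2) x (\<lambda>y. mollifier d (x - y))"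
    by (simp only:) (intro bump_class.intros)
  moreover have "bounded {y. mollifier d (x - y) \<noteq> 0}"
  proof (rule bounded_subset[OF bounded_cball])
    show "{y. mollifier d (x - y) \<noteq> 0} \<subseteq> cball x d"
      using mollifier_eq_0[OF d, of "x - _"] by (force simp: dist_norm)
  qed
  ultimately show ?thesis unfolding test_functions_def by (auto intro: bump_class_Ck)
qed

section \<open>Test functions\<close>

definition grad :: "('a::euclidean_space \<Rightarrow> real) \<Rightarrow> 'a \<Rightarrow> 'a" where
  "grad \<phi> x = (\<Sum>b\<in>Basis. partial_deriv b \<phi> x *\<^sub>R b)"

lemma grad_inner_Basis: "b \<in> Basis \<Longrightarrow> grad \<phi> x \<bullet> b = partial_deriv b \<phi> x"
  unfolding grad_def by (simp add: inner_sum_left inner_Basis if_distrib sum.delta cong: if_cong)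

lemma test_function_gradient:
  assumes "\<phi> \<in> test_functions" shows "has_gradient \<phi> (grad \<phi>)"
  unfolding has_gradient_def
proof (intro conjI allI)
  have Ck: "Ck k \<phi>" for k using assms by (auto simp: test_functions_def)
  show "continuous_on UNIV (grad \<phi>)"
    unfolding grad_def[abs_def] using Ck[of "Suc 0"] by (auto intro!: continuous_intros)
  fix x
  have "\<phi> differentiable (at x)" using Ck[of "Suc 0"] by auto
  then have D: "(\<phi> has_derivative frechet_derivative \<phi> (at x)) (at x)" by (simp add: frechet_derivative_works)
  then interpret bounded_linear "frechet_derivative \<phi> (at x)" by (rule has_derivative_bounded_linear)
  have "frechet_derivative \<phi> (at x) h = grad \<phi> x \<bullet> h" for h
  proof -
    have "frechet_derivative \<phi> (at x) h = frechet_derivative \<phi> (at x) (\<Sum>b\<in>Basis. (h \<bullet> b) *\<^sub>R b)"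
      by (simp add: euclidean_representation)
    also have "\<dots> = (\<Sum>b\<in>Basis. (h \<bullet> b) * partial_deriv b \<phi> x)"
      by (simp add: sum scaleR partial_deriv_def)
    also have "\<dots> = grad \<phi> x \<bullet> h"
      unfolding grad_def by (simp add: inner_sum_left inner_commute[of h] mult.commute)
    finally show ?thesis .
  qed
  then have "frechet_derivative \<phi> (at x) = (\<bullet>) (grad \<phi> x)" by (rule ext)
  with D show "(\<phi> has_derivative (\<bullet>) (grad \<phi> x)) (at x)" by (simp only:)
qed

text \<open>The complement of the closed ball is open, so \<open>u\<close> vanishes in a
  neighbourhood of \<open>x\<close>.\<close>

lemma has_gradient_zero_outside:
  assumes u: "has_gradient u g" and z: "\<And>x. x \<notin> cball 0 M \<Longrightarrow> u x = 0" and x: "x \<notin> cball 0 M"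
  shows "g x = 0"
proof -
  have "(u has_derivative (\<lambda>h. g x \<bullet> h)) (at x)" using u by (simp add: has_gradient_def)
  moreover have "(u has_derivative (\<lambda>h. 0)) (at x)"
    by (rule has_derivative_transform_within_open[of "\<lambda>_. 0" _ _ _ "- cball 0 M"]) (use z x in auto)
  ultimately have "(\<lambda>h. g x \<bullet> h) = (\<lambda>h. 0)" by (rule has_derivative_unique)
  then have "g x \<bullet> g x = 0" by meson
  then show ?thesis by simp
qed

lemma test_function_support:
  assumes "\<phi> \<in> test_functions" obtains M where "0 < M" "\<And>x. x \<notin> cball 0 M \<Longrightarrow> \<phi> x = 0" "\<And>x. x \<notin> cball 0 M \<Longrightarrow> grad \<phi> x = 0"
proof -
  have "bounded (closure {x. \<phi> x \<noteq> 0})" using assms by (auto simp: test_functions_def compact_imp_bounded)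
  then have "bounded {x. \<phi> x \<noteq> 0}" using bounded_subset closure_subset by blast
  then obtain M where M: "0 < M" "\<And>x. \<phi> x \<noteq> 0 \<Longrightarrow> norm x \<le> M" by (auto simp: bounded_pos)
  then have "\<phi> x = 0" if "x \<notin> cball 0 M" for x using that by force
  with M that has_gradient_zero_outside[OF test_function_gradient[OF assms]] show ?thesis by blast
qed

text \<open>The gradient has bounded support and is therefore uniformly continuous. Uniformity in
  \<open>x\<close> is what differentiation under the integral sign requires.\<close>

lemma has_gradient_uniform_remainder:
  fixes u :: "'a::euclidean_space \<Rightarrow> real"
  assumes u: "has_gradient u g" and z: "\<And>x. x \<notin> cball 0 M \<Longrightarrow> u x = 0" and e: "0 < e"
  shows "\<exists>d>0. \<forall>x h. norm h < d \<longrightarrow> \<bar>u (x + h) - u x - g x \<bullet> h\<bar> \<le> e * norm h"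
proof -
  have gz: "g x = 0" if "x \<notin> cball 0 M" for x
    using has_gradient_zero_outside[OF u z that] .
  have "uniformly_continuous_on (cball 0 (M + 1)) g"
    using u by (intro compact_uniformly_continuous) (auto simp: has_gradient_def intro: continuous_on_subset)
  then obtain d where d: "0 < d" "\<And>x y. x \<in> cball 0 (M + 1) \<Longrightarrow> y \<in> cball 0 (M + 1) \<Longrightarrow> dist y x < d \<Longrightarrow> dist (g y) (g x) < e"
    using e unfolding uniformly_continuous_on_def by metis
  show ?thesis
  proof (intro exI[of _ "min d 1"] conjI allI impI)
    fix x h :: 'a assume h: "norm h < min d 1"
    have near: "norm (g y - g x) \<le> e" if y: "y \<in> ball x (min d 1)" for y
    proof (cases "x \<in> cball 0 (M + 1) \<and> y \<in> cball 0 (M + 1)")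
      case True
      then show ?thesis using d(2)[of x y] y by (auto simp: dist_norm norm_minus_commute)
    next
      \<comment> \<open>If one of two points at distance less than 1 is outside the ball of radius
        \<open>M + 1\<close>, then both are outside the ball of radius \<open>M\<close>, where
        \<open>g\<close> vanishes.\<close>
      case False
      have "norm y \<le> norm x + norm (y - x)" "norm x \<le> norm y + norm (x - y)" by (metis norm_triangle_sub)+
      moreover have "norm (y - x) < 1" using y by (auto simp: dist_norm norm_minus_commute)
      ultimately have "x \<notin> cball 0 M \<and> y \<notin> cball 0 M"
        using False by (auto simp: norm_minus_commute[of x y])
      then show ?thesis using gz e by simp
    qed
    \<comment> \<open>Mean value inequality for \<open>u\<close> minus the linear function with
      slope \<open>g x\<close>, whose gradient is small on the whole ball around
      \<open>x\<close>.\<close>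
    have "norm ((u (x + h) - g x \<bullet> (x + h)) - (u x - g x \<bullet> x)) \<le> e * norm ((x + h) - x)"
    proof (rule differentiable_bound)
      show "convex (ball x (min d 1))" by simp
      fix y assume y: "y \<in> ball x (min d 1)"
      have "((\<lambda>y. u y - g x \<bullet> y) has_derivative (\<lambda>h. g y \<bullet> h - g x \<bullet> h)) (at y)"
        using u by (auto simp: has_gradient_def intro!: derivative_intros)
      then show "((\<lambda>y. u y - g x \<bullet> y) has_derivative (\<lambda>h. g y \<bullet> h - g x \<bullet> h)) (at y within ball x (min d 1))"
        by (rule has_derivative_at_withinI)
      show "onorm (\<lambda>h. g y \<bullet> h - g x \<bullet> h) \<le> e"
      proof (rule onorm_le)
        fix k show "norm (g y \<bullet> k - g x \<bullet> k) \<le> e * norm k"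
          using Cauchy_Schwarz_ineq2[of "g y - g x" k] mult_right_mono[OF near[OF y], of "norm k"]
          by (simp add: inner_diff_left)
      qed
    qed (use h d in \<open>auto simp: dist_norm\<close>)
    then show "\<bar>u (x + h) - u x - g x \<bullet> h\<bar> \<le> e * norm h" by (simp add: inner_add_right algebra_simps)
  qed (use d in auto)
qed

section \<open>Convolutions\<close>

lemma ball_borel [measurable]: "ball a r \<in> sets borel" "cball a r \<in> sets borel"
  by auto

definition locally_integrable :: "('a::euclidean_space \<Rightarrow> 'b::euclidean_space) \<Rightarrow> bool" where
  "locally_integrable f \<longleftrightarrow> f \<in> borel_measurable borel \<and>
    (\<forall>M. (\<integral>\<^sup>+x. ennreal (norm (f x)) * indicator (cball 0 M) x \<partial>lborel) < top)"

lemma locally_integrable_inner: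
  assumes "locally_integrable f" shows "locally_integrable (\<lambda>x. f x \<bullet> b)"
proof -
  have [measurable]: "f \<in> borel_measurable borel" using assms by (simp add: locally_integrable_def)
  have "(\<integral>\<^sup>+x. ennreal (norm (f x \<bullet> b)) * indicator (cball 0 M) x \<partial>lborel) < top" for M
  proof -
    have "(\<integral>\<^sup>+x. ennreal (norm (f x \<bullet> b)) * indicator (cball 0 M) x \<partial>lborel) \<le>
      (\<integral>\<^sup>+x. ennreal (norm b) * (ennreal (norm (f x)) * indicator (cball 0 M) x) \<partial>lborel)"
      using Cauchy_Schwarz_ineq2[of "f _" b]
      by (intro nn_integral_mono) (auto simp: indicator_def ennreal_mult[symmetric] mult.commute intro!: ennreal_leI)
    also have "\<dots> = ennreal (norm b) * (\<integral>\<^sup>+x. ennreal (norm (f x)) * indicator (cball 0 M) x \<partial>lborel)"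
      by (intro nn_integral_cmult) measurable
    also have "\<dots> < top" using assms by (auto simp: locally_integrable_def ennreal_mult_less_top)
    finally show ?thesis .
  qed
  then show ?thesis by (simp add: locally_integrable_def)
qed

lemma integrable_locally_integrable_times:
  fixes f :: "'a::euclidean_space \<Rightarrow> 'b::euclidean_space"
  assumes f: "locally_integrable f" and [measurable]: "\<psi> \<in> borel_measurable borel"
    and z: "\<And>x. x \<notin> cball 0 M \<Longrightarrow> \<psi> x = 0" and B: "\<And>x. \<bar>\<psi> x\<bar> \<le> B"
  shows "integrable lborel (\<lambda>x. \<psi> x *\<^sub>R f x)"
    and "norm (LINT x|lborel. \<psi> x *\<^sub>R f x) \<le> B * enn2real (\<integral>\<^sup>+x. ennreal (norm (f x)) * indicator (cball 0 M) x \<partial>lborel)"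
proof -
  have [measurable]: "f \<in> borel_measurable borel" using f by (simp add: locally_integrable_def)
  have B0: "0 \<le> B" using B[of 0] by linarith
  let ?I = "\<integral>\<^sup>+x. ennreal (norm (f x)) * indicator (cball 0 M) x \<partial>lborel"
  have fin: "?I < top" using f by (simp add: locally_integrable_def)
  have "(\<integral>\<^sup>+x. ennreal (norm (\<psi> x *\<^sub>R f x)) \<partial>lborel) \<le> (\<integral>\<^sup>+x. ennreal B * (ennreal (norm (f x)) * indicator (cball 0 M) x) \<partial>lborel)"
  proof (rule nn_integral_mono)
    fix x show "ennreal (norm (\<psi> x *\<^sub>R f x)) \<le> ennreal B * (ennreal (norm (f x)) * indicator (cball 0 M) x)"
      using z[of x] B[of x] B0 by (cases "x \<in> cball 0 M") (auto simp: ennreal_mult[symmetric] intro!: ennreal_leI mult_right_mono)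
  qed
  also have "\<dots> = ennreal B * ?I" by (intro nn_integral_cmult) measurable
  also have "\<dots> = ennreal (B * enn2real ?I)" using fin B0 by (simp add: ennreal_mult)
  finally have le: "(\<integral>\<^sup>+x. ennreal (norm (\<psi> x *\<^sub>R f x)) \<partial>lborel) \<le> ennreal (B * enn2real ?I)" .
  then show i: "integrable lborel (\<lambda>x. \<psi> x *\<^sub>R f x)"
    by (intro integrableI_bounded) (auto simp: le_less_trans)
  show "norm (LINT x|lborel. \<psi> x *\<^sub>R f x) \<le> B * enn2real ?I"
    using order_trans[OF integral_norm_bound_ennreal[OF i] le] B0 by simp
qed

lemma continuous_bounded_of_support:
  fixes u :: "'a::euclidean_space \<Rightarrow> 'b::euclidean_space"
  assumes u: "continuous_on UNIV u" and z: "\<And>x. x \<notin> cball 0 M \<Longrightarrow> u x = 0"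
  obtains B where "0 < B" "\<And>x. norm (u x) \<le> B"
proof -
  have "bounded (u ` cball 0 M)"
    by (intro compact_imp_bounded compact_continuous_image continuous_on_subset[OF u]) auto
  then obtain B where B: "0 < B" "\<And>x. x \<in> cball 0 M \<Longrightarrow> norm (u x) \<le> B" by (auto simp: bounded_pos)
  then have "norm (u x) \<le> B" for x using z[of x] by (cases "x \<in> cball 0 M") (auto simp: less_imp_le)
  with B(1) that show ?thesis by blast
qed

text \<open>The first-order remainders of the kernel are uniformly small and, for short shifts,
  supported in one ball, over which \<open>f\<close> has a finite integral. The point 0 stands for
  all points, which are reached by translating the kernel; the minus sign comes from the shift
  \<open>y - h\<close>.\<close>

lemma convolution_has_derivative:
  fixes f :: "'a::euclidean_space \<Rightarrow> real"
  assumes f: "locally_integrable f" and u: "has_gradient u g" and z: "\<And>x. x \<notin> cball 0 M \<Longrightarrow> u x = 0"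
  shows "((\<lambda>h. LINT y|lborel. u (y - h) * f y) has_derivative (\<lambda>h. - (LINT y|lborel. (g y \<bullet> h) * f y))) (at 0)"
proof -
  note [measurable] = has_gradient_measurable[OF u]
  have gz: "g x = 0" if "x \<notin> cball 0 M" for x using has_gradient_zero_outside[OF u z that] .
  obtain Bu where "0 < Bu" and Bu: "\<And>x. norm (u x) \<le> Bu"
    using continuous_bounded_of_support[OF has_gradient_continuous[OF u] z] by metis
  have cg: "continuous_on UNIV g" using u by (simp add: has_gradient_def)
  obtain Bg where "0 < Bg" and Bg: "\<And>x. norm (g x) \<le> Bg"
    using continuous_bounded_of_support[OF cg gz] by metis
  have int_g: "integrable lborel (\<lambda>y. (g y \<bullet> h) * f y)" for h
  proof -
    have "\<bar>g y \<bullet> h\<bar> \<le> Bg * norm h" for y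
      using order_trans[OF Cauchy_Schwarz_ineq2 mult_right_mono[OF Bg, of "norm h"]] by simp
    then have "integrable lborel (\<lambda>y. (g y \<bullet> h) *\<^sub>R f y)"
      by (intro integrable_locally_integrable_times(1)[OF f, where M=M]) (auto simp: gz)
    then show ?thesis by simp
  qed
  have int_u: "integrable lborel (\<lambda>y. u (y - h) * f y)" for h
  proof -
    have "u (y - h) = 0" if "y \<notin> cball 0 (M + norm h)" for y
      using that norm_triangle_ineq2[of y h] by (intro z) auto
    then have "integrable lborel (\<lambda>y. u (y - h) *\<^sub>R f y)"
      by (intro integrable_locally_integrable_times(1)[OF f, where M="M + norm h"]) (use Bu in auto)
    then show ?thesis by simp
  qed
  \<comment> \<open>The radius is \<open>M + 1\<close> because shifts shorter than 1 enlarge the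
    support by at most 1. Below, the denominator \<open>I + 1\<close> avoids a division by
    0.\<close>
  define I where "I = enn2real (\<integral>\<^sup>+x. ennreal (norm (f x)) * indicator (cball 0 (M + 1)) x \<partial>lborel)"
  have I: "0 \<le> I" by (simp add: I_def)
  show ?thesis unfolding has_derivative_at_alt
  proof (intro conjI allI impI)
    have eq: "(LINT y|lborel. (g y \<bullet> h) * f y) = (\<Sum>b\<in>Basis. (h \<bullet> b) * (LINT y|lborel. (g y \<bullet> b) * f y))" for h
    proof -
      have "(LINT y|lborel. (g y \<bullet> h) * f y) = (LINT y|lborel. (\<Sum>b\<in>Basis. (h \<bullet> b) * ((g y \<bullet> b) * f y)))"
        by (intro Bochner_Integration.integral_cong refl, subst euclidean_inner) (simp only: sum_distrib_right, simp add: mult_ac)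
      also have "\<dots> = (\<Sum>b\<in>Basis. (h \<bullet> b) * (LINT y|lborel. (g y \<bullet> b) * f y))"
        using int_g by (subst Bochner_Integration.integral_sum) auto
      finally show ?thesis .
    qed
    have "linear (\<lambda>h. - (\<Sum>b\<in>Basis. (h \<bullet> b) * (LINT y|lborel. (g y \<bullet> b) * f y)))"
      by (rule linearI) (simp_all add: inner_add_left distrib_right sum.distrib sum_distrib_left mult.assoc)
    moreover have "(\<lambda>h. - (LINT y|lborel. (g y \<bullet> h) * f y)) = (\<lambda>h. - (\<Sum>b\<in>Basis. (h \<bullet> b) * (LINT y|lborel. (g y \<bullet> b) * f y)))"
      by (intro ext arg_cong[where f=uminus] eq)
    ultimately show "bounded_linear (\<lambda>h. - (LINT y|lborel. (g y \<bullet> h) * f y))"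
      by (simp only: linear_conv_bounded_linear)
    fix e :: real assume e: "0 < e"
    then have "0 < e / (I + 1)" using I by simp
    from has_gradient_uniform_remainder[OF u z this] obtain d where d: "0 < d"
      "\<And>x h. norm h < d \<Longrightarrow> \<bar>u (x + h) - u x - g x \<bullet> h\<bar> \<le> e / (I + 1) * norm h" by blast
    show "\<exists>d>0. \<forall>h. norm (h - 0) < d \<longrightarrow> norm ((LINT y|lborel. u (y - h) * f y) - (LINT y|lborel. u (y - 0) * f y) - - (LINT y|lborel. (g y \<bullet> (h - 0)) * f y)) \<le> e * norm (h - 0)"
    proof (intro exI[of _ "min d 1"] conjI allI impI)
      fix h :: 'a assume h: "norm (h - 0) < min d 1"
      let ?psi = "\<lambda>y. u (y - h) - u y + g y \<bullet> h"
      have "(LINT y|lborel. u (y - h) * f y) - (LINT y|lborel. u (y - 0) * f y) - - (LINT y|lborel. (g y \<bullet> (h - 0)) * f y) = (LINT y|lborel. ?psi y *\<^sub>R f y)"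
        using int_u[of h] int_u[of 0] int_g[of h] by (simp add: algebra_simps)
      also have "norm \<dots> \<le> (e / (I + 1) * norm h) * I"
        unfolding I_def
      proof (rule integrable_locally_integrable_times(2)[OF f])
        fix x
        show "\<bar>?psi x\<bar> \<le> e / (enn2real (\<integral>\<^sup>+x. ennreal (norm (f x)) * indicator (cball 0 (M + 1)) x \<partial>lborel) + 1) * norm h"
          using d(2)[of "- h" x] h unfolding I_def by simp
        assume "x \<notin> cball 0 (M + 1)"
        then have "x \<notin> cball 0 M" "x - h \<notin> cball 0 M" using h norm_triangle_ineq2[of x h] by auto
        then show "?psi x = 0" using z gz by simp
      qed measurable
      also have "\<dots> \<le> e * norm h"
      proof -
        have "e * I / (I + 1) \<le> e" using e I by (simp add: field_simps)
        from mult_right_mono[OF this, of "norm h"] show ?thesis by (simp add: mult_ac)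
      qed
      finally show "norm ((LINT y|lborel. u (y - h) * f y) - (LINT y|lborel. u (y - 0) * f y) - - (LINT y|lborel. (g y \<bullet> (h - 0)) * f y)) \<le> e * norm (h - 0)" by simp
    qed (use d in auto)
  qed
qed

text \<open>The p-th power of the norm in \<open>L^p\<close>, kept without the root so that it is an
  integral to which Tonelli's theorem applies directly.\<close>

definition pint :: "real \<Rightarrow> ('a::euclidean_space \<Rightarrow> 'b::euclidean_space) \<Rightarrow> ennreal" where
  "pint p F = (\<integral>\<^sup>+x. epow (ennreal (norm (F x))) p \<partial>lborel)"

lemma epow_norm_add:
  assumes "0 \<le> p"
  shows "epow (ennreal (norm (a + b))) p \<le> ennreal (2 powr p) * (epow (ennreal (norm a)) p + epow (ennreal (norm b)) p)"
proof -
  have "epow (ennreal (norm (a + b))) p \<le> epow (ennreal (norm a) + ennreal (norm b)) p"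
    using assms by (intro epow_mono) (auto simp: ennreal_plus[symmetric] norm_triangle_ineq simp del: ennreal_plus)
  also have "\<dots> \<le> ennreal (2 powr p) * (epow (ennreal (norm a)) p + epow (ennreal (norm b)) p)"
    by (rule epow_double_add[OF assms])
  finally show ?thesis .
qed

lemma pint_add:
  assumes "0 \<le> p" and [measurable]: "F \<in> borel_measurable borel" "G \<in> borel_measurable borel"
  shows "pint p (\<lambda>x. F x + G x) \<le> ennreal (2 powr p) * (pint p F + pint p G)"
proof -
  have "pint p (\<lambda>x. F x + G x) \<le> (\<integral>\<^sup>+x. ennreal (2 powr p) * (epow (ennreal (norm (F x))) p + epow (ennreal (norm (G x))) p) \<partial>lborel)"
    unfolding pint_def by (intro nn_integral_mono epow_norm_add assms)
  also have "\<dots> = ennreal (2 powr p) * (pint p F + pint p G)"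
    unfolding pint_def by (subst nn_integral_cmult) (auto intro!: arg_cong2[where f="(*)"] nn_integral_add)
  finally show ?thesis .
qed

lemma pint_diff:
  assumes "0 \<le> p" and [measurable]: "F \<in> borel_measurable borel" "G \<in> borel_measurable borel"
  shows "pint p (\<lambda>x. F x - G x) \<le> ennreal (2 powr p) * (pint p F + pint p G)"
proof -
  have "pint p (\<lambda>x. F x + - G x) \<le> ennreal (2 powr p) * (pint p F + pint p (\<lambda>x. - G x))"
    by (intro pint_add assms) measurable
  then show ?thesis by (simp add: pint_def)
qed

lemma pint_shift:
  assumes [measurable]: "F \<in> borel_measurable borel"
  shows "pint p (\<lambda>x. F (x + h)) = pint p F"
  unfolding pint_def by (simp add: add.commute[of _ h]) (rule nn_integral_shift, measurable)

lemma pint_mono: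
  "0 \<le> p \<Longrightarrow> (\<And>x. norm (F x) \<le> norm (G x)) \<Longrightarrow> pint p F \<le> pint p G"
  unfolding pint_def by (intro nn_integral_mono epow_mono ennreal_leI)

text \<open>Since \<open>p\<close> is at least 1, every nonnegative \<open>t\<close> satisfies
  \<open>t \<le> 1 + t powr p\<close>, and the constant 1 is integrable over a ball.\<close>

lemma locally_integrable_pint:
  fixes F :: "'a::euclidean_space \<Rightarrow> 'b::euclidean_space"
  assumes "1 \<le> p" and [measurable]: "F \<in> borel_measurable borel" and fin: "pint p F < top"
  shows "locally_integrable F"
  unfolding locally_integrable_def
proof (intro conjI allI)
  fix M
  have "(\<integral>\<^sup>+x. ennreal (norm (F x)) * indicator (cball 0 M) x \<partial>lborel) \<le> (\<integral>\<^sup>+x. indicator (cball 0 M) x + epow (ennreal (norm (F x))) p \<partial>lborel)"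
  proof (rule nn_integral_mono)
    fix x :: 'a
    have "ennreal (norm (F x)) \<le> 1 + epow (ennreal (norm (F x))) p"
    proof (cases "norm (F x) \<le> 1")
      case True
      then show ?thesis by (auto intro!: add_increasing2 simp: ennreal_le_1)
    next
      case False
      then have "norm (F x) powr 1 \<le> norm (F x) powr p" using assms(1) by (intro powr_mono) auto
      then have "ennreal (norm (F x)) \<le> epow (ennreal (norm (F x))) p"
        using assms(1) False by (auto simp: epow_ennreal intro!: ennreal_leI)
      then show ?thesis by (simp add: add_increasing)
    qed
    then show "ennreal (norm (F x)) * indicator (cball 0 M) x \<le> indicator (cball 0 M) x + epow (ennreal (norm (F x))) p"
      by (auto simp: indicator_def)
  qed
  also have "\<dots> = emeasure lborel (cball (0::'a) M) + pint p F"
    unfolding pint_def by (subst nn_integral_add) auto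
  also have "\<dots> < top" using fin emeasure_bounded_finite[of "cball (0::'a) M"] by simp
  finally show "(\<integral>\<^sup>+x. ennreal (norm (F x)) * indicator (cball 0 M) x \<partial>lborel) < top" .
qed simp

section \<open>Continuity of translations in \<open>L\<^sup>p\<close>\<close>

text \<open>The part of \<open>A\<close> outside a large ball has small measure by continuity from
  above. The bounded part is approximated from inside by a closed set, which is then compact. Each
  of the two losses is less than half of \<open>e\<close>.\<close>

lemma inner_regular_compact:
  fixes A :: "'a::euclidean_space set"
  assumes A: "A \<in> sets borel" "emeasure lborel A < top" and e: "0 < e"
  obtains K where "compact K" "K \<subseteq> A" "emeasure lborel (A - K) < e"
proof -
  have "(\<lambda>n. emeasure lborel (A - cball 0 (real n))) \<longlonglongrightarrow> emeasure lborel (\<Inter>n. A - cball 0 (real n))"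
  proof (rule Lim_emeasure_decseq)
    show "decseq (\<lambda>n. A - cball 0 (real n))" by (intro decseq_SucI) auto
    show "emeasure lborel (A - cball 0 (real n)) \<noteq> \<infinity>" for n
    proof -
      have "emeasure lborel (A - cball 0 (real n)) \<le> emeasure lborel A" using A by (intro emeasure_mono) auto
      then show ?thesis using A by auto
    qed
  qed (use A in auto)
  moreover have "(\<Inter>n. A - cball 0 (real n)) = {}"
    using real_arch_simple by (auto simp: not_le[symmetric])
  ultimately have lim: "(\<lambda>n. emeasure lborel (A - cball 0 (real n))) \<longlonglongrightarrow> 0" by (simp only: emeasure_empty)
  obtain d where d: "0 < d" "ennreal d + ennreal d \<le> e"
  proof (cases e rule: ennreal_cases)
    case (real r)
    then have "0 < r / 2" "ennreal (r/2) + ennreal (r/2) \<le> e" using e by (auto simp: ennreal_plus[symmetric] simp del: ennreal_plus)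
    then show ?thesis using that by blast
  qed (use that[of 1] in simp)
  have "\<forall>\<^sub>F n in sequentially. emeasure lborel (A - cball 0 (real n)) < ennreal d"
    using d by (intro order_tendstoD(2)[OF lim]) auto
  then obtain n where n: "emeasure lborel (A - cball 0 (real n)) < ennreal d" by (auto simp: eventually_sequentially)
  have "A \<inter> cball 0 (real n) \<in> sets lebesgue" using A by auto
  then obtain T where T: "closed T" "T \<subseteq> A \<inter> cball 0 (real n)" "(A \<inter> cball 0 (real n)) - T \<in> lmeasurable"
    "emeasure lebesgue ((A \<inter> cball 0 (real n)) - T) < ennreal d"
    using sets_lebesgue_inner_closed[of "A \<inter> cball 0 (real n)" d] d(1) by blast
  show ?thesis
  proof
    show "compact T" using T(1,2) by (meson bounded_cball bounded_subset compact_eq_bounded_closed le_inf_iff)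
    show "T \<subseteq> A" using T by auto
    have "emeasure lborel (A - T) \<le> emeasure lborel ((A - cball 0 (real n)) \<union> ((A \<inter> cball 0 (real n)) - T))"
      using A T(1) by (intro emeasure_mono) auto
    also have "\<dots> \<le> emeasure lborel (A - cball 0 (real n)) + emeasure lborel ((A \<inter> cball 0 (real n)) - T)"
      using A T(1) by (intro emeasure_subadditive) auto
    also have "\<dots> < ennreal d + ennreal d"
      using T(4) n A T(1) by (intro add_strict_mono) (auto simp: emeasure_completion)
    also have "\<dots> \<le> e" by (rule d)
    finally show "emeasure lborel (A - T) < e" .
  qed
qed

text \<open>The filter \<open>nhds 0\<close> includes the shift \<open>h = 0\<close>, so smallness
  holds on a full ball of shifts.\<close>

definition translation_continuous :: "real \<Rightarrow> ('a::euclidean_space \<Rightarrow> 'b::euclidean_space) \<Rightarrow> bool" where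
  "translation_continuous p F \<longleftrightarrow> ((\<lambda>h. pint p (\<lambda>x. F (x + h) - F x)) \<longlongrightarrow> 0) (nhds 0)"

lemma translation_continuous_zero: "0 < p \<Longrightarrow> translation_continuous p (\<lambda>_. 0)"
  unfolding translation_continuous_def pint_def by simp

lemma translation_continuous_add:
  assumes p: "0 \<le> p" and [measurable]: "F \<in> borel_measurable borel" "G \<in> borel_measurable borel"
    and F: "translation_continuous p F" and G: "translation_continuous p G"
  shows "translation_continuous p (\<lambda>x. F x + G x)"
  unfolding translation_continuous_def
proof (rule tendsto_sandwich[OF _ _ tendsto_const])
  let ?B = "\<lambda>h. ennreal (2 powr p) * (pint p (\<lambda>x. F (x + h) - F x) + pint p (\<lambda>x. G (x + h) - G x))"
  have "pint p (\<lambda>x. F (x + h) + G (x + h) - (F x + G x)) \<le> ?B h" for h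
    using pint_add[OF p, of "\<lambda>x. F (x + h) - F x" "\<lambda>x. G (x + h) - G x"] by (simp add: algebra_simps)
  then show "\<forall>\<^sub>F h in nhds 0. pint p (\<lambda>x. F (x + h) + G (x + h) - (F x + G x)) \<le> ?B h" by simp
  have "((\<lambda>h. pint p (\<lambda>x. F (x + h) - F x) + pint p (\<lambda>x. G (x + h) - G x)) \<longlongrightarrow> 0 + 0) (nhds 0)"
    using F G unfolding translation_continuous_def by (rule tendsto_add)
  then show "(?B \<longlongrightarrow> 0) (nhds 0)"
    using ennreal_tendsto_cmult[of "ennreal (2 powr p)"] by fastforce
qed simp

lemma translation_continuous_sum:
  assumes p: "0 < p" and "finite S" "\<And>c. c \<in> S \<Longrightarrow> F c \<in> borel_measurable borel" "\<And>c. c \<in> S \<Longrightarrow> translation_continuous p (F c)"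
  shows "translation_continuous p (\<lambda>x. \<Sum>c\<in>S. F c x)"
  using assms(2-)
proof (induction S rule: finite_induct)
  case (insert a S)
  then show ?case using p
    by (simp add: translation_continuous_add)
qed (use p in \<open>simp add: translation_continuous_zero\<close>)

text \<open>Translation invariance of \<open>pint\<close> makes the approximation error of the
  shifted function independent of \<open>h\<close>. Functions with continuous translations thus form
  a closed class.\<close>

lemma translation_continuous_approx:
  fixes F :: "'a::euclidean_space \<Rightarrow> 'b::euclidean_space"
  assumes p: "0 \<le> p" and [measurable]: "F \<in> borel_measurable borel"
    and approx: "\<And>e. 0 < e \<Longrightarrow> \<exists>G. G \<in> borel_measurable borel \<and> translation_continuous p G \<and> pint p (\<lambda>x. F x - G x) < ennreal e"
  shows "translation_continuous p F"
  unfolding translation_continuous_def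
\<comment> \<open>Two nested splittings cost \<open>2 powr p\<close> each. The summand 3 counts the
  error \<open>F - G\<close> at two points and one increment of \<open>G\<close>; the latter is
  enlarged by a factor of at least 1 to fit the common form.\<close>
proof (rule tendsto_0_ennrealI[where K="2 powr p * 2 powr p * 3"])
  let ?c = "ennreal (2 powr p)"
  fix d :: real assume d: "0 < d"
  obtain G where [measurable]: "G \<in> borel_measurable borel" and G: "translation_continuous p G" "pint p (\<lambda>x. F x - G x) < ennreal d"
    using approx[OF d] by blast
  have "\<forall>\<^sub>F h in nhds 0. pint p (\<lambda>x. G (x + h) - G x) < ennreal d"
    using G(1) d unfolding translation_continuous_def by (intro order_tendstoD(2)) auto
  then show "\<forall>\<^sub>F h in nhds 0. pint p (\<lambda>x. F (x + h) - F x) \<le> ennreal (2 powr p * 2 powr p * 3) * ennreal d"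
  proof eventually_elim
    case (elim h)
    let ?D = "\<lambda>x. F x - G x"
    have "pint p (\<lambda>x. F (x + h) - F x) = pint p (\<lambda>x. (?D (x + h) - ?D x) + (G (x + h) - G x))"
      by (simp add: algebra_simps)
    also have "\<dots> \<le> ?c * (pint p (\<lambda>x. ?D (x + h) - ?D x) + pint p (\<lambda>x. G (x + h) - G x))"
      by (intro pint_add p) measurable
    also have "\<dots> \<le> ?c * (?c * (pint p (\<lambda>x. ?D (x + h)) + pint p ?D) + pint p (\<lambda>x. G (x + h) - G x))"
      by (intro mult_left_mono add_right_mono pint_diff p) auto
    also have "pint p (\<lambda>x. ?D (x + h)) = pint p ?D" by (rule pint_shift) measurable
    also have "?c * (?c * (pint p ?D + pint p ?D) + pint p (\<lambda>x. G (x + h) - G x)) \<le> ?c * (?c * (ennreal d + ennreal d) + ?c * ennreal d)"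
    proof (intro mult_left_mono add_mono)
      have "1 \<le> ?c" using p by (simp add: ge_one_powr_ge_zero)
      then show "pint p (\<lambda>x. G (x + h) - G x) \<le> ?c * ennreal d"
        using elim mult_mono[of 1 ?c "pint p (\<lambda>x. G (x + h) - G x)" "ennreal d"] by (simp add: less_imp_le)
    qed (use G less_imp_le in auto)
    also have "\<dots> = ennreal (2 powr p * 2 powr p * 3) * ennreal d"
      using d by (simp add: ennreal_mult'[symmetric] ennreal_plus[symmetric] del: ennreal_plus)
    finally show ?case .
  qed
qed

lemma pint_indicator:
  assumes "0 < p" "A \<in> sets borel"
  shows "pint p (\<lambda>x. indicator A x *\<^sub>R c) = epow (ennreal (norm c)) p * emeasure lborel A"
proof -
  have "pint p (\<lambda>x. indicator A x *\<^sub>R c) = (\<integral>\<^sup>+x. epow (ennreal (norm c)) p * indicator A x \<partial>lborel)"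
    unfolding pint_def using assms(1) by (intro nn_integral_cong) (auto simp: indicator_def)
  then show ?thesis using assms(2) by (simp add: nn_integral_cmult_indicator)
qed

text \<open>A shift shorter than \<open>d\<close> changes the indicator only on the shell
  \<open>T d - K\<close> and on a translate of it. The shells have finite measure and shrink to the
  empty set, because \<open>K\<close> is closed.\<close>

lemma translation_continuous_compact:
  fixes K :: "'a::euclidean_space set"
  assumes p: "0 < p" and K: "compact K"
  shows "translation_continuous p (\<lambda>x. indicator K x *\<^sub>R (c :: 'b::euclidean_space))"
\<comment> \<open>The distance \<open>infdist\<close> to the empty set is 0, so the neighbourhoods
  \<open>T d\<close> below would be the whole space.\<close>
proof (cases "K = {}")
  case True
  then show ?thesis using p by (simp add: translation_continuous_zero)
next
  case False
  have [measurable]: "K \<in> sets borel" using K by (simp add: compact_imp_closed)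
  define T where "T d = {x. infdist x K \<le> d}" for d
  have Tc: "closed (T d)" for d
    unfolding T_def by (intro closed_Collect_le continuous_intros)
  have [measurable]: "T d \<in> sets borel" for d using Tc by auto
  have Tb: "bounded (T d)" for d
  proof -
    obtain B where B: "\<And>y. y \<in> K \<Longrightarrow> norm y \<le> B" using compact_imp_bounded[OF K] by (auto simp: bounded_iff)
    have "norm x \<le> B + d" if x: "x \<in> T d" for x
    proof -
      obtain y where y: "y \<in> K" "infdist x K = dist x y"
        using infdist_attains_inf[OF compact_imp_closed[OF K] False] by blast
      then show ?thesis using B[of y] x norm_triangle_sub[of x y] by (auto simp: T_def dist_norm)
    qed
    then show ?thesis by (auto simp: bounded_iff)
  qed
  have "(\<lambda>n. emeasure lborel (T (inverse (real (Suc n))) - K)) \<longlonglongrightarrow> emeasure lborel (\<Inter>n. T (inverse (real (Suc n))) - K)"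
  proof (rule Lim_emeasure_decseq)
    show "decseq (\<lambda>n. T (inverse (real (Suc n))) - K)"
      unfolding T_def by (intro decseq_SucI) (auto elim!: order_trans intro!: le_imp_inverse_le simp del: of_nat_Suc)
    show "emeasure lborel (T (inverse (real (Suc n))) - K) \<noteq> \<infinity>" for n
      using emeasure_bounded_finite[OF bounded_subset[OF Tb[of "inverse (real (Suc n))"], of "T (inverse (real (Suc n))) - K"]] by auto
  qed auto
  moreover have "(\<Inter>n. T (inverse (real (Suc n))) - K) = {}"
  proof -
    have False if x: "\<And>n. infdist x K \<le> inverse (real (Suc n))" "x \<notin> K" for x
    proof -
      have "0 < infdist x K" using x(2) K False by (simp add: infdist_pos_not_in_closed compact_imp_closed)
      then obtain n where "inverse (real (Suc n)) < infdist x K" using reals_Archimedean by blast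
      with x(1)[of n] show False by simp
    qed
    then show ?thesis unfolding T_def by auto
  qed
  ultimately have lim: "(\<lambda>n. emeasure lborel (T (inverse (real (Suc n))) - K)) \<longlonglongrightarrow> 0" by (simp only: emeasure_empty)
  have bound: "pint p (\<lambda>x. indicator K (x + h) *\<^sub>R c - indicator K x *\<^sub>R c) \<le>
     ennreal (2 powr p) * (epow (ennreal (norm c)) p * emeasure lborel (T d - K) + epow (ennreal (norm c)) p * emeasure lborel (T d - K))"
    if h: "norm h < d" for h d
  proof -
    let ?I = "\<lambda>x. indicator (T d - K) x *\<^sub>R c"
    have near: "y \<in> T d" if "x \<in> K" "dist y x < d" for x y
      using infdist_le[OF that(1), of y] that(2) by (simp add: T_def)
    \<comment> \<open>If exactly one of \<open>x\<close> and \<open>x + h\<close> lies in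
      \<open>K\<close>, the other one lies in the shell.\<close>
    have "pint p (\<lambda>x. indicator K (x + h) *\<^sub>R c - indicator K x *\<^sub>R c) \<le> pint p (\<lambda>x. ?I x - - ?I (x + h))"
    proof (rule pint_mono)
      fix x
      have "x + h \<in> K \<Longrightarrow> x \<in> T d" using near[of "x + h" x] h by (simp add: dist_norm)
      moreover have "x \<in> K \<Longrightarrow> x + h \<in> T d" using near[of x "x + h"] h by (simp add: dist_norm)
      ultimately show "norm (indicator K (x + h) *\<^sub>R c - indicator K x *\<^sub>R c) \<le> norm (?I x - - ?I (x + h))"
        by (auto simp: indicator_def)
    qed (use p in simp)
    also have "\<dots> \<le> ennreal (2 powr p) * (pint p ?I + pint p (\<lambda>x. - ?I (x + h)))"
      using p by (intro pint_diff) auto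
    also have "pint p (\<lambda>x. - ?I (x + h)) = pint p ?I"
      using pint_shift[of ?I p h] by (simp add: pint_def)
    also have "pint p ?I = epow (ennreal (norm c)) p * emeasure lborel (T d - K)"
      using p by (intro pint_indicator) auto
    finally show ?thesis .
  qed
  show ?thesis unfolding translation_continuous_def
  proof (rule order_tendstoI)
    fix e :: ennreal assume e: "0 < e"
    let ?B = "\<lambda>n. ennreal (2 powr p) * (epow (ennreal (norm c)) p * emeasure lborel (T (inverse (real (Suc n))) - K) + epow (ennreal (norm c)) p * emeasure lborel (T (inverse (real (Suc n))) - K))"
    have "?B \<longlonglongrightarrow> ennreal (2 powr p) * (epow (ennreal (norm c)) p * 0 + epow (ennreal (norm c)) p * 0)"
      using p by (intro ennreal_tendsto_cmult tendsto_add lim) (auto simp: epow_eq_top_iff epow_ennreal)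
    then have "\<forall>\<^sub>F n in sequentially. ?B n < e" using e by (intro order_tendstoD(2)) auto
    then obtain n where n: "?B n < e" by (auto simp: eventually_sequentially)
    have "\<forall>\<^sub>F h in nhds (0::'a). norm h < inverse (real (Suc n))"
      by (intro order_tendstoD(2)[OF tendsto_norm[OF filterlim_ident]]) auto
    then show "\<forall>\<^sub>F h in nhds 0. pint p (\<lambda>x. indicator K (x + h) *\<^sub>R c - indicator K x *\<^sub>R c) < e"
      by eventually_elim (use n bound le_less_trans in blast)
  qed simp
qed

lemma translation_continuous_indicator:
  fixes A :: "'a::euclidean_space set"
  assumes p: "0 < p" and [measurable]: "A \<in> sets borel" and fin: "emeasure lborel A < top"
  shows "translation_continuous p (\<lambda>x. indicator A x *\<^sub>R (c :: 'b::euclidean_space))"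
proof (rule translation_continuous_approx)
  fix e :: real assume e: "0 < e"
  define k where "k = norm c powr p"
  have k: "0 \<le> k" by (simp add: k_def)
  have "0 < ennreal (e / (k + 1))" using e k by simp
  then obtain K where K: "compact K" "K \<subseteq> A" "emeasure lborel (A - K) < ennreal (e / (k + 1))"
    using inner_regular_compact[OF assms(2) fin] by blast
  have [measurable]: "K \<in> sets borel" using K by (simp add: compact_imp_closed)
  have "pint p (\<lambda>x. indicator A x *\<^sub>R c - indicator K x *\<^sub>R c) = pint p (\<lambda>x. indicator (A - K) x *\<^sub>R c)"
    using K(2) by (intro arg_cong[where f="pint p"] ext) (auto simp: indicator_def)
  also have "\<dots> = ennreal k * emeasure lborel (A - K)"
    using p by (subst pint_indicator) (auto simp: k_def epow_ennreal)
  also have "\<dots> \<le> ennreal k * ennreal (e / (k + 1))" using K by (intro mult_left_mono) auto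
  also have "\<dots> = ennreal (k * e / (k + 1))" using k by (simp add: ennreal_mult'[symmetric])
  also have "\<dots> < ennreal e" using k e by (intro ennreal_lessI) (auto simp: field_simps)
  finally show "\<exists>G. G \<in> borel_measurable borel \<and> translation_continuous p G \<and> pint p (\<lambda>x. indicator A x *\<^sub>R c - G x) < ennreal e"
    using translation_continuous_compact[OF p K(1), of c] by (intro exI[of _ "\<lambda>x. indicator K x *\<^sub>R c"]) auto
qed (use p in auto)

text \<open>Simple functions dominated by \<open>2 |F|\<close> converge to \<open>F\<close> in
  \<open>L^p\<close>. The domination also forces each level set of a nonzero value to have finite
  measure, so the case of indicators applies.\<close>

lemma translation_continuous_pint:
  fixes F :: "'a::euclidean_space \<Rightarrow> 'b::euclidean_space"
  assumes p: "1 \<le> p" and [measurable]: "F \<in> borel_measurable borel" and fin: "pint p F < top"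
  shows "translation_continuous p F"
proof (rule translation_continuous_approx)
  fix e :: real assume e: "0 < e"
  have p0: "0 < p" using p by simp
  have "F \<in> borel_measurable lborel" by simp
  from borel_measurable_implies_sequence_metric[OF this, of 0]
  obtain s where s: "\<And>i. simple_function lborel (s i)" "\<And>x. (\<lambda>i. s i x) \<longlonglongrightarrow> F x" "\<And>i x. norm (s i x) \<le> 2 * norm (F x)"
    by (auto simp: dist_norm)
  have [measurable]: "s i \<in> borel_measurable borel" for i
    using borel_measurable_simple_function[OF s(1)[of i]] by simp
  have "(\<lambda>i. pint p (\<lambda>x. F x - s i x)) \<longlonglongrightarrow> (\<integral>\<^sup>+(x::'a). 0 \<partial>lborel)"
    unfolding pint_def
  proof (rule nn_integral_dominated_convergence)
    show "AE x in lborel. epow (ennreal (norm (F x - s i x))) p \<le> epow (ennreal 3) p * epow (ennreal (norm (F x))) p" for i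
    proof (intro AE_I2)
      fix x
      have "norm (F x - s i x) \<le> 3 * norm (F x)" using norm_triangle_ineq4[of "F x" "s i x"] s(3)[of i x] by linarith
      then show "epow (ennreal (norm (F x - s i x))) p \<le> epow (ennreal 3) p * epow (ennreal (norm (F x))) p"
        using p by (subst epow_mult[symmetric]) (auto simp: ennreal_mult'[symmetric] simp del: ennreal_numeral intro!: epow_mono ennreal_leI)
    qed
    show "(\<integral>\<^sup>+x. epow (ennreal 3) p * epow (ennreal (norm (F x))) p \<partial>lborel) < \<infinity>"
      using fin p by (subst nn_integral_cmult) (auto simp: pint_def ennreal_mult_less_top epow_ennreal simp del: ennreal_numeral)
    show "AE x in lborel. (\<lambda>i. epow (ennreal (norm (F x - s i x))) p) \<longlonglongrightarrow> 0"
    proof (intro AE_I2 epow_tendsto_0 p0)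
      fix x
      have "(\<lambda>i. norm (F x - s i x)) \<longlonglongrightarrow> norm (F x - F x)" by (intro tendsto_intros s)
      then show "(\<lambda>i. ennreal (norm (F x - s i x))) \<longlonglongrightarrow> 0" using tendsto_ennrealI by fastforce
    qed
  qed measurable
  then have "\<forall>\<^sub>F i in sequentially. pint p (\<lambda>x. F x - s i x) < ennreal e"
    using e by (intro order_tendstoD(2)) auto
  then obtain i where i: "pint p (\<lambda>x. F x - s i x) < ennreal e" by (auto simp: eventually_sequentially)
  have fin_range: "finite (range (s i))" using s(1)[of i] by (auto simp: simple_function_def)
  have "translation_continuous p (\<lambda>x. \<Sum>c\<in>range (s i). indicator (s i -` {c}) x *\<^sub>R c)"
  proof (rule translation_continuous_sum[OF p0 fin_range])
    fix c assume "c \<in> range (s i)"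
    have [measurable]: "s i -` {c} \<in> sets borel" using measurable_sets[of "s i" borel borel "{c}"] by simp
    show "(\<lambda>x. indicator (s i -` {c}) x *\<^sub>R c) \<in> borel_measurable borel" by measurable
    show "translation_continuous p (\<lambda>x. indicator (s i -` {c}) x *\<^sub>R c)"
    proof (cases "c = 0")
      case False
      have "epow (ennreal (norm c)) p * emeasure lborel (s i -` {c}) = pint p (\<lambda>x. indicator (s i -` {c}) x *\<^sub>R c)"
        using p0 by (subst pint_indicator) auto
      also have "\<dots> \<le> pint p (\<lambda>x. 2 *\<^sub>R F x)"
        using s(3)[of i] p0 by (intro pint_mono) (auto simp: indicator_def)
      also have "\<dots> = epow (ennreal 2) p * pint p F"
        unfolding pint_def using p0
        by (subst nn_integral_cmult[symmetric]) (auto simp: epow_mult[symmetric] ennreal_mult simp del: ennreal_numeral)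
      also have "\<dots> < top" using fin p0 by (simp add: ennreal_mult_less_top epow_ennreal del: ennreal_numeral)
      finally have "emeasure lborel (s i -` {c}) < top"
        using False p0 by (auto simp: ennreal_mult_less_top epow_ennreal less_top)
      then show ?thesis using p0 by (intro translation_continuous_indicator) auto
    qed (use p0 in \<open>simp add: translation_continuous_zero\<close>)
  qed
  moreover have "(\<Sum>c\<in>range (s i). indicator (s i -` {c}) x *\<^sub>R c) = s i x" for x
  proof -
    have "(\<Sum>c\<in>range (s i). indicator (s i -` {c}) x *\<^sub>R c) = (\<Sum>c\<in>range (s i). if c = s i x then s i x else 0)"
      by (intro sum.cong) (auto simp: indicator_def)
    then show ?thesis using fin_range by (simp add: sum.delta')
  qed
  ultimately show "\<exists>G. G \<in> borel_measurable borel \<and> translation_continuous p G \<and> pint p (\<lambda>x. F x - G x) < ennreal e"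
    using i by (intro exI[of _ "s i"]) auto
qed (use p in auto)

section \<open>Mollification of Sobolev functions\<close>

definition mollify :: "real \<Rightarrow> ('a::euclidean_space \<Rightarrow> 'b::euclidean_space) \<Rightarrow> 'a \<Rightarrow> 'b" where
  "mollify d F x = (LINT y|lborel. mollifier d (x - y) *\<^sub>R F y)"

lemma mollifier_gradient:
  assumes d: "0 < d"
  shows "has_gradient (\<lambda>y. mollifier d (x - y)) (grad (\<lambda>y. mollifier d (x - y)))"
    and "y \<notin> cball 0 (norm x + d) \<Longrightarrow> mollifier d (x - y) = 0"
proof -
  show "has_gradient (\<lambda>y. mollifier d (x - y)) (grad (\<lambda>y. mollifier d (x - y)))"
    by (rule test_function_gradient[OF mollifier_test_function[OF d]])
  show "mollifier d (x - y) = 0" if "y \<notin> cball 0 (norm x + d)"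
    using that norm_triangle_ineq2[of y x] by (intro mollifier_eq_0 d) (auto simp: norm_minus_commute)
qed

lemma integrable_mollify:
  fixes F :: "'a::euclidean_space \<Rightarrow> 'b::euclidean_space"
  assumes d: "0 < d" and F: "locally_integrable F"
  shows "integrable lborel (\<lambda>y. mollifier d (x - y) *\<^sub>R F y)"
proof (rule integrable_locally_integrable_times(1)[OF F])
  show "mollifier d (x - y) = 0" if "y \<notin> cball 0 (norm x + d)" for y
    by (rule mollifier_gradient(2)[OF d that])
  show "\<bar>mollifier d (x - y)\<bar> \<le> 1 / bump_mass TYPE('a) d" for y
    using bump_nonneg[of d "x - y"] bump_le_1[of d "x - y"] bump_mass_pos[OF d, where 'a='a]
    by (auto simp: mollifier_def intro!: divide_right_mono)
qed measurable

lemma mollify_has_derivative: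
  fixes f :: "'a::euclidean_space \<Rightarrow> real"
  assumes d: "0 < d" and f: "locally_integrable f"
  shows "(mollify d f has_derivative (\<lambda>h. - (LINT y|lborel. (grad (\<lambda>y. mollifier d (x - y)) y \<bullet> h) * f y))) (at x)"
proof -
  have "((\<lambda>h. LINT y|lborel. mollifier d (x - (y - h)) * f y) has_derivative
      (\<lambda>h. - (LINT y|lborel. (grad (\<lambda>y. mollifier d (x - y)) y \<bullet> h) * f y))) (at 0)"
    using convolution_has_derivative[OF f mollifier_gradient(1)[OF d] mollifier_gradient(2)[OF d, of _ x]] by simp
  moreover have "(\<lambda>h. LINT y|lborel. mollifier d (x - (y - h)) * f y) = (\<lambda>h. mollify d f (x + h))"
    unfolding mollify_def by (simp add: algebra_simps)
  ultimately have "((\<lambda>h. mollify d f (x + h)) has_derivative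
      (\<lambda>h. - (LINT y|lborel. (grad (\<lambda>y. mollifier d (x - y)) y \<bullet> h) * f y))) (at (x - x))" by simp
  from diff_chain_at[OF has_derivative_diff[OF has_derivative_ident has_derivative_const] this]
  show ?thesis by (simp add: o_def)
qed

lemma mollify_inner:
  assumes "0 < d" "locally_integrable F"
  shows "mollify d F x \<bullet> b = mollify d (\<lambda>y. F y \<bullet> b) x"
  unfolding mollify_def using integral_inner_left[OF integrable_mollify[OF assms]] by simp

text \<open>Each coordinate is the mollification of a real function and hence
  differentiable.\<close>

lemma continuous_mollify:
  fixes F :: "'a::euclidean_space \<Rightarrow> 'b::euclidean_space"
  assumes d: "0 < d" and F: "locally_integrable F"
  shows "continuous_on UNIV (mollify d F)"
proof -
  have "continuous_on UNIV (\<lambda>x. mollify d F x \<bullet> b)" for b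
    unfolding mollify_inner[OF assms]
    using mollify_has_derivative[OF d locally_integrable_inner[OF F]]
    by (auto intro!: continuous_at_imp_continuous_on has_derivative_continuous)
  then show ?thesis by (subst continuous_on_componentwise) auto
qed

text \<open>The counterpart of \<^const>\<open>distributional_gradient\<close> for Borel representatives.\<close>

definition weak_gradient :: "('a::euclidean_space \<Rightarrow> real) \<Rightarrow> ('a \<Rightarrow> 'a) \<Rightarrow> bool" where
  "weak_gradient f g \<longleftrightarrow> (\<forall>\<phi>\<in>test_functions. \<forall>b\<in>Basis.
     (LINT x|lborel. f x * partial_deriv b \<phi> x) = - (LINT x|lborel. (g x \<bullet> b) * \<phi> x))"

text \<open>The derivative falls on the kernel, which as a function of \<open>y\<close> is a test
  function. The minus sign of the convolution derivative and that of the weak gradient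
  cancel.\<close>

lemma mollify_has_gradient:
  assumes d: "0 < d" and f: "locally_integrable f" and v: "locally_integrable v" and w: "weak_gradient f v"
  shows "has_gradient (mollify d f) (mollify d v)"
  unfolding has_gradient_def
proof (intro conjI allI)
  show "continuous_on UNIV (mollify d v)" by (rule continuous_mollify[OF d v])
  fix x
  let ?D = "\<lambda>h. - (LINT y|lborel. (grad (\<lambda>y. mollifier d (x - y)) y \<bullet> h) * f y)"
  have D: "(mollify d f has_derivative ?D) (at x)" by (rule mollify_has_derivative[OF d f])
  have "?D h = mollify d v x \<bullet> h" for h
  proof -
    interpret bounded_linear ?D using D by (rule has_derivative_bounded_linear)
    have "?D b = mollify d v x \<bullet> b" if b: "b \<in> Basis" for b
    proof -
      have "?D b = - (LINT y|lborel. f y * partial_deriv b (\<lambda>y. mollifier d (x - y)) y)"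
        using b by (simp add: grad_inner_Basis mult.commute)
      also have "\<dots> = (LINT y|lborel. (v y \<bullet> b) * mollifier d (x - y))"
        using w b mollifier_test_function[OF d, of x] unfolding weak_gradient_def by simp
      also have "\<dots> = mollify d v x \<bullet> b"
        unfolding mollify_inner[OF d v] by (simp add: mollify_def mult.commute)
      finally show ?thesis .
    qed
    then have "?D (\<Sum>b\<in>Basis. (h \<bullet> b) *\<^sub>R b) = (\<Sum>b\<in>Basis. (h \<bullet> b) * (mollify d v x \<bullet> b))"
      unfolding sum scaleR by simp
    then show ?thesis by (simp only: euclidean_representation euclidean_inner[of "mollify d v x" h] mult.commute)
  qed
  then show "(mollify d f has_derivative (\<bullet>) (mollify d v x)) (at x)"
    using D by (simp only:)
qed

text \<open>The kernel has mass 1, so \<open>F x\<close> is an average of itself and the difference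
  is an average of increments.\<close>

lemma mollify_diff_le:
  fixes F :: "'a::euclidean_space \<Rightarrow> 'b::euclidean_space"
  assumes d: "0 < d" and F: "locally_integrable F"
  shows "ennreal (norm (mollify d F x - F x)) \<le> (\<integral>\<^sup>+z. ennreal (norm (F (x + z) - F x)) * ennreal (mollifier d z) \<partial>lborel)"
proof -
  have [measurable]: "F \<in> borel_measurable borel" using F by (simp add: locally_integrable_def)
  have c: "(\<integral>\<^sup>+y. ennreal (mollifier d (x - y)) \<partial>lborel) = 1"
    using nn_integral_shift[of "\<lambda>z. ennreal (mollifier d (z - x))" x] nn_integral_shift[of "\<lambda>z. ennreal (mollifier d z)" "- x"]
      nn_integral_mollifier[OF d, where 'a='a] by (simp add: mollifier_minus[of d x])
  have i: "integrable lborel (\<lambda>y. mollifier d (x - y))"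
    using c mollifier_nonneg[OF d] by (intro integrableI_nonneg) auto
  have i1: "(LINT y|lborel. mollifier d (x - y)) = 1"
    using c mollifier_nonneg[OF d] by (intro integral_eq_nn_integral[THEN trans]) auto
  have "mollify d F x - F x = (LINT y|lborel. mollifier d (x - y) *\<^sub>R F y) - (LINT y|lborel. mollifier d (x - y) *\<^sub>R F x)"
    using i i1 by (simp add: mollify_def)
  also have "\<dots> = (LINT y|lborel. mollifier d (x - y) *\<^sub>R (F y - F x))"
    using i integrable_mollify[OF d F, of x] by (subst Bochner_Integration.integral_diff[symmetric]) (auto simp: scaleR_diff_right)
  finally have "ennreal (norm (mollify d F x - F x)) \<le> (\<integral>\<^sup>+y. norm (mollifier d (x - y) *\<^sub>R (F y - F x)) \<partial>lborel)"
    using i integrable_mollify[OF d F, of x]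
    by (simp only:) (rule integral_norm_bound_ennreal, simp add: scaleR_diff_right)
  also have "\<dots> = (\<integral>\<^sup>+z. norm (mollifier d (x - (x + z)) *\<^sub>R (F (x + z) - F x)) \<partial>lborel)"
    by (rule nn_integral_shift[symmetric]) measurable
  also have "\<dots> = (\<integral>\<^sup>+z. ennreal (norm (F (x + z) - F x)) * ennreal (mollifier d z) \<partial>lborel)"
    using mollifier_nonneg[OF d, where 'a='a] mollifier_minus[of d "0 :: 'a"]
    by (intro nn_integral_cong) (simp add: ennreal_mult mult.commute)
  finally show ?thesis .
qed

text \<open>Jensen's inequality for the probability weight given by the kernel, followed by
  Tonelli's theorem, reduces the mollification error to translations shorter than
  \<open>d\<close>.\<close>

lemma pint_mollify_le:
  fixes F :: "'a::euclidean_space \<Rightarrow> 'b::euclidean_space"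
  assumes p: "1 \<le> p" and d: "0 < d" and F: "locally_integrable F"
    and e: "\<And>z. norm z < d \<Longrightarrow> pint p (\<lambda>x. F (x + z) - F x) \<le> e"
  shows "pint p (\<lambda>x. mollify d F x - F x) \<le> e"
proof -
  have [measurable]: "F \<in> borel_measurable borel" using F by (simp add: locally_integrable_def)
  have "pint p (\<lambda>x. mollify d F x - F x) \<le> (\<integral>\<^sup>+x. (\<integral>\<^sup>+z. epow (ennreal (norm (F (x + z) - F x))) p * ennreal (mollifier d z) \<partial>lborel) \<partial>lborel)"
    unfolding pint_def
  proof (rule nn_integral_mono)
    fix x
    have "epow (ennreal (norm (mollify d F x - F x))) p \<le> epow (\<integral>\<^sup>+z. ennreal (norm (F (x + z) - F x)) * ennreal (mollifier d z) \<partial>lborel) p"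
      using p by (intro epow_mono mollify_diff_le d F) auto
    also have "\<dots> \<le> epow (\<integral>\<^sup>+z. ennreal (mollifier d (z::'a)) \<partial>lborel) (p - 1) * (\<integral>\<^sup>+z. epow (ennreal (norm (F (x + z) - F x))) p * ennreal (mollifier d z) \<partial>lborel)"
      using p by (intro nn_integral_Jensen) auto
    finally show "epow (ennreal (norm (mollify d F x - F x))) p \<le> (\<integral>\<^sup>+z. epow (ennreal (norm (F (x + z) - F x))) p * ennreal (mollifier d z) \<partial>lborel)"
      by (simp add: nn_integral_mollifier[OF d])
  qed
  also have "\<dots> = (\<integral>\<^sup>+z. (\<integral>\<^sup>+x. epow (ennreal (norm (F (x + z) - F x))) p * ennreal (mollifier d z) \<partial>lborel) \<partial>lborel)"
    by (rule lborel_pair.Fubini') measurable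
  also have "\<dots> = (\<integral>\<^sup>+z. pint p (\<lambda>x. F (x + z) - F x) * ennreal (mollifier d z) \<partial>lborel)"
    unfolding pint_def by (intro nn_integral_cong nn_integral_multc) measurable
  also have "\<dots> \<le> (\<integral>\<^sup>+z. e * ennreal (mollifier d (z::'a)) \<partial>lborel)"
  proof (rule nn_integral_mono)
    fix z :: 'a
    show "pint p (\<lambda>x. F (x + z) - F x) * ennreal (mollifier d z) \<le> e * ennreal (mollifier d z)"
      using e[of z] mollifier_eq_0[OF d, of z] by (cases "norm z < d") (auto intro: mult_right_mono)
  qed
  also have "\<dots> = e"
    by (subst nn_integral_cmult) (auto simp: nn_integral_mollifier[OF d])
  finally show ?thesis .
qed

lemma ex_pint_mollify_small:
  fixes F :: "'a::euclidean_space \<Rightarrow> 'b::euclidean_space"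
  assumes p: "1 \<le> p" and [measurable]: "F \<in> borel_measurable borel" and fin: "pint p F < top" and e: "0 < e"
  shows "\<exists>d0>0. \<forall>d. 0 < d \<longrightarrow> d \<le> d0 \<longrightarrow> pint p (\<lambda>x. mollify d F x - F x) \<le> e"
proof -
  have "\<forall>\<^sub>F h in nhds 0. pint p (\<lambda>x. F (x + h) - F x) < e"
    using translation_continuous_pint[OF assms(1-3)] e unfolding translation_continuous_def
    by (intro order_tendstoD(2)) auto
  then obtain d0 where "0 < d0" "\<And>h. norm h < d0 \<Longrightarrow> pint p (\<lambda>x. F (x + h) - F x) < e"
    unfolding eventually_nhds_metric by (auto simp: dist_norm)
  then show ?thesis
    by (intro exI[of _ d0] conjI allI impI pint_mollify_le p locally_integrable_pint[OF p _ fin]) (auto intro: less_imp_le)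
qed

text \<open>The geometric rate makes the sum of the p-th powers integrable, so it is finite almost
  everywhere and its terms tend to 0. Pointwise convergence is thus obtained without passing to a
  subsequence.\<close>

lemma AE_tendsto_of_pint:
  fixes G :: "nat \<Rightarrow> 'a::euclidean_space \<Rightarrow> 'b::euclidean_space"
  assumes p: "0 < p" and [measurable]: "\<And>n. G n \<in> borel_measurable borel" and le: "\<And>n. pint p (G n) \<le> ennreal ((1/2) ^ n)"
  shows "AE x in lborel. (\<lambda>n. G n x) \<longlonglongrightarrow> 0"
proof -
  have "(\<integral>\<^sup>+x. (\<Sum>n. epow (ennreal (norm (G n x))) p) \<partial>lborel) = (\<Sum>n. pint p (G n))"
    unfolding pint_def by (rule nn_integral_suminf) measurable
  also have "\<dots> \<le> (\<Sum>n. ennreal ((1/2) ^ n))" by (intro suminf_le le) auto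
  also have "\<dots> = ennreal (\<Sum>n. (1/2) ^ n)" by (intro suminf_ennreal2) auto
  finally have "(\<integral>\<^sup>+x. (\<Sum>n. epow (ennreal (norm (G n x))) p) \<partial>lborel) \<noteq> \<infinity>" by (auto simp: top_unique)
  then have "AE x in lborel. (\<Sum>n. epow (ennreal (norm (G n x))) p) \<noteq> \<infinity>"
    by (intro nn_integral_PInf_AE) measurable
  then show ?thesis
  proof eventually_elim
    case (elim x)
    then have "summable (\<lambda>n. norm (G n x) powr p)"
      using p by (intro summable_suminf_not_top) (auto simp: epow_ennreal)
    then have "(\<lambda>n. norm (G n x) powr p) \<longlonglongrightarrow> 0" by (rule summable_LIMSEQ_zero)
    then have "(\<lambda>n. (norm (G n x) powr p) powr (1/p)) \<longlonglongrightarrow> 0"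
      using p tendsto_powr'[of "\<lambda>n. norm (G n x) powr p" 0 sequentially "\<lambda>_. 1/p" "1/p"] by auto
    then have "(\<lambda>n. norm (G n x)) \<longlonglongrightarrow> 0" using p by (simp add: powr_powr)
    then show ?case by (rule tendsto_norm_zero_cancel)
  qed
qed

text \<open>For each index one radius serves \<open>f\<close> and \<open>v\<close> simultaneously,
  so that \<open>V n\<close> is the gradient of \<open>F n\<close>. The rate
  \<open>(1/2) ^ n\<close> is summable, which yields convergence almost everywhere as well.\<close>

lemma sobolev_approximation:
  fixes f :: "'a::euclidean_space \<Rightarrow> real"
  assumes p: "1 \<le> p" and [measurable]: "f \<in> borel_measurable borel" "v \<in> borel_measurable borel"
    and fin: "pint p f < top" "pint p v < top" and w: "weak_gradient f v"
  obtains F V where "\<And>n::nat. has_gradient (F n) (V n)"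
    "\<And>n. pint p (\<lambda>x. F n x - f x) \<le> ennreal ((1/2) ^ n)" "\<And>n. pint p (\<lambda>x. V n x - v x) \<le> ennreal ((1/2) ^ n)"
    "AE x in lborel. (\<lambda>n. F n x) \<longlonglongrightarrow> f x" "AE x in lborel. (\<lambda>n. V n x) \<longlonglongrightarrow> v x"
proof -
  have "\<exists>d>0. pint p (\<lambda>x. mollify d f x - f x) \<le> ennreal ((1/2) ^ n) \<and> pint p (\<lambda>x. mollify d v x - v x) \<le> ennreal ((1/2) ^ n)" for n
  proof -
    have e: "0 < ennreal ((1/2) ^ n)" by simp
    obtain d1 d2 where "0 < d1" "0 < d2" "\<And>d. 0 < d \<Longrightarrow> d \<le> d1 \<Longrightarrow> pint p (\<lambda>x. mollify d f x - f x) \<le> ennreal ((1/2) ^ n)"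
      "\<And>d. 0 < d \<Longrightarrow> d \<le> d2 \<Longrightarrow> pint p (\<lambda>x. mollify d v x - v x) \<le> ennreal ((1/2) ^ n)"
      using ex_pint_mollify_small[OF p assms(2) fin(1) e] ex_pint_mollify_small[OF p assms(3) fin(2) e] by metis
    then show ?thesis by (intro exI[of _ "min d1 d2"]) auto
  qed
  then obtain d where d: "\<And>n. 0 < d n" "\<And>n. pint p (\<lambda>x. mollify (d n) f x - f x) \<le> ennreal ((1/2) ^ n)"
    "\<And>n. pint p (\<lambda>x. mollify (d n) v x - v x) \<le> ennreal ((1/2) ^ n)" by metis
  have lf: "locally_integrable f" and lv: "locally_integrable v"
    using fin by (auto intro: locally_integrable_pint[OF p])
  have [measurable]: "mollify (d n) f \<in> borel_measurable borel" "mollify (d n) v \<in> borel_measurable borel" for n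
    using continuous_mollify[OF d(1) lf] continuous_mollify[OF d(1) lv] by (auto intro: borel_measurable_continuous_onI)
  have "AE x in lborel. (\<lambda>n. mollify (d n) f x - f x) \<longlonglongrightarrow> 0" "AE x in lborel. (\<lambda>n. mollify (d n) v x - v x) \<longlonglongrightarrow> 0"
    using p d by (auto intro!: AE_tendsto_of_pint[of p])
  then have "AE x in lborel. (\<lambda>n. mollify (d n) f x) \<longlonglongrightarrow> f x" "AE x in lborel. (\<lambda>n. mollify (d n) v x) \<longlonglongrightarrow> v x"
    by (auto simp: LIM_zero_iff)
  with that[of "\<lambda>n. mollify (d n) f" "\<lambda>n. mollify (d n) v"] mollify_has_gradient[OF d(1) lf lv w] d
  show ?thesis by blast
qed

section \<open>First-order remainders in the sense of \<open>L^p\<close>\<close>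

lemma AE_lborel_shift:
  fixes c :: "'a::euclidean_space"
  assumes "AE x in lborel. P x" shows "AE x in lborel. P (c + x)"
proof -
  have "AE x in distr lborel borel ((+) c). P x" using assms by (simp only: lborel_distr_plus)
  then show ?thesis by (rule AE_distrD[rotated]) measurable
qed

text \<open>The form in which estimates for smooth approximations pass to Sobolev functions: the
  integrands converge almost everywhere, and the bounds converge in \<open>ennreal\<close>.\<close>

lemma nn_integral_Fatou_epow:
  fixes G :: "nat \<Rightarrow> 'a \<Rightarrow> 'b::euclidean_space"
  assumes p: "0 < p" and [measurable]: "\<And>n. G n \<in> borel_measurable M" and [measurable]: "g \<in> borel_measurable M"
    and lim: "AE x in M. (\<lambda>n. G n x) \<longlonglongrightarrow> g x" and le: "\<And>n. (\<integral>\<^sup>+x. epow (ennreal (norm (G n x))) p \<partial>M) \<le> b n"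
    and b: "b \<longlonglongrightarrow> B"
  shows "(\<integral>\<^sup>+x. epow (ennreal (norm (g x))) p \<partial>M) \<le> B"
proof -
  have "(\<integral>\<^sup>+x. epow (ennreal (norm (g x))) p \<partial>M) = (\<integral>\<^sup>+x. liminf (\<lambda>n. epow (ennreal (norm (G n x))) p) \<partial>M)"
  proof (rule nn_integral_cong_AE)
    show "AE x in M. epow (ennreal (norm (g x))) p = liminf (\<lambda>n. epow (ennreal (norm (G n x))) p)"
      using lim
    proof eventually_elim
      case (elim x)
      have "(\<lambda>n. norm (G n x) powr p) \<longlonglongrightarrow> norm (g x) powr p"
        using p by (intro tendsto_powr' tendsto_norm elim) auto
      then have "(\<lambda>n. epow (ennreal (norm (G n x))) p) \<longlonglongrightarrow> epow (ennreal (norm (g x))) p"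
        using p by (simp add: epow_ennreal tendsto_ennrealI)
      then show ?case by (intro lim_imp_Liminf[symmetric]) auto
    qed
  qed
  also have "\<dots> \<le> liminf (\<lambda>n. \<integral>\<^sup>+x. epow (ennreal (norm (G n x))) p \<partial>M)"
    by (rule nn_integral_liminf) measurable
  also have "\<dots> \<le> liminf b" by (intro Liminf_mono always_eventually allI le)
  also have "\<dots> = B" using b by (intro lim_imp_Liminf) auto
  finally show ?thesis .
qed

text \<open>The derivative of \<open>u\<close> minus a linear function is integrated along the
  segment from \<open>x\<close> to \<open>x + h\<close>. The vector \<open>a\<close> is left free:
  it is \<open>g x\<close> for the estimate in \<open>L^p\<close> and an arbitrary constant for
  Morrey's estimate.\<close>

lemma has_gradient_remainder_le:
  fixes u :: "'a::euclidean_space \<Rightarrow> real"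
  assumes u: "has_gradient u g"
  shows "ennreal \<bar>u (x + h) - u x - a \<bullet> h\<bar> \<le> (\<integral>\<^sup>+t. ennreal (norm h) * ennreal (norm (g (x + t *\<^sub>R h) - a)) * indicator {0..1} t \<partial>lborel)"
proof -
  have c: "continuous_on S (\<lambda>t. g (x + t *\<^sub>R h))" for S
    using u unfolding has_gradient_def by (auto intro!: continuous_intros continuous_on_compose2[of UNIV g])
  have "ennreal (norm ((u (x + 1 *\<^sub>R h) - 1 *\<^sub>R (a \<bullet> h)) - (u (x + 0 *\<^sub>R h) - 0 *\<^sub>R (a \<bullet> h)))) \<le>
      (\<integral>\<^sup>+t. ennreal (norm (g (x + t *\<^sub>R h) \<bullet> h - a \<bullet> h)) * indicator {0..1} t \<partial>lborel)"
  proof (rule FTC_norm_le)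
    fix t
    show "((\<lambda>t. u (x + t *\<^sub>R h) - t *\<^sub>R (a \<bullet> h)) has_vector_derivative g (x + t *\<^sub>R h) \<bullet> h - a \<bullet> h) (at t)"
      by (intro has_vector_derivative_diff has_gradient_line[OF u]) (auto intro!: derivative_eq_intros)
  qed (auto intro!: continuous_intros c)
  also have "\<dots> \<le> (\<integral>\<^sup>+t. ennreal (norm h) * ennreal (norm (g (x + t *\<^sub>R h) - a)) * indicator {0..1} t \<partial>lborel)"
    using Cauchy_Schwarz_ineq2[of "g (x + _ *\<^sub>R h) - a" h]
    by (intro nn_integral_mono mult_right_mono) (auto simp: ennreal_mult[symmetric] inner_diff_left mult.commute intro!: ennreal_leI)
  finally show ?thesis by (simp add: algebra_simps)
qed

text \<open>Jensen's inequality in \<open>t\<close> moves the power inside, and Tonelli's theorem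
  leaves the increments of \<open>g\<close> under the shifts \<open>t *\<^sub>R h\<close>, none of
  which is longer than \<open>h\<close>.\<close>

lemma pint_remainder_smooth:
  fixes u :: "'a::euclidean_space \<Rightarrow> real"
  assumes p: "1 \<le> p" and u: "has_gradient u g"
    and e: "\<And>k. norm k \<le> norm h \<Longrightarrow> pint p (\<lambda>x. g (x + k) - g x) \<le> e"
  shows "pint p (\<lambda>x. u (x + h) - u x - g x \<bullet> h) \<le> epow (ennreal (norm h)) p * e"
proof -
  note [measurable] = has_gradient_measurable[OF u]
  have "pint p (\<lambda>x. u (x + h) - u x - g x \<bullet> h) \<le>
    (\<integral>\<^sup>+x. (\<integral>\<^sup>+t. epow (ennreal (norm h)) p * epow (ennreal (norm (g (x + t *\<^sub>R h) - g x))) p * indicator {0..1} t \<partial>lborel) \<partial>lborel)"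
    unfolding pint_def
  proof (rule nn_integral_mono)
    fix x
    have "epow (ennreal (norm (u (x + h) - u x - g x \<bullet> h))) p \<le>
      epow (\<integral>\<^sup>+t. ennreal (norm h) * ennreal (norm (g (x + t *\<^sub>R h) - g x)) * indicator {0..1} t \<partial>lborel) p"
      using p has_gradient_remainder_le[OF u, of x h "g x"] by (intro epow_mono) auto
    also have "\<dots> \<le> epow (\<integral>\<^sup>+t. indicator {0..1::real} t \<partial>lborel) (p - 1) *
      (\<integral>\<^sup>+t. epow (ennreal (norm h) * ennreal (norm (g (x + t *\<^sub>R h) - g x))) p * indicator {0..1} t \<partial>lborel)"
      using p by (intro nn_integral_Jensen) auto
    finally show "epow (ennreal (norm (u (x + h) - u x - g x \<bullet> h))) p \<le>
      (\<integral>\<^sup>+t. epow (ennreal (norm h)) p * epow (ennreal (norm (g (x + t *\<^sub>R h) - g x))) p * indicator {0..1} t \<partial>lborel)"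
      using p by (simp add: epow_mult)
  qed
  also have "\<dots> = (\<integral>\<^sup>+t. (\<integral>\<^sup>+x. epow (ennreal (norm h)) p * epow (ennreal (norm (g (x + t *\<^sub>R h) - g x))) p * indicator {0..1} t \<partial>lborel) \<partial>lborel)"
    by (rule lborel_pair.Fubini') measurable
  also have "\<dots> = (\<integral>\<^sup>+t. epow (ennreal (norm h)) p * pint p (\<lambda>x. g (x + t *\<^sub>R h) - g x) * indicator {0..1} t \<partial>lborel)"
    unfolding pint_def by (intro nn_integral_cong) (simp add: nn_integral_multc nn_integral_cmult)
  also have "\<dots> \<le> (\<integral>\<^sup>+t. epow (ennreal (norm h)) p * e * indicator {0..1::real} t \<partial>lborel)"
  proof (rule nn_integral_mono)
    fix t :: real
    show "epow (ennreal (norm h)) p * pint p (\<lambda>x. g (x + t *\<^sub>R h) - g x) * indicator {0..1} t \<le> epow (ennreal (norm h)) p * e * indicator {0..1} t"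
      using e[of "t *\<^sub>R h"] by (auto simp: indicator_def mult_left_le_one_le intro!: mult_left_mono)
  qed
  also have "\<dots> = epow (ennreal (norm h)) p * e" by (subst nn_integral_cmult_indicator) auto
  finally show ?thesis .
qed

definition sobolev_pair :: "real \<Rightarrow> ('a::euclidean_space \<Rightarrow> real) \<Rightarrow> ('a \<Rightarrow> 'a) \<Rightarrow> bool" where
  "sobolev_pair p f v \<longleftrightarrow> f \<in> borel_measurable borel \<and> v \<in> borel_measurable borel \<and>
    pint p f < top \<and> pint p v < top \<and> weak_gradient f v"

lemma sobolev_pairD:
  assumes "sobolev_pair p f v"
  shows "f \<in> borel_measurable borel" "v \<in> borel_measurable borel" "pint p f < top" "pint p v < top" "weak_gradient f v"
  using assms by (auto simp: sobolev_pair_def)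

lemma tendsto_half_power_ennreal: "(\<lambda>n. ennreal ((1/2) ^ n)) \<longlonglongrightarrow> 0"
proof -
  have "(\<lambda>n. (1/2::real) ^ n) \<longlonglongrightarrow> 0" by (rule LIMSEQ_power_zero) auto
  then show ?thesis using tendsto_ennrealI by fastforce
qed

text \<open>The smooth estimate is applied to the approximations. The translation modulus of
  \<open>V n\<close> is controlled by that of \<open>v\<close> and an error of order
  \<open>(1/2) ^ n\<close>; separating the two costs the factor \<open>2 powr p\<close>, which
  survives in the limit.\<close>

lemma pint_remainder:
  fixes f :: "'a::euclidean_space \<Rightarrow> real"
  assumes p: "1 \<le> p" and fv: "sobolev_pair p f v"
    and e: "\<And>k. norm k \<le> norm h \<Longrightarrow> pint p (\<lambda>x. v (x + k) - v x) \<le> e"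
  shows "pint p (\<lambda>x. f (x + h) - f x - v x \<bullet> h) \<le> epow (ennreal (norm h)) p * (ennreal (2 powr p) * e)"
proof -
  note D = sobolev_pairD[OF fv]
  note [measurable] = D(1,2)
  obtain F V where FV: "\<And>n::nat. has_gradient (F n) (V n)"
    "\<And>n. pint p (\<lambda>x. F n x - f x) \<le> ennreal ((1/2) ^ n)" "\<And>n. pint p (\<lambda>x. V n x - v x) \<le> ennreal ((1/2) ^ n)"
    "AE x in lborel. (\<lambda>n. F n x) \<longlonglongrightarrow> f x" "AE x in lborel. (\<lambda>n. V n x) \<longlonglongrightarrow> v x"
    using sobolev_approximation[OF p D] by blast
  have [measurable]: "F n \<in> borel_measurable borel" "V n \<in> borel_measurable borel" for n
    using has_gradient_measurable[OF FV(1)] by auto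
  let ?c = "ennreal (2 powr p)"
  let ?b = "\<lambda>n. epow (ennreal (norm h)) p * (?c * (?c * (ennreal ((1/2) ^ n) + ennreal ((1/2) ^ n)) + e))"
  have "(\<integral>\<^sup>+x. epow (ennreal (norm (f (x + h) - f x - v x \<bullet> h))) p \<partial>lborel) \<le> epow (ennreal (norm h)) p * (?c * (?c * (0 + 0) + e))"
  proof (rule nn_integral_Fatou_epow[where G="\<lambda>n x. F n (x + h) - F n x - V n x \<bullet> h" and b="?b"])
    have "AE x in lborel. (\<lambda>n. F n (h + x)) \<longlonglongrightarrow> f (h + x)" by (rule AE_lborel_shift[OF FV(4)])
    with FV(4,5) show "AE x in lborel. (\<lambda>n. F n (x + h) - F n x - V n x \<bullet> h) \<longlonglongrightarrow> f (x + h) - f x - v x \<bullet> h"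
      by eventually_elim (auto simp: add.commute intro!: tendsto_intros)
    show "(\<integral>\<^sup>+x. epow (ennreal (norm (F n (x + h) - F n x - V n x \<bullet> h))) p \<partial>lborel) \<le> ?b n" for n
      unfolding pint_def[symmetric]
    proof (rule pint_remainder_smooth[OF p FV(1)])
      fix k :: 'a assume k: "norm k \<le> norm h"
      let ?D = "\<lambda>x. V n x - v x"
      have "pint p (\<lambda>x. V n (x + k) - V n x) = pint p (\<lambda>x. (?D (x + k) - ?D x) + (v (x + k) - v x))"
        by (simp add: algebra_simps)
      also have "\<dots> \<le> ?c * (pint p (\<lambda>x. ?D (x + k) - ?D x) + pint p (\<lambda>x. v (x + k) - v x))"
        using p by (intro pint_add) auto
      also have "\<dots> \<le> ?c * (?c * (pint p (\<lambda>x. ?D (x + k)) + pint p ?D) + pint p (\<lambda>x. v (x + k) - v x))"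
        using p by (intro mult_left_mono add_right_mono pint_diff) auto
      also have "pint p (\<lambda>x. ?D (x + k)) = pint p ?D" by (rule pint_shift) measurable
      also have "?c * (?c * (pint p ?D + pint p ?D) + pint p (\<lambda>x. v (x + k) - v x)) \<le> ?c * (?c * (ennreal ((1/2) ^ n) + ennreal ((1/2) ^ n)) + e)"
        using FV(3)[of n] e[OF k] by (intro mult_left_mono add_mono) auto
      finally show "pint p (\<lambda>x. V n (x + k) - V n x) \<le> \<dots>" .
    qed
    show "(\<lambda>n. ?b n) \<longlonglongrightarrow> epow (ennreal (norm h)) p * (?c * (?c * (0 + 0) + e))"
      using p by (intro ennreal_tendsto_cmult tendsto_add tendsto_half_power_ennreal tendsto_const) (auto simp: epow_ennreal)
  qed (use p in auto)
  then show ?thesis by (simp add: pint_def)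
qed

section \<open>Local estimates\<close>

text \<open>A multiple of a single bump serves as the cutoff, because on the unit ball only a lower
  bound is asked for.\<close>

lemma ex_cutoff:
  obtains \<psi> :: "'a::euclidean_space \<Rightarrow> real" and g K
  where "has_gradient \<psi> g" "\<And>x. x \<in> ball 0 1 \<Longrightarrow> 1 \<le> \<psi> x" "\<And>x. \<bar>\<psi> x\<bar> \<le> K" "\<And>x. norm (g x) \<le> K" "0 < K"
    "\<And>x. x \<notin> ball 0 2 \<Longrightarrow> \<psi> x = 0" "\<And>x. x \<notin> ball 0 2 \<Longrightarrow> g x = 0"
proof -
  have d: "0 < (3/2 :: real)" by simp
  let ?m = "\<lambda>y :: 'a. mollifier (3/2) (0 - y)"
  \<comment> \<open>The first factor undoes the normalisation of the mollifier. For
    \<open>|y| < 1\<close> and radius \<open>3/2\<close> the exponent in the bump is at least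
    \<open>- 9/5\<close>, which the second factor compensates. The radius lies strictly between
    those of the two balls.\<close>
  let ?c = "bump_mass TYPE('a) (3/2) * exp (9/5)"
  have c: "0 < ?c" using bump_mass_pos[OF d, where 'a='a] by simp
  have m: "has_gradient ?m (grad ?m)" by (rule mollifier_gradient(1)[OF d])
  define \<psi> where "\<psi> y = ?c * ?m y" for y
  define g where "g y = ?c *\<^sub>R grad ?m y" for y
  have \<psi>: "has_gradient \<psi> g"
    using m unfolding has_gradient_def \<psi>_def g_def
    by (auto intro!: continuous_intros derivative_eq_intros simp: inner_scaleR_left)
  have z: "\<psi> y = 0" if "y \<notin> cball 0 (3/2)" for y
    using that mollifier_eq_0[OF d, of "0 - y"] by (auto simp: \<psi>_def)
  have gz: "g y = 0" if "y \<notin> cball 0 (3/2)" for y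
    by (rule has_gradient_zero_outside[OF \<psi> z that])
  obtain K1 where K1: "\<And>x. norm (\<psi> x) \<le> K1" "0 < K1"
    using continuous_bounded_of_support[OF has_gradient_continuous[OF \<psi>] z] by metis
  have gc: "continuous_on UNIV g" using \<psi> by (simp add: has_gradient_def)
  obtain K2 where K2: "\<And>x. norm (g x) \<le> K2" "0 < K2"
    using continuous_bounded_of_support[OF gc gz] by metis
  have ge: "1 \<le> \<psi> y" if y: "y \<in> ball 0 1" for y
  proof -
    have yy: "y \<bullet> y < 1" using y power_mono[of "norm y" 1 2] by (simp add: power2_norm_eq_inner[symmetric] abs_square_less_1)
    define t where "t = 1 - (4/9) * (y \<bullet> y)"
    have t: "5/9 < t" using yy by (simp add: t_def)
    have "- (9/5) \<le> - 1 / t" using t by (simp add: field_simps)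
    then have "exp (- (9/5)) \<le> bump (3/2) y"
      using t by (simp add: bump_def flat_exp_def t_def power2_eq_square)
    then have "exp (9/5) * exp (- (9/5)) \<le> exp (9/5) * bump (3/2) y" by (intro mult_left_mono) auto
    moreover have "\<psi> y = exp (9/5) * bump (3/2) y"
      using bump_mass_pos[OF d, where 'a='a] by (simp add: \<psi>_def mollifier_def)
    ultimately show ?thesis by (simp add: exp_minus)
  qed
  show ?thesis
    by (rule that[OF \<psi> ge, of "max K1 K2"]) (use K1 K2 in \<open>auto simp: le_max_iff_disj intro!: z gz\<close>)
qed

lemma has_gradient_cutoff:
  fixes u :: "'a::euclidean_space \<Rightarrow> real"
  assumes u: "has_gradient u g" and \<psi>: "has_gradient \<psi> \<gamma>"
  shows "has_gradient (\<lambda>h. \<psi> (s *\<^sub>R h) * (u (x + h) - c - a \<bullet> h))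
     (\<lambda>h. \<psi> (s *\<^sub>R h) *\<^sub>R (g (x + h) - a) + ((u (x + h) - c - a \<bullet> h) * s) *\<^sub>R \<gamma> (s *\<^sub>R h))"
proof -
  have c: "continuous_on UNIV u" "continuous_on UNIV g" "continuous_on UNIV \<psi>" "continuous_on UNIV \<gamma>"
    using has_gradient_continuous[OF u] has_gradient_continuous[OF \<psi>] u \<psi> by (auto simp: has_gradient_def)
  have D: "((\<lambda>h. u (x + h)) has_derivative (\<lambda>k. g (x + h) \<bullet> k)) (at h)" for h
  proof -
    have "(u \<circ> (\<lambda>h. x + h) has_derivative (\<lambda>k. g (x + h) \<bullet> k) \<circ> (\<lambda>k. k)) (at h)"
      using u by (intro diff_chain_at) (auto simp: has_gradient_def intro!: derivative_eq_intros)
    then show ?thesis by (simp add: o_def)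
  qed
  have E: "((\<lambda>h. \<psi> (s *\<^sub>R h)) has_derivative (\<lambda>k. \<gamma> (s *\<^sub>R h) \<bullet> (s *\<^sub>R k))) (at h)" for h
  proof -
    have "(\<psi> \<circ> (\<lambda>h. s *\<^sub>R h) has_derivative (\<lambda>k. \<gamma> (s *\<^sub>R h) \<bullet> k) \<circ> (\<lambda>k. s *\<^sub>R k)) (at h)"
      using \<psi> by (intro diff_chain_at) (auto simp: has_gradient_def intro!: derivative_eq_intros)
    then show ?thesis by (simp add: o_def)
  qed
  have "((\<lambda>h. \<psi> (s *\<^sub>R h) * (u (x + h) - c - a \<bullet> h)) has_derivative
     (\<lambda>k. (\<psi> (s *\<^sub>R h) *\<^sub>R (g (x + h) - a) + ((u (x + h) - c - a \<bullet> h) * s) *\<^sub>R \<gamma> (s *\<^sub>R h)) \<bullet> k)) (at h)" for h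
  proof -
    have "((\<lambda>h. \<psi> (s *\<^sub>R h) * (u (x + h) - c - a \<bullet> h)) has_derivative
        (\<lambda>k. \<psi> (s *\<^sub>R h) * (g (x + h) \<bullet> k - 0 - a \<bullet> k) + (\<gamma> (s *\<^sub>R h) \<bullet> (s *\<^sub>R k)) * (u (x + h) - c - a \<bullet> h))) (at h)"
      by (intro has_derivative_mult has_derivative_diff has_derivative_const has_derivative_inner_right has_derivative_ident D E)
    then show ?thesis by (rule has_derivative_eq_rhs) (simp add: fun_eq_iff inner_add_left inner_diff_left mult_ac)
  qed
  moreover have "continuous_on UNIV (\<lambda>h. \<psi> (s *\<^sub>R h) *\<^sub>R (g (x + h) - a) + ((u (x + h) - c - a \<bullet> h) * s) *\<^sub>R \<gamma> (s *\<^sub>R h))"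
    by (intro continuous_intros continuous_on_compose2[OF c(1)] continuous_on_compose2[OF c(2)]
        continuous_on_compose2[OF c(3)] continuous_on_compose2[OF c(4)]) auto
  ultimately show ?thesis unfolding has_gradient_def by blast
qed

text \<open>By the product rule the gradient of the cut-off remainder consists of
  \<open>g - a\<close> and of the remainder times a term of order \<open>1 / r\<close>. The free
  \<open>a\<close> and \<open>c\<close> keep the estimate independent of pointwise values of
  \<open>u\<close> and \<open>g\<close>, so that it can pass to a limit at every
  \<open>x\<close>.\<close>

lemma local_sobolev_smooth:
  fixes p q :: real
  assumes pq: "1 \<le> p" "1 \<le> q" "p \<le> DIM('a::euclidean_space)"
    and "p < DIM('a) \<Longrightarrow> q = real DIM('a) / (real DIM('a) - p)"
  shows "\<exists>C\<ge>0. \<forall>u g. has_gradient (u :: 'a \<Rightarrow> real) g \<longrightarrow> (\<forall>r>0. \<forall>x a c.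
    epow (ennreal (1 / r ^ DIM('a)) * (\<integral>\<^sup>+h\<in>ball 0 r. epow (ennreal \<bar>u (x + h) - c - a \<bullet> h\<bar>) (p * q) \<partial>lborel)) (1 / q)
      \<le> ennreal (C * (r powr p / r ^ DIM('a))) * (\<integral>\<^sup>+h\<in>ball 0 (2 * r). epow (ennreal (norm (g (x + h) - a))) p \<partial>lborel)
      + ennreal (C / r ^ DIM('a)) * (\<integral>\<^sup>+h\<in>ball 0 (2 * r). epow (ennreal \<bar>u (x + h) - c - a \<bullet> h\<bar>) p \<partial>lborel))"
proof -
  let ?N = "DIM('a)"
  obtain C where C: "0 \<le> C" and sob: "\<And>r u g. 0 < r \<Longrightarrow> has_gradient (u :: 'a \<Rightarrow> real) g \<Longrightarrow> (\<And>x. x \<notin> ball 0 r \<Longrightarrow> u x = 0 \<and> g x = 0) \<Longrightarrow>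
    epow (ennreal (1 / r ^ ?N) * (\<integral>\<^sup>+x. epow (ennreal \<bar>u x\<bar>) (p * q) \<partial>lborel)) (1 / q)
      \<le> ennreal (C * (r powr p / r ^ ?N)) * (\<integral>\<^sup>+x. epow (ennreal (norm (g x))) p \<partial>lborel)"
    using sobolev_ball[OF assms] by blast
  obtain \<psi> :: "'a \<Rightarrow> real" and \<gamma> K where cut: "has_gradient \<psi> \<gamma>" "\<And>x. x \<in> ball 0 1 \<Longrightarrow> 1 \<le> \<psi> x" "\<And>x. \<bar>\<psi> x\<bar> \<le> K" "\<And>x. norm (\<gamma> x) \<le> K" "0 < K"
    "\<And>x. x \<notin> ball 0 2 \<Longrightarrow> \<psi> x = 0" "\<And>x. x \<notin> ball 0 2 \<Longrightarrow> \<gamma> x = 0"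
    using ex_cutoff by metis
  \<comment> \<open>\<open>M\<close> is the cost of separating the two terms of the product rule,
    \<open>K\<close> bounding both the cutoff and its gradient. In \<open>C'\<close> the first
    factor turns the normalisation by \<open>r ^ N\<close> into that by \<open>(2 * r) ^ N\<close>,
    and \<open>2 powr p / 2 ^ N\<close> comes from the Sobolev inequality on the ball of radius
    \<open>2 * r\<close>.\<close>
  define M where "M = 2 powr p * K powr p"
  define C' where "C' = (2 ^ ?N) powr (1/q) * (C * (2 powr p / 2 ^ ?N) * M)"
  have C': "0 \<le> C'" "0 \<le> M" using C by (auto simp: C'_def M_def)
  show ?thesis
  proof (intro exI[of _ C'] conjI allI impI C')
    fix u :: "'a \<Rightarrow> real" and g and r :: real and x a :: 'a and c
    assume u: "has_gradient u g" and r: "0 < r"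
    note [measurable] = has_gradient_measurable[OF u]
    let ?w = "\<lambda>h. u (x + h) - c - a \<bullet> h"
    define U where "U h = \<psi> ((1/r) *\<^sub>R h) * ?w h" for h
    define G where "G h = \<psi> ((1/r) *\<^sub>R h) *\<^sub>R (g (x + h) - a) + (?w h * (1/r)) *\<^sub>R \<gamma> ((1/r) *\<^sub>R h)" for h
    have UG: "has_gradient U G" unfolding U_def G_def by (rule has_gradient_cutoff[OF u cut(1)])
    have supp: "U h = 0 \<and> G h = 0" if "h \<notin> ball 0 (2 * r)" for h
      using that r cut(6,7)[of "(1/r) *\<^sub>R h"] by (auto simp: U_def G_def field_simps)
    define A where "A = (\<integral>\<^sup>+h\<in>ball 0 (2 * r). epow (ennreal (norm (g (x + h) - a))) p \<partial>lborel)"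
    define B where "B = (\<integral>\<^sup>+h\<in>ball 0 (2 * r). epow (ennreal \<bar>?w h\<bar>) p \<partial>lborel)"
    define L where "L = (\<integral>\<^sup>+h\<in>ball 0 r. epow (ennreal \<bar>?w h\<bar>) (p * q) \<partial>lborel)"
    have G_le: "(\<integral>\<^sup>+h. epow (ennreal (norm (G h))) p \<partial>lborel) \<le> ennreal M * (A + ennreal (1 / r powr p) * B)"
    proof -
      have "epow (ennreal (norm (G h))) p \<le> ennreal M * (epow (ennreal (norm (g (x + h) - a))) p * indicator (ball 0 (2 * r)) h
          + ennreal (1 / r powr p) * (epow (ennreal \<bar>?w h\<bar>) p * indicator (ball 0 (2 * r)) h))" for h
      proof (cases "h \<in> ball 0 (2 * r)")
        case False
        then show ?thesis using supp[of h] pq by simp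
      next
        case True
        have 1: "norm (\<psi> ((1/r) *\<^sub>R h) *\<^sub>R (g (x + h) - a)) \<le> K * norm (g (x + h) - a)"
          using cut(3) by (auto intro!: mult_right_mono)
        have 2: "norm ((?w h * (1/r)) *\<^sub>R \<gamma> ((1/r) *\<^sub>R h)) \<le> K * (1/r) * \<bar>?w h\<bar>"
          using r mult_left_mono[OF cut(4)[of "(1/r) *\<^sub>R h"], of "\<bar>?w h\<bar> * (1/r)"] by (simp add: abs_mult mult_ac)
        have "epow (ennreal (norm (G h))) p \<le> ennreal (2 powr p) * (epow (ennreal (norm (\<psi> ((1/r) *\<^sub>R h) *\<^sub>R (g (x + h) - a)))) p
            + epow (ennreal (norm ((?w h * (1/r)) *\<^sub>R \<gamma> ((1/r) *\<^sub>R h)))) p)"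
          unfolding G_def using pq by (intro epow_norm_add) auto
        also have "\<dots> \<le> ennreal (2 powr p) * (epow (ennreal (K * norm (g (x + h) - a))) p + epow (ennreal (K * (1/r) * \<bar>?w h\<bar>)) p)"
          using pq by (intro mult_left_mono add_mono epow_mono ennreal_leI 1 2) auto
        also have "epow (ennreal (K * norm (g (x + h) - a))) p = ennreal (K powr p) * epow (ennreal (norm (g (x + h) - a))) p"
          using pq cut(5) by (subst ennreal_mult) (auto simp: epow_mult epow_ennreal)
        also have "epow (ennreal (K * (1/r) * \<bar>?w h\<bar>)) p = ennreal (K powr p) * (ennreal (1 / r powr p) * epow (ennreal \<bar>?w h\<bar>) p)"
          using pq cut(5) r by (simp add: ennreal_mult epow_mult epow_ennreal powr_divide powr_mult ennreal_mult'[symmetric] mult.assoc[symmetric])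
        finally show ?thesis using True
          by (simp add: M_def ennreal_mult distrib_left[symmetric] mult.assoc)
      qed
      then have "(\<integral>\<^sup>+h. epow (ennreal (norm (G h))) p \<partial>lborel) \<le> (\<integral>\<^sup>+h. ennreal M * (epow (ennreal (norm (g (x + h) - a))) p * indicator (ball 0 (2 * r)) h
          + ennreal (1 / r powr p) * (epow (ennreal \<bar>?w h\<bar>) p * indicator (ball 0 (2 * r)) h)) \<partial>lborel)"
        by (intro nn_integral_mono)
      also have "\<dots> = ennreal M * (A + ennreal (1 / r powr p) * B)"
        unfolding A_def B_def by (simp add: nn_integral_cmult nn_integral_add)
      finally show ?thesis .
    qed
    have "L \<le> (\<integral>\<^sup>+h. epow (ennreal \<bar>U h\<bar>) (p * q) \<partial>lborel)"
      unfolding L_def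
    proof (rule nn_integral_mono)
      fix h show "epow (ennreal \<bar>?w h\<bar>) (p * q) * indicator (ball 0 r) h \<le> epow (ennreal \<bar>U h\<bar>) (p * q)"
      proof (cases "h \<in> ball 0 r")
        case True
        then have "1 \<le> \<psi> ((1/r) *\<^sub>R h)" using r by (intro cut) (auto simp: field_simps)
        then have "\<bar>?w h\<bar> \<le> \<bar>U h\<bar>" unfolding U_def abs_mult
          using mult_right_mono[of 1 "\<bar>\<psi> ((1/r) *\<^sub>R h)\<bar>" "\<bar>?w h\<bar>"] by simp
        then show ?thesis using True pq by (auto intro!: epow_mono ennreal_leI)
      qed simp
    qed
    then have "epow (ennreal (1 / r ^ ?N) * L) (1/q) \<le> epow (ennreal (2 ^ ?N) * (ennreal (1 / (2 * r) ^ ?N) * (\<integral>\<^sup>+h. epow (ennreal \<bar>U h\<bar>) (p * q) \<partial>lborel))) (1/q)"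
      using r pq by (intro epow_mono) (auto simp: mult.assoc[symmetric] ennreal_mult'[symmetric] power_mult_distrib intro!: mult_left_mono)
    also have "\<dots> = ennreal ((2 ^ ?N) powr (1/q)) * epow (ennreal (1 / (2 * r) ^ ?N) * (\<integral>\<^sup>+h. epow (ennreal \<bar>U h\<bar>) (p * q) \<partial>lborel)) (1/q)"
      using pq by (subst epow_mult) (auto simp: epow_ennreal_pos simp del: ennreal_power)
    also have "\<dots> \<le> ennreal ((2 ^ ?N) powr (1/q)) * (ennreal (C * ((2 * r) powr p / (2 * r) ^ ?N)) * (\<integral>\<^sup>+h. epow (ennreal (norm (G h))) p \<partial>lborel))"
      using r supp by (intro mult_left_mono sob UG) auto
    also have "\<dots> \<le> ennreal ((2 ^ ?N) powr (1/q)) * (ennreal (C * ((2 * r) powr p / (2 * r) ^ ?N)) * (ennreal M * (A + ennreal (1 / r powr p) * B)))"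
      by (intro mult_left_mono G_le) auto
    also have "\<dots> = ennreal (C' * (r powr p / r ^ ?N)) * (A + ennreal (1 / r powr p) * B)"
    proof -
      have "(2 ^ ?N) powr (1/q) * (C * ((2 * r) powr p / (2 * r) ^ ?N) * M) = C' * (r powr p / r ^ ?N)"
        using r by (simp add: C'_def powr_mult power_mult_distrib)
      then show ?thesis using C C' r by (simp only: mult.assoc[symmetric] ennreal_mult'[symmetric] ennreal_mult''[symmetric] powr_ge_zero)
    qed
    also have "\<dots> = ennreal (C' * (r powr p / r ^ ?N)) * A + ennreal (C' / r ^ ?N) * B"
    proof -
      have "C' * (r powr p / r ^ ?N) * (1 / r powr p) = C' / r ^ ?N" using r by simp
      then have "ennreal (C' * (r powr p / r ^ ?N)) * ennreal (1 / r powr p) = ennreal (C' / r ^ ?N)"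
        using r C' by (subst ennreal_mult'[symmetric]) auto
      then show ?thesis by (simp only: distrib_left mult.assoc[symmetric])
    qed
    finally show "epow (ennreal (1 / r ^ ?N) * L) (1/q) \<le> ennreal (C' * (r powr p / r ^ ?N)) * A + ennreal (C' / r ^ ?N) * B" .
  qed
qed

text \<open>The left-hand side passes to the limit by Fatou's lemma in \<open>h\<close> for fixed
  \<open>x\<close>. On the right the approximation errors over the ball are bounded by those over
  the whole space, which do not depend on \<open>x\<close>.\<close>

lemma local_sobolev:
  fixes p q :: real
  assumes pq: "1 \<le> p" "1 \<le> q" "p \<le> DIM('a::euclidean_space)"
    and "p < DIM('a) \<Longrightarrow> q = real DIM('a) / (real DIM('a) - p)"
  shows "\<exists>C\<ge>0. \<forall>f v. sobolev_pair p (f :: 'a \<Rightarrow> real) v \<longrightarrow> (\<forall>r>0. \<forall>x a c.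
    epow (ennreal (1 / r ^ DIM('a)) * (\<integral>\<^sup>+h\<in>ball 0 r. epow (ennreal \<bar>f (x + h) - c - a \<bullet> h\<bar>) (p * q) \<partial>lborel)) (1 / q)
      \<le> ennreal (C * (r powr p / r ^ DIM('a))) * (\<integral>\<^sup>+h\<in>ball 0 (2 * r). epow (ennreal (norm (v (x + h) - a))) p \<partial>lborel)
      + ennreal (C / r ^ DIM('a)) * (\<integral>\<^sup>+h\<in>ball 0 (2 * r). epow (ennreal \<bar>f (x + h) - c - a \<bullet> h\<bar>) p \<partial>lborel))"
proof -
  let ?N = "DIM('a)"
  obtain C where C: "0 \<le> C" and sob: "\<And>u g r x a c. has_gradient (u :: 'a \<Rightarrow> real) g \<Longrightarrow> 0 < r \<Longrightarrow>
    epow (ennreal (1 / r ^ ?N) * (\<integral>\<^sup>+h\<in>ball 0 r. epow (ennreal \<bar>u (x + h) - c - a \<bullet> h\<bar>) (p * q) \<partial>lborel)) (1 / q)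
      \<le> ennreal (C * (r powr p / r ^ ?N)) * (\<integral>\<^sup>+h\<in>ball 0 (2 * r). epow (ennreal (norm (g (x + h) - a))) p \<partial>lborel)
      + ennreal (C / r ^ ?N) * (\<integral>\<^sup>+h\<in>ball 0 (2 * r). epow (ennreal \<bar>u (x + h) - c - a \<bullet> h\<bar>) p \<partial>lborel)"
    using local_sobolev_smooth[OF assms] by blast
  show ?thesis
  proof (intro exI[of _ "C * 2 powr p"] conjI allI impI)
    fix f :: "'a \<Rightarrow> real" and v and r :: real and x a :: 'a and c
    assume fv: "sobolev_pair p f v" and r: "0 < r"
    note D = sobolev_pairD[OF fv]
    note [measurable] = D(1,2)
    obtain F V where FV: "\<And>n::nat. has_gradient (F n) (V n)"
      "\<And>n. pint p (\<lambda>x. F n x - f x) \<le> ennreal ((1/2) ^ n)" "\<And>n. pint p (\<lambda>x. V n x - v x) \<le> ennreal ((1/2) ^ n)"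
      "AE x in lborel. (\<lambda>n. F n x) \<longlonglongrightarrow> f x" "AE x in lborel. (\<lambda>n. V n x) \<longlonglongrightarrow> v x"
      using sobolev_approximation[OF pq(1) D] by blast
    have [measurable]: "F n \<in> borel_measurable borel" "V n \<in> borel_measurable borel" for n
      using has_gradient_measurable[OF FV(1)] by auto
    let ?I = "\<lambda>H :: 'a \<Rightarrow> ennreal. \<integral>\<^sup>+h\<in>ball 0 (2 * r). H h \<partial>lborel"
    let ?c = "ennreal (2 powr p)"
    define A where "A = ?I (\<lambda>h. epow (ennreal (norm (v (x + h) - a))) p)"
    define B where "B = ?I (\<lambda>h. epow (ennreal \<bar>f (x + h) - c - a \<bullet> h\<bar>) p)"
    define \<alpha> where "\<alpha> = ennreal (C * (r powr p / r ^ ?N))"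
    define \<beta> where "\<beta> = ennreal (C / r ^ ?N)"
    define R where "R n = \<alpha> * (?c * (ennreal ((1/2) ^ n) + A)) + \<beta> * (?c * (ennreal ((1/2) ^ n) + B))" for n :: nat
    have split: "?I (\<lambda>h. epow (ennreal (norm (P h))) p) \<le> ?c * (e + ?I (\<lambda>h. epow (ennreal (norm (Q h))) p))"
      if [measurable]: "P \<in> borel_measurable borel" "Q \<in> borel_measurable borel" and e: "pint p (\<lambda>h. P h - Q h) \<le> e"
      for P Q :: "'a \<Rightarrow> 'c::euclidean_space" and e
    proof -
      have "?I (\<lambda>h. epow (ennreal (norm (P h))) p) \<le>
        (\<integral>\<^sup>+h. ?c * (epow (ennreal (norm (P h - Q h))) p + epow (ennreal (norm (Q h))) p * indicator (ball 0 (2 * r)) h) \<partial>lborel)"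
      proof (rule nn_integral_mono)
        fix h show "epow (ennreal (norm (P h))) p * indicator (ball 0 (2 * r)) h \<le> ?c * (epow (ennreal (norm (P h - Q h))) p + epow (ennreal (norm (Q h))) p * indicator (ball 0 (2 * r)) h)"
          using epow_norm_add[of p "P h - Q h" "Q h"] pq(1) by (auto simp: indicator_def)
      qed
      also have "\<dots> = ?c * (pint p (\<lambda>h. P h - Q h) + ?I (\<lambda>h. epow (ennreal (norm (Q h))) p))"
        unfolding pint_def by (simp add: nn_integral_cmult nn_integral_add)
      also have "\<dots> \<le> ?c * (e + ?I (\<lambda>h. epow (ennreal (norm (Q h))) p))"
        by (intro mult_left_mono add_right_mono e) auto
      finally show ?thesis .
    qed
    have An: "?I (\<lambda>h. epow (ennreal (norm (V n (x + h) - a))) p) \<le> ?c * (ennreal ((1/2) ^ n) + A)" for n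
      unfolding A_def
    proof (rule split)
      have "pint p (\<lambda>h. V n (x + h) - a - (v (x + h) - a)) = pint p (\<lambda>h. (\<lambda>y. V n y - v y) (h + x))"
        by (simp add: add.commute)
      also have "\<dots> = pint p (\<lambda>y. V n y - v y)" by (rule pint_shift) measurable
      finally show "pint p (\<lambda>h. V n (x + h) - a - (v (x + h) - a)) \<le> ennreal ((1/2) ^ n)" using FV(3)[of n] by simp
    qed measurable
    have Bn: "?I (\<lambda>h. epow (ennreal \<bar>F n (x + h) - c - a \<bullet> h\<bar>) p) \<le> ?c * (ennreal ((1/2) ^ n) + B)" for n
      unfolding B_def real_norm_def[symmetric]
    proof (rule split)
      have "pint p (\<lambda>h. F n (x + h) - c - a \<bullet> h - (f (x + h) - c - a \<bullet> h)) = pint p (\<lambda>h. (\<lambda>y. F n y - f y) (h + x))"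
        by (simp add: add.commute)
      also have "\<dots> = pint p (\<lambda>y. F n y - f y)" by (rule pint_shift) measurable
      finally show "pint p (\<lambda>h. F n (x + h) - c - a \<bullet> h - (f (x + h) - c - a \<bullet> h)) \<le> ennreal ((1/2) ^ n)" using FV(2)[of n] by simp
    qed measurable
    \<comment> \<open>Fatou's lemma concerns the bare integral, so the normalising factor and the
      root are moved to the right-hand side before the limit is taken.\<close>
    have rr: "ennreal (r ^ ?N) * (ennreal (1 / r ^ ?N) * X) = X" for X
      using r by (simp add: mult.assoc[symmetric] ennreal_mult'[symmetric])
    define L where "L u = (\<integral>\<^sup>+h\<in>ball 0 r. epow (ennreal \<bar>u (x + h) - c - a \<bullet> h\<bar>) (p * q) \<partial>lborel)" for u
    \<comment> \<open>With the indicator inside the norm, the integral over the ball has the form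
      required for Fatou's lemma.\<close>
    have L_eq: "L u = (\<integral>\<^sup>+h. epow (ennreal (norm ((u (x + h) - c - a \<bullet> h) * indicator (ball 0 r) h))) (p * q) \<partial>lborel)" for u
      unfolding L_def using pq by (intro nn_integral_cong) (auto simp: indicator_def)
    have Ln: "L (F n) \<le> ennreal (r ^ ?N) * epow (R n) q" for n
    proof -
      have "epow (ennreal (1 / r ^ ?N) * L (F n)) (1 / q) \<le> R n"
        unfolding R_def L_def \<alpha>_def \<beta>_def
        by (rule order_trans[OF sob[OF FV(1) r]]) (intro add_mono mult_left_mono An Bn; simp)
      then have "ennreal (1 / r ^ ?N) * L (F n) \<le> epow (R n) q" using pq by (simp add: epow_le_iff)
      from mult_left_mono[OF this, of "ennreal (r ^ ?N)"] show ?thesis by (simp only: rr zero_le)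
    qed
    have "L f \<le> ennreal (r ^ ?N) * epow (\<alpha> * (?c * (0 + A)) + \<beta> * (?c * (0 + B))) q"
      unfolding L_eq
    proof (rule nn_integral_Fatou_epow[where G="\<lambda>n h. (F n (x + h) - c - a \<bullet> h) * indicator (ball 0 r) h"])
      show "AE h in lborel. (\<lambda>n. (F n (x + h) - c - a \<bullet> h) * indicator (ball 0 r) h) \<longlonglongrightarrow> (f (x + h) - c - a \<bullet> h) * indicator (ball 0 r) h"
        using AE_lborel_shift[OF FV(4), of x] by eventually_elim (auto intro!: tendsto_intros)
      show "(\<integral>\<^sup>+h. epow (ennreal (norm ((F n (x + h) - c - a \<bullet> h) * indicator (ball 0 r) h))) (p * q) \<partial>lborel) \<le> ennreal (r ^ ?N) * epow (R n) q" for n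
        using Ln[of n] unfolding L_eq .
      show "(\<lambda>n. ennreal (r ^ ?N) * epow (R n) q) \<longlonglongrightarrow> ennreal (r ^ ?N) * epow (\<alpha> * (?c * (0 + A)) + \<beta> * (?c * (0 + B))) q"
        unfolding R_def using pq
        by (intro ennreal_tendsto_cmult tendsto_epow tendsto_add tendsto_half_power_ennreal tendsto_const) (auto simp: \<alpha>_def \<beta>_def)
    qed (use pq in auto)
    from mult_left_mono[OF this, of "ennreal (1 / r ^ ?N)"]
    have "ennreal (1 / r ^ ?N) * L f \<le> epow (\<alpha> * (?c * A) + \<beta> * (?c * B)) q"
      using r by (simp add: mult.assoc[symmetric] ennreal_mult'[symmetric])
    then have "epow (ennreal (1 / r ^ ?N) * L f) (1/q) \<le> \<alpha> * (?c * A) + \<beta> * (?c * B)"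
      using pq by (subst epow_le_iff) auto
    also have "\<dots> = ennreal (C * 2 powr p * (r powr p / r ^ ?N)) * A + ennreal (C * 2 powr p / r ^ ?N) * B"
    proof -
      have "\<alpha> * ?c = ennreal (C * 2 powr p * (r powr p / r ^ ?N))"
        using C r by (simp add: \<alpha>_def ennreal_mult'[symmetric] mult_ac)
      moreover have "\<beta> * ?c = ennreal (C * 2 powr p / r ^ ?N)"
        using C r by (simp add: \<beta>_def ennreal_mult'[symmetric] mult_ac)
      ultimately show ?thesis by (simp only: mult.assoc[symmetric])
    qed
    finally show "epow (ennreal (1 / r ^ ?N) * L f) (1/q) \<le> ennreal (C * 2 powr p * (r powr p / r ^ ?N)) * A + ennreal (C * 2 powr p / r ^ ?N) * B" .
  qed (use C in auto)
qed

section \<open>The remainder for finite exponents\<close>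

lemma emeasure_lborel_ball:
  "0 \<le> r \<Longrightarrow> emeasure lborel (ball (c :: 'a::euclidean_space) r) = ennreal (unit_ball_vol (real DIM('a)) * r ^ DIM('a))"
  by (simp add: emeasure_ball)

lemma nn_integral_ball_weight:
  assumes "0 < r"
  shows "(\<integral>\<^sup>+z\<in>ball (x :: 'a::euclidean_space) r. ennreal (1 / (unit_ball_vol (real DIM('a)) * r ^ DIM('a))) \<partial>lborel) = 1"
proof -
  define V where "V = unit_ball_vol (real DIM('a))"
  have "0 < V" by (simp add: V_def)
  then show ?thesis using assms
    by (subst nn_integral_cmult_indicator) (auto simp: emeasure_lborel_ball V_def[symmetric] ennreal_mult'[symmetric])
qed

lemma nn_integral_ball_le:
  fixes \<Phi> :: "'a::euclidean_space \<Rightarrow> 'a \<Rightarrow> ennreal"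
  assumes [measurable]: "(\<lambda>(x, h). \<Phi> x h) \<in> borel_measurable (lborel \<Otimes>\<^sub>M lborel)"
    and le: "\<And>h. h \<in> ball 0 r \<Longrightarrow> (\<integral>\<^sup>+x. \<Phi> x h \<partial>lborel) \<le> e"
  shows "(\<integral>\<^sup>+x. (\<integral>\<^sup>+h. \<Phi> x h * indicator (ball 0 r) h \<partial>lborel) \<partial>lborel) \<le> e * emeasure lborel (ball (0::'a) r)"
proof -
  have "(\<integral>\<^sup>+x. (\<integral>\<^sup>+h. \<Phi> x h * indicator (ball 0 r) h \<partial>lborel) \<partial>lborel) = (\<integral>\<^sup>+h. (\<integral>\<^sup>+x. \<Phi> x h * indicator (ball 0 r) h \<partial>lborel) \<partial>lborel)"
    by (rule lborel_pair.Fubini') measurable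
  also have "\<dots> = (\<integral>\<^sup>+h. (\<integral>\<^sup>+x. \<Phi> x h \<partial>lborel) * indicator (ball 0 r) h \<partial>lborel)"
    by (intro nn_integral_cong nn_integral_multc) measurable
  also have "\<dots> \<le> (\<integral>\<^sup>+h\<in>ball (0::'a) r. e \<partial>lborel)"
    using le by (intro nn_integral_mono) (auto simp: indicator_def)
  also have "\<dots> = e * emeasure lborel (ball (0::'a) r)"
    by (intro nn_integral_cmult_indicator) auto
  finally show ?thesis .
qed

text \<open>Here \<open>c = f x\<close> and \<open>a = v x\<close> are inserted. After integration
  in \<open>x\<close> both terms on the right become integrals over the ball of radius
  \<open>2 * r\<close>: one of the translation modulus, the other of the remainder in
  \<open>L^p\<close>, whose factor \<open>|h| powr p\<close> supplies the missing power of
  \<open>r\<close>.\<close>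

lemma scaled_remainder_bound:
  fixes p q :: real
  assumes pq: "1 \<le> p" "1 \<le> q" "p \<le> DIM('a::euclidean_space)"
    and "p < DIM('a) \<Longrightarrow> q = real DIM('a) / (real DIM('a) - p)"
  shows "\<exists>C\<ge>0. \<forall>f v e r. sobolev_pair p (f :: 'a \<Rightarrow> real) v \<longrightarrow> 0 < r \<longrightarrow>
      (\<forall>k. norm k \<le> 2 * r \<longrightarrow> pint p (\<lambda>x. v (x + k) - v x) \<le> e) \<longrightarrow>
    (\<integral>\<^sup>+x. epow (ennreal (1 / r ^ DIM('a)) * (\<integral>\<^sup>+h\<in>ball 0 r. epow (ennreal \<bar>f (x + h) - f x - v x \<bullet> h\<bar>) (p * q) \<partial>lborel)) (1 / q) \<partial>lborel)
      \<le> ennreal (C * r powr p) * e"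
proof -
  let ?N = "DIM('a)"
  obtain C where C: "0 \<le> C" and sob: "\<And>f v r x a c. sobolev_pair p (f :: 'a \<Rightarrow> real) v \<Longrightarrow> 0 < r \<Longrightarrow>
    epow (ennreal (1 / r ^ ?N) * (\<integral>\<^sup>+h\<in>ball 0 r. epow (ennreal \<bar>f (x + h) - c - a \<bullet> h\<bar>) (p * q) \<partial>lborel)) (1 / q)
      \<le> ennreal (C * (r powr p / r ^ ?N)) * (\<integral>\<^sup>+h\<in>ball 0 (2 * r). epow (ennreal (norm (v (x + h) - a))) p \<partial>lborel)
      + ennreal (C / r ^ ?N) * (\<integral>\<^sup>+h\<in>ball 0 (2 * r). epow (ennreal \<bar>f (x + h) - c - a \<bullet> h\<bar>) p \<partial>lborel)"
    using local_sobolev[OF assms] by blast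
  define V where "V = unit_ball_vol (real ?N)"
  have V: "0 < V" by (simp add: V_def)
  \<comment> \<open>\<open>V * 2 ^ ?N\<close> is the volume of the ball of radius 2. The summand 1
    belongs to the gradient term. In the other summand one factor \<open>2 powr p\<close> comes from
    \<open>(2 * r) powr p\<close> and the other from \<open>pint_remainder\<close>.\<close>
  define C' where "C' = C * V * 2 ^ ?N * (1 + 2 powr p * 2 powr p)"
  show ?thesis
  proof (intro exI[of _ C'] conjI allI impI)
    show "0 \<le> C'" using C V by (simp add: C'_def)
    fix f :: "'a \<Rightarrow> real" and v and e :: ennreal and r :: real
    assume fv: "sobolev_pair p f v" and r: "0 < r" and e: "\<forall>k. norm k \<le> 2 * r \<longrightarrow> pint p (\<lambda>x. v (x + k) - v x) \<le> e"
    note [measurable] = sobolev_pairD(1,2)[OF fv]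
    let ?W = "emeasure lborel (ball (0::'a) (2 * r))"
    have W: "?W = ennreal (V * (2 ^ ?N * r ^ ?N))"
      using r by (simp add: emeasure_lborel_ball V_def power_mult_distrib)
    have "(\<integral>\<^sup>+x. epow (ennreal (1 / r ^ ?N) * (\<integral>\<^sup>+h\<in>ball 0 r. epow (ennreal \<bar>f (x + h) - f x - v x \<bullet> h\<bar>) (p * q) \<partial>lborel)) (1 / q) \<partial>lborel)
      \<le> (\<integral>\<^sup>+x. ennreal (C * (r powr p / r ^ ?N)) * (\<integral>\<^sup>+h\<in>ball 0 (2 * r). epow (ennreal (norm (v (x + h) - v x))) p \<partial>lborel)
      + ennreal (C / r ^ ?N) * (\<integral>\<^sup>+h\<in>ball 0 (2 * r). epow (ennreal (norm (f (x + h) - f x - v x \<bullet> h))) p \<partial>lborel) \<partial>lborel)"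
      unfolding real_norm_def by (intro nn_integral_mono sob[OF fv r])
    also have "\<dots> = ennreal (C * (r powr p / r ^ ?N)) * (\<integral>\<^sup>+x. (\<integral>\<^sup>+h\<in>ball 0 (2 * r). epow (ennreal (norm (v (x + h) - v x))) p \<partial>lborel) \<partial>lborel)
      + ennreal (C / r ^ ?N) * (\<integral>\<^sup>+x. (\<integral>\<^sup>+h\<in>ball 0 (2 * r). epow (ennreal (norm (f (x + h) - f x - v x \<bullet> h))) p \<partial>lborel) \<partial>lborel)"
      by (simp add: nn_integral_add nn_integral_cmult)
    also have "\<dots> \<le> ennreal (C * (r powr p / r ^ ?N)) * (e * ?W) + ennreal (C / r ^ ?N) * (ennreal ((2 * r) powr p * 2 powr p) * e * ?W)"
    proof (intro add_mono mult_left_mono nn_integral_ball_le)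
      fix h :: 'a assume h: "h \<in> ball 0 (2 * r)"
      then show "(\<integral>\<^sup>+x. epow (ennreal (norm (v (x + h) - v x))) p \<partial>lborel) \<le> e"
        using e[rule_format, of h] by (simp add: pint_def)
      have "pint p (\<lambda>x. f (x + h) - f x - v x \<bullet> h) \<le> epow (ennreal (norm h)) p * (ennreal (2 powr p) * e)"
        using e h by (intro pint_remainder pq fv) auto
      also have "\<dots> \<le> epow (ennreal (2 * r)) p * (ennreal (2 powr p) * e)"
        using pq h by (intro mult_right_mono epow_mono ennreal_leI) auto
      also have "\<dots> = ennreal ((2 * r) powr p * 2 powr p) * e"
        using pq r by (subst epow_ennreal) (auto simp: ennreal_mult mult.assoc)
      finally show "(\<integral>\<^sup>+x. epow (ennreal (norm (f (x + h) - f x - v x \<bullet> h))) p \<partial>lborel) \<le> ennreal ((2 * r) powr p * 2 powr p) * e"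
        by (simp add: pint_def)
    qed auto
    also have "\<dots> = ennreal (C' * r powr p) * e"
    proof -
      have "ennreal (C * (r powr p / r ^ ?N)) * (e * ?W) = ennreal (C * V * 2 ^ ?N * r powr p) * e"
      proof -
        have "ennreal (C * (r powr p / r ^ ?N)) * ?W = ennreal (C * (r powr p / r ^ ?N) * (V * (2 ^ ?N * r ^ ?N)))"
          unfolding W using C r by (intro ennreal_mult'[symmetric]) auto
        also have "C * (r powr p / r ^ ?N) * (V * (2 ^ ?N * r ^ ?N)) = C * V * 2 ^ ?N * r powr p" using r by simp
        finally have eq: "ennreal (C * (r powr p / r ^ ?N)) * ?W = ennreal (C * V * 2 ^ ?N * r powr p)" .
        show ?thesis unfolding eq[symmetric] by (simp only: mult.assoc mult.commute[of e])
      qed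
      moreover have "ennreal (C / r ^ ?N) * (ennreal ((2 * r) powr p * 2 powr p) * e * ?W) = ennreal (C * V * 2 ^ ?N * (2 powr p * 2 powr p) * r powr p) * e"
      proof -
        have "ennreal (C / r ^ ?N) * ennreal ((2 * r) powr p * 2 powr p) * ?W = ennreal (C / r ^ ?N * ((2 * r) powr p * 2 powr p) * (V * (2 ^ ?N * r ^ ?N)))"
          unfolding W using C r by (simp only: ennreal_mult'[symmetric] divide_nonneg_nonneg zero_le_power less_imp_le mult_nonneg_nonneg powr_ge_zero)
        also have "C / r ^ ?N * ((2 * r) powr p * 2 powr p) * (V * (2 ^ ?N * r ^ ?N)) = C * V * 2 ^ ?N * (2 powr p * 2 powr p) * r powr p"
          using r by (simp add: powr_mult)
        finally have eq: "ennreal (C / r ^ ?N) * ennreal ((2 * r) powr p * 2 powr p) * ?W = ennreal (C * V * 2 ^ ?N * (2 powr p * 2 powr p) * r powr p)" .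
        show ?thesis unfolding eq[symmetric] by (simp only: mult.assoc mult.commute[of e])
      qed
      moreover have "C' * r powr p = C * V * 2 ^ ?N * r powr p + C * V * 2 ^ ?N * (2 powr p * 2 powr p) * r powr p"
        by (simp add: C'_def algebra_simps)
      moreover have "ennreal (C' * r powr p) = ennreal (C * V * 2 ^ ?N * r powr p) + ennreal (C * V * 2 ^ ?N * (2 powr p * 2 powr p) * r powr p)"
        using C V calculation(3) by (subst ennreal_plus[symmetric]) auto
      ultimately show ?thesis by (simp only: distrib_right)
    qed
    finally show "(\<integral>\<^sup>+x. epow (ennreal (1 / r ^ ?N) * (\<integral>\<^sup>+h\<in>ball 0 r. epow (ennreal \<bar>f (x + h) - f x - v x \<bullet> h\<bar>) (p * q) \<partial>lborel)) (1 / q) \<partial>lborel)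
      \<le> ennreal (C' * r powr p) * e" .
  qed
qed

text \<open>This is \<^const>\<open>local_remainder\<close> with finite \<open>q\<close> for Borel representatives.\<close>

definition lrem :: "real \<Rightarrow> real \<Rightarrow> ('a::euclidean_space \<Rightarrow> real) \<Rightarrow> ('a \<Rightarrow> 'a) \<Rightarrow> real \<Rightarrow> 'a \<Rightarrow> ennreal" where
  "lrem p q f v \<epsilon> x = epow (ennreal (1 / (unit_ball_vol (real DIM('a)) * \<epsilon> ^ DIM('a))) *
     (\<integral>\<^sup>+h\<in>ball 0 \<epsilon>. epow (ennreal (\<bar>f (x + h) - f x - v x \<bullet> h\<bar> / norm h)) (p * q) \<partial>lborel)) (1 / q)"

text \<open>The least \<open>k\<close> satisfying the second inequality works: minimality gives the
  first one, or \<open>t < \<epsilon>\<close> does if \<open>k = 0\<close>. On such a shell the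
  weight \<open>1 / |h|\<close> is comparable with the inverse radius of a dyadic ball.\<close>

lemma dyadic_shell:
  fixes t \<epsilon> :: real assumes "0 < t" "t < \<epsilon>"
  obtains k :: nat where "t < \<epsilon> / 2 ^ k" "\<epsilon> / 2 ^ k \<le> 2 * t"
proof -
  obtain n where n: "\<epsilon> / t < 2 ^ n" using real_arch_pow[of 2 "\<epsilon> / t"] by auto
  define k where "k = (LEAST k. \<epsilon> / 2 ^ k \<le> 2 * t)"
  have "\<epsilon> / 2 ^ n \<le> 2 * t" using n assms by (simp add: field_simps)
  then have k: "\<epsilon> / 2 ^ k \<le> 2 * t" unfolding k_def by (rule LeastI)
  have "t < \<epsilon> / 2 ^ k"
  proof (cases k)
    case (Suc j)
    then have "\<not> \<epsilon> / 2 ^ j \<le> 2 * t" using not_less_Least[of j "\<lambda>k. \<epsilon> / 2 ^ k \<le> 2 * t"] by (simp add: k_def)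
    then show ?thesis using Suc by (simp add: field_simps)
  qed (use assms in simp)
  with k that show ?thesis by blast
qed

text \<open>Each nonzero \<open>h\<close> lies in a dyadic ball on which \<open>1 / |h|\<close> is
  at most twice the inverse radius, so the weighted integral is dominated by a sum over balls, and
  the exponent \<open>1 / q \<le> 1\<close> passes inside the sum. The decaying factor is the power
  \<open>1 / q\<close> of the ratio of the volumes of the k-th ball and the whole ball.\<close>

lemma lrem_le_suminf:
  fixes f :: "'a::euclidean_space \<Rightarrow> real"
  assumes pq: "1 \<le> p" "1 \<le> q" and \<epsilon>: "0 < \<epsilon>" and [measurable]: "f \<in> borel_measurable borel"
  shows "lrem p q f v \<epsilon> x \<le> (\<Sum>k. ennreal ((1 / unit_ball_vol (real DIM('a))) powr (1/q) * ((1/2) powr (real DIM('a) / q)) ^ k * (2 / (\<epsilon> / 2 ^ k)) powr p) *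
      epow (ennreal (1 / (\<epsilon> / 2 ^ k) ^ DIM('a)) * (\<integral>\<^sup>+h\<in>ball 0 (\<epsilon> / 2 ^ k). epow (ennreal \<bar>f (x + h) - f x - v x \<bullet> h\<bar>) (p * q) \<partial>lborel)) (1 / q))"
proof -
  let ?N = "DIM('a)"
  define V where "V = unit_ball_vol (real ?N)"
  have V: "0 < V" by (simp add: V_def)
  define r where "r k = \<epsilon> / 2 ^ k" for k :: nat
  have r: "0 < r k" for k using \<epsilon> by (simp add: r_def)
  let ?w = "\<lambda>h. \<bar>f (x + h) - f x - v x \<bullet> h\<bar>"
  define X where "X k = (\<integral>\<^sup>+h\<in>ball 0 (r k). epow (ennreal (?w h)) (p * q) \<partial>lborel)" for k
  have s: "0 < p * q" using pq by simp
  have "(\<integral>\<^sup>+h\<in>ball 0 \<epsilon>. epow (ennreal (?w h / norm h)) (p * q) \<partial>lborel) \<le>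
      (\<integral>\<^sup>+h. (\<Sum>k. ennreal ((2 / r k) powr (p * q)) * (epow (ennreal (?w h)) (p * q) * indicator (ball 0 (r k)) h)) \<partial>lborel)"
  proof (rule nn_integral_mono)
    fix h
    let ?T = "\<lambda>k. ennreal ((2 / r k) powr (p * q)) * (epow (ennreal (?w h)) (p * q) * indicator (ball 0 (r k)) h)"
    show "epow (ennreal (?w h / norm h)) (p * q) * indicator (ball 0 \<epsilon>) h \<le> (\<Sum>k. ?T k)"
    \<comment> \<open>At \<open>h = 0\<close> the quotient has the default value 0, so no dyadic
      ball is required.\<close>
    proof (cases "h \<in> ball 0 \<epsilon> \<and> h \<noteq> 0")
      case False
      then show ?thesis using s by auto
    next
      case True
      then obtain k where k: "norm h < r k" "r k \<le> 2 * norm h"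
        using dyadic_shell[of "norm h" \<epsilon>] unfolding r_def by auto
      have "?w h / norm h \<le> 2 / r k * ?w h"
      proof -
        have "1 / norm h \<le> 2 / r k" using k r[of k] True by (simp add: field_simps)
        from mult_right_mono[OF this, of "?w h"] show ?thesis by simp
      qed
      then have "epow (ennreal (?w h / norm h)) (p * q) \<le> epow (ennreal (2 / r k * ?w h)) (p * q)"
        using s by (intro epow_mono ennreal_leI) auto
      also have "\<dots> = ?T k"
        using s r[of k] k by (subst ennreal_mult) (auto simp: epow_mult epow_ennreal less_imp_le)
      also have "\<dots> \<le> (\<Sum>k. ?T k)" using sum_le_suminf[of ?T "{k}"] by simp
      finally show ?thesis using True by simp
    qed
  qed
  also have "\<dots> = (\<Sum>k. ennreal ((2 / r k) powr (p * q)) * X k)"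
    unfolding X_def by (subst nn_integral_suminf) (auto simp: nn_integral_cmult)
  finally have "lrem p q f v \<epsilon> x \<le> epow (ennreal (1 / (V * \<epsilon> ^ ?N)) * (\<Sum>k. ennreal ((2 / r k) powr (p * q)) * X k)) (1 / q)"
    unfolding lrem_def V_def using pq by (intro epow_mono mult_left_mono) auto
  \<comment> \<open>The factor \<open>1 / \<epsilon> ^ ?N\<close> is rewritten as
    \<open>1 / r k ^ ?N\<close> times the volume ratio \<open>((1/2) ^ k) ^ ?N\<close>.\<close>
  also have "ennreal (1 / (V * \<epsilon> ^ ?N)) * (\<Sum>k. ennreal ((2 / r k) powr (p * q)) * X k) =
      (\<Sum>k. ennreal (1 / V * ((1/2) ^ k) ^ ?N * (2 / r k) powr (p * q)) * (ennreal (1 / r k ^ ?N) * X k))"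
  proof -
    have "ennreal (1 / (V * \<epsilon> ^ ?N)) * (ennreal ((2 / r k) powr (p * q)) * X k) =
        ennreal (1 / V * ((1/2) ^ k) ^ ?N * (2 / r k) powr (p * q)) * (ennreal (1 / r k ^ ?N) * X k)" for k
    proof -
      have "1 / (V * \<epsilon> ^ ?N) * (2 / r k) powr (p * q) = 1 / V * ((1/2) ^ k) ^ ?N * (2 / r k) powr (p * q) * (1 / r k ^ ?N)"
        using \<epsilon> V by (simp add: r_def power_divide)
      then show ?thesis using V \<epsilon> r[of k] by (simp only: mult.assoc[symmetric]) (subst (1 2) ennreal_mult'[symmetric]; simp)
    qed
    then show ?thesis by (simp add: ennreal_suminf_cmult[symmetric])
  qed
  also have "epow (\<Sum>k. ennreal (1 / V * ((1/2) ^ k) ^ ?N * (2 / r k) powr (p * q)) * (ennreal (1 / r k ^ ?N) * X k)) (1 / q) \<le>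
      (\<Sum>k. epow (ennreal (1 / V * ((1/2) ^ k) ^ ?N * (2 / r k) powr (p * q)) * (ennreal (1 / r k ^ ?N) * X k)) (1 / q))"
    using pq by (intro epow_suminf_le) auto
  also have "\<dots> = (\<Sum>k. ennreal ((1 / V) powr (1/q) * ((1/2) powr (real ?N / q)) ^ k * (2 / r k) powr p) * epow (ennreal (1 / r k ^ ?N) * X k) (1 / q))"
  proof (intro suminf_cong)
    fix k
    have "((1/2::real) ^ k) ^ ?N = (1/2) powr (real (k * ?N))"
      using powr_realpow[of "1/2 :: real" "k * ?N"] by (simp only: power_mult)
    then have "(((1/2::real) ^ k) ^ ?N) powr (1/q) = (1/2) powr (real ?N / q * real k)"
      by (simp add: powr_powr mult_ac)
    also have "\<dots> = ((1/2) powr (real ?N / q)) ^ k"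
      using powr_realpow[of "(1/2 :: real) powr (real ?N / q)" k] by (simp only: powr_powr) simp
    finally have e: "(((1/2::real) ^ k) ^ ?N) powr (1/q) = ((1/2) powr (real ?N / q)) ^ k" .
    have "((2 / r k) powr (p * q)) powr (1/q) = (2 / r k) powr p" using pq by (simp add: powr_powr)
    then have "(1 / V * ((1/2) ^ k) ^ ?N * (2 / r k) powr (p * q)) powr (1/q) = (1 / V) powr (1/q) * ((1/2) powr (real ?N / q)) ^ k * (2 / r k) powr p"
      using V by (simp only: powr_mult e)
    then show "epow (ennreal (1 / V * ((1/2) ^ k) ^ ?N * (2 / r k) powr (p * q)) * (ennreal (1 / r k ^ ?N) * X k)) (1 / q) =
       ennreal ((1 / V) powr (1/q) * ((1/2) powr (real ?N / q)) ^ k * (2 / r k) powr p) * epow (ennreal (1 / r k ^ ?N) * X k) (1 / q)"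
      using pq V by (subst epow_mult) (auto simp: epow_ennreal)
  qed
  finally show ?thesis unfolding V_def r_def X_def .
qed

text \<open>The weight \<open>(2 / r) powr p\<close> on the ball of radius \<open>r\<close> cancels
  against \<open>r powr p\<close> in the bound for the unweighted remainder. What is left is a
  geometric series whose ratio \<theta> is less than 1 because \<open>q\<close> is finite.\<close>

lemma nn_integral_lrem_tendsto:
  fixes f :: "'a::euclidean_space \<Rightarrow> real" and p q :: real
  assumes pq: "1 \<le> p" "1 \<le> q" "p \<le> DIM('a)"
    and pqN: "p < DIM('a) \<Longrightarrow> q = real DIM('a) / (real DIM('a) - p)"
    and fv: "sobolev_pair p f v"
  shows "((\<lambda>\<epsilon>. \<integral>\<^sup>+x. lrem p q f v \<epsilon> x \<partial>lborel) \<longlongrightarrow> 0) (at_right 0)"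
proof -
  let ?N = "DIM('a)"
  note [measurable] = sobolev_pairD(1,2)[OF fv]
  from scaled_remainder_bound[OF pq pqN] obtain C where C: "0 \<le> C" and
    bound: "\<And>f v e r. sobolev_pair p (f :: 'a \<Rightarrow> real) v \<Longrightarrow> 0 < r \<Longrightarrow>
      (\<forall>k. norm k \<le> 2 * r \<longrightarrow> pint p (\<lambda>x. v (x + k) - v x) \<le> e) \<Longrightarrow>
    (\<integral>\<^sup>+x. epow (ennreal (1 / r ^ ?N) * (\<integral>\<^sup>+h\<in>ball 0 r. epow (ennreal \<bar>f (x + h) - f x - v x \<bullet> h\<bar>) (p * q) \<partial>lborel)) (1 / q) \<partial>lborel)
      \<le> ennreal (C * r powr p) * e" by blast
  define V where "V = unit_ball_vol (real ?N)"
  have V: "0 < V" by (simp add: V_def)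
  define \<theta> where "\<theta> = (1/2::real) powr (real ?N / q)"
  have \<theta>: "0 \<le> \<theta>" "\<theta> < 1" 
    unfolding \<theta>_def using pq powr_less_mono'[of "1/2" 0 "real ?N / q"] by auto
  define K where "K = (1 / V) powr (1/q) * 2 powr p * C / (1 - \<theta>)"
  have main: "(\<integral>\<^sup>+x. lrem p q f v \<epsilon> x \<partial>lborel) \<le> ennreal K * e"
    if \<epsilon>: "0 < \<epsilon>" and e: "\<And>k. norm k \<le> 2 * \<epsilon> \<Longrightarrow> pint p (\<lambda>x. v (x + k) - v x) \<le> e" for \<epsilon> e
  proof -
    define c where "c k = (1 / V) powr (1/q) * \<theta> ^ k * (2 / (\<epsilon> / 2 ^ k)) powr p" for k :: nat
    have c: "0 \<le> c k" for k using \<theta> by (simp add: c_def)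
    let ?A = "\<lambda>k x. epow (ennreal (1 / (\<epsilon> / 2 ^ k) ^ ?N) * (\<integral>\<^sup>+h\<in>ball 0 (\<epsilon> / 2 ^ k). epow (ennreal \<bar>f (x + h) - f x - v x \<bullet> h\<bar>) (p * q) \<partial>lborel)) (1 / q)"
    have "(\<integral>\<^sup>+x. lrem p q f v \<epsilon> x \<partial>lborel) \<le> (\<integral>\<^sup>+x. (\<Sum>k. ennreal (c k) * ?A k x) \<partial>lborel)"
      unfolding c_def V_def \<theta>_def by (intro nn_integral_mono lrem_le_suminf pq \<epsilon>) measurable
    also have "\<dots> = (\<Sum>k. ennreal (c k) * (\<integral>\<^sup>+x. ?A k x \<partial>lborel))"
      by (subst nn_integral_suminf) (auto simp: nn_integral_cmult)
    also have "\<dots> \<le> (\<Sum>k. ennreal (c k) * (ennreal (C * (\<epsilon> / 2 ^ k) powr p) * e))"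
    proof (intro suminf_le mult_left_mono bound[OF fv] allI impI)
      fix k :: nat and j :: 'a assume "norm j \<le> 2 * (\<epsilon> / 2 ^ k)"
      \<comment> \<open>One bound \<open>e\<close> for the translations at scale \<epsilon> serves
        all smaller balls.\<close>
      moreover have "\<epsilon> / 2 ^ k \<le> \<epsilon>" using \<epsilon> by (simp add: field_simps)
      ultimately show "pint p (\<lambda>x. v (x + j) - v x) \<le> e" by (intro e) linarith
    qed (use \<epsilon> in auto)
    also have "\<dots> = (\<Sum>k. ennreal ((1 / V) powr (1/q) * 2 powr p * C * \<theta> ^ k) * e)"
    proof (intro suminf_cong)
      fix k :: nat
      have "(2 / (\<epsilon> / 2 ^ k)) powr p * (\<epsilon> / 2 ^ k) powr p = 2 powr p"
        using \<epsilon> by (simp add: powr_mult[symmetric])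
      then have "c k * (C * (\<epsilon> / 2 ^ k) powr p) = (1 / V) powr (1/q) * 2 powr p * C * \<theta> ^ k"
        by (simp only: c_def mult_ac)
      then show "ennreal (c k) * (ennreal (C * (\<epsilon> / 2 ^ k) powr p) * e) = ennreal ((1 / V) powr (1/q) * 2 powr p * C * \<theta> ^ k) * e"
        using c[of k] by (simp only: mult.assoc[symmetric] ennreal_mult'[symmetric])
    qed
    also have "\<dots> = (\<Sum>k. ennreal ((1 / V) powr (1/q) * 2 powr p * C * \<theta> ^ k)) * e"
      by (rule ennreal_suminf_multc)
    also have "(\<Sum>k. ennreal ((1 / V) powr (1/q) * 2 powr p * C * \<theta> ^ k)) = ennreal (\<Sum>k. (1 / V) powr (1/q) * 2 powr p * C * \<theta> ^ k)"
      using \<theta> C by (intro suminf_ennreal2 summable_mult summable_geometric) auto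
    also have "(\<Sum>k. (1 / V) powr (1/q) * 2 powr p * C * \<theta> ^ k) = K"
      using \<theta> by (subst suminf_mult) (auto simp: K_def suminf_geometric summable_geometric)
    finally show ?thesis .
  qed
  show ?thesis
  proof (rule tendsto_0_ennrealI[where K=K])
    fix e :: real assume e: "0 < e"
    have "\<forall>\<^sub>F h in nhds 0. pint p (\<lambda>x. v (x + h) - v x) < ennreal e"
      using translation_continuous_pint[OF pq(1) sobolev_pairD(2,4)[OF fv]] e
      unfolding translation_continuous_def by (intro order_tendstoD(2)) auto
    then obtain d where d: "0 < d" "\<And>h. norm h < d \<Longrightarrow> pint p (\<lambda>x. v (x + h) - v x) < ennreal e"
      unfolding eventually_nhds_metric by (auto simp: dist_norm)
    have "\<forall>\<^sub>F \<epsilon> in at_right 0. 0 < \<epsilon> \<and> \<epsilon> < d / 2"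
      using d(1) eventually_at_right_real[of 0 "d/2"] by (auto elim!: eventually_mono)
    then show "\<forall>\<^sub>F \<epsilon> in at_right 0. (\<integral>\<^sup>+x. lrem p q f v \<epsilon> x \<partial>lborel) \<le> ennreal K * ennreal e"
    proof eventually_elim
      case (elim \<epsilon>)
      show ?case
      proof (rule main)
        show "pint p (\<lambda>x. v (x + k) - v x) \<le> ennreal e" if "norm k \<le> 2 * \<epsilon>" for k
          using d(2)[of k] that elim by (simp add: less_imp_le)
      qed (use elim in simp)
    qed
  qed
qed

text \<open>Power means with respect to the normalised measure on the ball increase with the
  exponent, by Jensen's inequality with exponent \<open>q' / q\<close>.\<close>

lemma lrem_mono:
  fixes f :: "'a::euclidean_space \<Rightarrow> real"
  assumes p: "1 \<le> p" and q: "1 \<le> q" "q \<le> q'" and \<epsilon>: "0 < \<epsilon>" and [measurable]: "f \<in> borel_measurable borel"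
  shows "lrem p q f v \<epsilon> x \<le> lrem p q' f v \<epsilon> x"
proof -
  let ?N = "DIM('a)"
  define c where "c = 1 / (unit_ball_vol (real ?N) * \<epsilon> ^ ?N)"
  let ?F = "\<lambda>h. ennreal (\<bar>f (x + h) - f x - v x \<bullet> h\<bar> / norm h)"
  let ?g = "\<lambda>h. ennreal c * indicator (ball (0::'a) \<epsilon>) h"
  have g1: "(\<integral>\<^sup>+h. ?g h \<partial>lborel) = 1" unfolding c_def by (rule nn_integral_ball_weight[OF \<epsilon>])
  have eq: "ennreal c * (\<integral>\<^sup>+h\<in>ball 0 \<epsilon>. epow (?F h) (p * s) \<partial>lborel) = (\<integral>\<^sup>+h. epow (?F h) (p * s) * ?g h \<partial>lborel)" for s
    by (subst nn_integral_cmult[symmetric]) (auto simp: mult_ac)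
  have "epow (\<integral>\<^sup>+h. epow (?F h) (p * q) * ?g h \<partial>lborel) (q' / q) \<le>
     epow (\<integral>\<^sup>+h. ?g h \<partial>lborel) (q' / q - 1) * (\<integral>\<^sup>+h. epow (epow (?F h) (p * q)) (q' / q) * ?g h \<partial>lborel)"
    using q by (intro nn_integral_Jensen) auto
  also have "\<dots> = (\<integral>\<^sup>+h. epow (?F h) (p * q') * ?g h \<partial>lborel)"
    using p q by (simp add: g1 epow_epow)
  finally have "epow (epow (\<integral>\<^sup>+h. epow (?F h) (p * q) * ?g h \<partial>lborel) (q' / q)) (1 / q') \<le> epow (\<integral>\<^sup>+h. epow (?F h) (p * q') * ?g h \<partial>lborel) (1 / q')"
    using q by (intro epow_mono) auto
  then show ?thesis
    using p q unfolding lrem_def c_def[symmetric] eq by (simp add: epow_epow)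
qed

section \<open>The maximal function\<close>

text \<open>Only the radii \<open>r / 2 ^ k\<close> occur: the supremum is countable, hence measurable, and the radii are bounded, as the
  Vitali covering lemma requires.\<close>

definition maxfun :: "real \<Rightarrow> ('a::euclidean_space \<Rightarrow> ennreal) \<Rightarrow> 'a \<Rightarrow> ennreal" where
  "maxfun r u x = (SUP k::nat. ennreal (1 / (unit_ball_vol (real DIM('a)) * (r / 2 ^ k) ^ DIM('a))) *
     (\<integral>\<^sup>+h\<in>ball 0 (r / 2 ^ k). u (x + h) \<partial>lborel))"

lemma measurable_maxfun [measurable]:
  assumes [measurable]: "u \<in> borel_measurable borel" shows "maxfun r u \<in> borel_measurable borel"
  unfolding maxfun_def[abs_def] by measurable

lemma nn_integral_ball_shift:
  fixes u :: "'a::euclidean_space \<Rightarrow> ennreal"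
  assumes [measurable]: "u \<in> borel_measurable borel"
  shows "(\<integral>\<^sup>+h\<in>ball 0 r. u (x + h) \<partial>lborel) = (\<integral>\<^sup>+y\<in>ball x r. u y \<partial>lborel)"
proof -
  have "(\<integral>\<^sup>+h\<in>ball 0 r. u (x + h) \<partial>lborel) = (\<integral>\<^sup>+h. u (x + h) * indicator (ball x r) (x + h) \<partial>lborel)"
    by (intro nn_integral_cong arg_cong2[where f="(*)"] refl) (auto simp: indicator_def dist_norm)
  also have "\<dots> = (\<integral>\<^sup>+y\<in>ball x r. u y \<partial>lborel)"
    by (rule nn_integral_shift[of "\<lambda>y. u y * indicator (ball x r) y"]) measurable
  finally show ?thesis .
qed

text \<open>Each point of the level set is the centre of a dyadic ball on which the mass of
  \<open>u\<close> is at least \<open>l\<close> times the volume. The Vitali covering lemma selects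
  disjoint ones whose fivefold enlargements cover the level set; the factor 5 in the radius costs
  \<open>5 ^ N\<close> in volume.\<close>

lemma maxfun_weak:
  fixes u :: "'a::euclidean_space \<Rightarrow> ennreal"
  assumes [measurable]: "u \<in> borel_measurable borel" and r: "0 < r" and l: "0 < l"
  shows "ennreal l * emeasure lborel {x. ennreal l < maxfun r u x} \<le> ennreal (5 ^ DIM('a)) * (\<integral>\<^sup>+x. u x \<partial>lborel)"
proof -
  let ?N = "DIM('a)"
  define V where "V = unit_ball_vol (real ?N)"
  have V: "0 < V" by (simp add: V_def)
  define E where "E = {x. ennreal l < maxfun r u x}"
  have [measurable]: "E \<in> sets borel" unfolding E_def by measurable
  \<comment> \<open>Regarded as a measure, the mass of \<open>u\<close> is countably additive over
    the disjoint balls.\<close>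
  define D where "D = density lborel u"
  have "\<exists>k::nat. ennreal l * emeasure lborel (ball x (r / 2 ^ k)) \<le> emeasure D (ball x (r / 2 ^ k))" if x: "x \<in> E" for x
  proof -
    obtain k :: nat where k: "ennreal l < ennreal (1 / (V * (r / 2 ^ k) ^ ?N)) * (\<integral>\<^sup>+h\<in>ball 0 (r / 2 ^ k). u (x + h) \<partial>lborel)"
      using x unfolding E_def maxfun_def V_def by (auto simp: less_SUP_iff)
    define c where "c = V * (r / 2 ^ k) ^ ?N"
    have c: "0 < c" using V r by (simp add: c_def)
    have "emeasure D (ball x (r / 2 ^ k)) = (\<integral>\<^sup>+h\<in>ball 0 (r / 2 ^ k). u (x + h) \<partial>lborel)"
      unfolding D_def nn_integral_ball_shift[OF assms(1)] by (rule emeasure_density) auto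
    then have k': "ennreal l \<le> ennreal (1 / c) * emeasure D (ball x (r / 2 ^ k))" using k unfolding c_def by (simp add: less_imp_le)
    have e: "emeasure lborel (ball x (r / 2 ^ k)) = ennreal c" using r by (simp add: emeasure_lborel_ball c_def V_def)
    have "ennreal l * emeasure lborel (ball x (r / 2 ^ k)) \<le> ennreal (1 / c) * emeasure D (ball x (r / 2 ^ k)) * ennreal c"
      unfolding e by (intro mult_right_mono k') auto
    also have "\<dots> = (ennreal (1 / c) * ennreal c) * emeasure D (ball x (r / 2 ^ k))" by (simp only: mult_ac)
    also have "ennreal (1 / c) * ennreal c = 1" using c by (simp add: ennreal_mult'[symmetric])
    finally show ?thesis by (auto intro!: exI[of _ k])
  qed
  then obtain \<kappa> :: "'a \<Rightarrow> nat" where \<kappa>: "\<And>x. x \<in> E \<Longrightarrow> ennreal l * emeasure lborel (ball x (r / 2 ^ \<kappa> x)) \<le> emeasure D (ball x (r / 2 ^ \<kappa> x))"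
    by metis
  define \<rho> where "\<rho> x = r / 2 ^ \<kappa> x" for x
  have \<rho>: "0 < \<rho> x \<and> \<rho> x \<le> r" for x using r by (auto simp: \<rho>_def field_simps)
  have "E \<subseteq> (\<Union>x\<in>E. ball x (\<rho> x))" using \<rho> by force
  then obtain C where C: "countable C" "C \<subseteq> E" "pairwise (\<lambda>i j. disjnt (ball i (\<rho> i)) (ball j (\<rho> j))) C" "E \<subseteq> (\<Union>i\<in>C. ball i (5 * \<rho> i))"
    using Vitali_covering_lemma_balls[where S=E and a="\<lambda>x. x" and K=E and r=\<rho> and B=r] \<rho> by blast
  \<comment> \<open>The selected balls indexed by natural numbers, with empty sets at the remaining
    indices: \<open>s = 1\<close> gives the disjoint balls, \<open>s = 5\<close> the covering
    ones.\<close>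
  define A where "A s n = (if n \<in> to_nat_on C ` C then ball (from_nat_into C n) (s * \<rho> (from_nat_into C n)) else {})" for s and n :: nat
  have A_sets[measurable]: "A s n \<in> sets borel" for s n by (simp add: A_def)
  have A_eq: "A s (to_nat_on C i) = ball i (s * \<rho> i)" if "i \<in> C" for i s using that C(1) by (simp add: A_def)
  have disj: "disjoint_family (A 1)"
    unfolding disjoint_family_on_def
  proof (intro ballI impI)
    fix m n :: nat assume "m \<noteq> n"
    show "A 1 m \<inter> A 1 n = {}"
    proof (cases "m \<in> to_nat_on C ` C \<and> n \<in> to_nat_on C ` C")
      case True
      then obtain i j where ij: "i \<in> C" "j \<in> C" "m = to_nat_on C i" "n = to_nat_on C j" by blast
      with \<open>m \<noteq> n\<close> have "i \<noteq> j" by auto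
      then have "disjnt (ball i (\<rho> i)) (ball j (\<rho> j))" using C(3) ij by (auto simp: pairwise_def)
      then show ?thesis using ij by (simp add: A_eq disjnt_def)
    qed (auto simp: A_def)
  qed
  have le: "ennreal l * emeasure lborel (A 5 n) \<le> ennreal (5 ^ ?N) * emeasure D (A 1 n)" for n
  proof (cases "n \<in> to_nat_on C ` C")
    case True
    then obtain i where i: "i \<in> C" "n = to_nat_on C i" by blast
    have "emeasure lborel (A 5 n) = ennreal (5 ^ ?N) * emeasure lborel (ball i (\<rho> i))"
      using i \<rho>[of i] by (simp add: A_eq emeasure_lborel_ball power_mult_distrib ennreal_mult'[symmetric] mult_ac del: ennreal_power)
    then have "ennreal l * emeasure lborel (A 5 n) = ennreal (5 ^ ?N) * (ennreal l * emeasure lborel (ball i (\<rho> i)))"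
      by (simp only: mult_ac)
    also have "\<dots> \<le> ennreal (5 ^ ?N) * emeasure D (ball i (\<rho> i))"
      using \<kappa>[of i] i C(2) unfolding \<rho>_def by (intro mult_left_mono) auto
    also have "ball i (\<rho> i) = A 1 n" using i by (simp add: A_eq)
    finally show ?thesis .
  qed (simp add: A_def)
  have "E \<subseteq> (\<Union>n. A 5 n)"
  proof
    fix x assume "x \<in> E"
    then obtain i where "i \<in> C" "x \<in> ball i (5 * \<rho> i)" using C(4) by blast
    then show "x \<in> (\<Union>n. A 5 n)" using A_eq[of i 5] by blast
  qed
  then have "emeasure lborel E \<le> emeasure lborel (\<Union>n. A 5 n)" by (intro emeasure_mono) auto
  also have "\<dots> \<le> (\<Sum>n. emeasure lborel (A 5 n))" by (intro emeasure_subadditive_countably) auto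
  finally have "ennreal l * emeasure lborel E \<le> ennreal l * (\<Sum>n. emeasure lborel (A 5 n))" by (intro mult_left_mono) auto
  also have "\<dots> \<le> (\<Sum>n. ennreal (5 ^ ?N) * emeasure D (A 1 n))"
    unfolding ennreal_suminf_cmult[symmetric] by (intro suminf_le le) auto
  also have "\<dots> = ennreal (5 ^ ?N) * emeasure D (\<Union>n. A 1 n)"
    unfolding ennreal_suminf_cmult by (subst suminf_emeasure) (use disj in \<open>auto simp: D_def\<close>)
  also have "\<dots> \<le> ennreal (5 ^ ?N) * emeasure D (space D)"
    by (intro mult_left_mono emeasure_mono) (auto simp: D_def)
  also have "emeasure D (space D) = (\<integral>\<^sup>+x. u x \<partial>lborel)"
    by (simp add: D_def emeasure_density)
  finally show ?thesis unfolding E_def .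
qed

section \<open>From the weak to the strong maximal inequality\<close>

lemma nn_integral_powr_0:
  assumes "-1 < a" "0 \<le> c"
  shows "(\<integral>\<^sup>+x. ennreal (x powr a) * indicator {0..c} x \<partial>lborel) = ennreal (c powr (a + 1) / (a + 1))"
  using has_integral_powr_from_0[OF assms] by (intro nn_integral_has_integral_lebesgue') auto

text \<open>The power rule is integrated up to a finite \<open>c\<close> with
  \<open>ennreal c \<le> y\<close>. For \<open>y = top\<close> arbitrarily large \<open>c\<close>
  force the integral to be infinite.\<close>

lemma layer_cake:
  assumes t: "0 < t"
  shows "epow y t \<le> (\<integral>\<^sup>+l. ennreal (t * l powr (t - 1)) * indicator {l. 0 < l \<and> ennreal l < y} l \<partial>lborel)"
proof -
  have fin: "epow (ennreal c) t \<le> (\<integral>\<^sup>+l. ennreal (t * l powr (t - 1)) * indicator {l. 0 < l \<and> ennreal l < y} l \<partial>lborel)"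
    if c: "0 \<le> c" "ennreal c \<le> y" for c
  proof -
    have "epow (ennreal c) t = ennreal t * ennreal (c powr t / t)"
      using t c by (simp add: epow_ennreal ennreal_mult'[symmetric])
    also have "ennreal (c powr t / t) = (\<integral>\<^sup>+l. ennreal (l powr (t - 1)) * indicator {0..c} l \<partial>lborel)"
      using nn_integral_powr_0[of "t - 1" c] t c by simp
    also have "ennreal t * \<dots> = (\<integral>\<^sup>+l. ennreal (t * l powr (t - 1)) * indicator {0..c} l \<partial>lborel)"
      using t by (subst nn_integral_cmult[symmetric]) (auto simp: ennreal_mult mult.assoc)
    also have "\<dots> \<le> (\<integral>\<^sup>+l. ennreal (t * l powr (t - 1)) * indicator {l. 0 < l \<and> ennreal l < y} l \<partial>lborel)"
    proof (rule nn_integral_mono_AE)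
      \<comment> \<open>The interval is contained in the set with strict inequalities except
        possibly for its endpoints, which form a null set.\<close>
      show "AE l in lborel. ennreal (t * l powr (t - 1)) * indicator {0..c} l \<le> ennreal (t * l powr (t - 1)) * indicator {l. 0 < l \<and> ennreal l < y} l"
        using AE_lborel_singleton[of 0] AE_lborel_singleton[of c]
      proof eventually_elim
        case (elim l)
        have "l \<in> {0..c} \<Longrightarrow> ennreal l < y"
          using elim c less_le_trans[of "ennreal l" "ennreal c" y] by (auto simp: ennreal_less_iff)
        then show ?case using elim by (auto simp: indicator_def)
      qed
    qed
    finally show ?thesis .
  qed
  show ?thesis
  proof (cases y rule: ennreal_cases)
    case (real c)
    then show ?thesis using fin[of c] by simp
  next
    case top
    let ?R = "\<integral>\<^sup>+l. ennreal (t * l powr (t - 1)) * indicator {l. 0 < l \<and> ennreal l < y} l \<partial>lborel"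
    have le: "ennreal z \<le> ?R" if z: "0 \<le> z" for z
      using fin[of "z powr (1/t)"] t z top by (simp add: epow_ennreal powr_powr)
    have "?R = top"
    proof (cases ?R rule: ennreal_cases)
      case (real z)
      have "ennreal (z + 1) \<le> ennreal z" using le[of "z + 1"] real by simp
      then show ?thesis using real(1) by simp
    qed
    then show ?thesis by simp
  qed
qed

text \<open>What the truncation removes from \<open>u\<close> is at most \<open>l\<close>, and so
  are its averages.\<close>

lemma maxfun_truncate:
  fixes u :: "'a::euclidean_space \<Rightarrow> ennreal"
  assumes [measurable]: "u \<in> borel_measurable borel" and r: "0 < r" and l: "0 \<le> l"
  shows "maxfun r u x \<le> maxfun r (\<lambda>y. u y * indicator {y. ennreal l < u y} y) x + ennreal l"
  unfolding maxfun_def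
proof (rule SUP_least)
  fix k :: nat
  let ?N = "DIM('a)" and ?w = "\<lambda>y. u y * indicator {y. ennreal l < u y} y" and ?B = "ball (0::'a) (r / 2 ^ k)"
  define V where "V = unit_ball_vol (real ?N)"
  have V: "0 < V" by (simp add: V_def)
  define c where "c = V * (r / 2 ^ k) ^ ?N"
  have c: "0 < c" using V r by (simp add: c_def)
  have "(\<integral>\<^sup>+h\<in>?B. u (x + h) \<partial>lborel) \<le> (\<integral>\<^sup>+h. ?w (x + h) * indicator ?B h + ennreal l * indicator ?B h \<partial>lborel)"
    by (intro nn_integral_mono) (auto simp: indicator_def)
  also have "\<dots> = (\<integral>\<^sup>+h\<in>?B. ?w (x + h) \<partial>lborel) + ennreal l * emeasure lborel ?B"
    by (subst nn_integral_add) (auto simp: nn_integral_cmult_indicator)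
  also have "emeasure lborel ?B = ennreal c" using r by (simp add: emeasure_lborel_ball c_def V_def)
  finally have "ennreal (1 / c) * (\<integral>\<^sup>+h\<in>?B. u (x + h) \<partial>lborel) \<le>
      ennreal (1 / c) * ((\<integral>\<^sup>+h\<in>?B. ?w (x + h) \<partial>lborel) + ennreal l * ennreal c)"
    by (intro mult_left_mono) auto
  also have "\<dots> = ennreal (1 / c) * (\<integral>\<^sup>+h\<in>?B. ?w (x + h) \<partial>lborel) + ennreal l"
  proof -
    have "ennreal (1 / c) * (ennreal l * ennreal c) = ennreal l" using c l by (simp add: ennreal_mult'[symmetric])
    then show ?thesis by (simp only: distrib_left)
  qed
  also have "\<dots> \<le> (SUP k. ennreal (1 / (V * (r / 2 ^ k) ^ ?N)) * (\<integral>\<^sup>+h\<in>ball 0 (r / 2 ^ k). ?w (x + h) \<partial>lborel)) + ennreal l"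
    unfolding c_def by (intro add_right_mono SUP_upper) simp
  finally show "ennreal (1 / (unit_ball_vol (real ?N) * (r / 2 ^ k) ^ ?N)) * (\<integral>\<^sup>+h\<in>?B. u (x + h) \<partial>lborel) \<le>
     (SUP k. ennreal (1 / (unit_ball_vol (real ?N) * (r / 2 ^ k) ^ ?N)) * (\<integral>\<^sup>+h\<in>ball 0 (r / 2 ^ k). ?w (x + h) \<partial>lborel)) + ennreal l"
    unfolding c_def V_def .
qed

text \<open>At level \<open>l\<close> the weak type estimate is applied to the part of \<open>w\<close> above \<open>l / 2\<close>.\<close>

lemma maxfun_strong:
  fixes w :: "'a::euclidean_space \<Rightarrow> real"
  assumes t: "1 < t" and r: "0 < r" and [measurable]: "w \<in> borel_measurable borel" and w: "\<And>x. 0 \<le> w x"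
  shows "(\<integral>\<^sup>+x. epow (maxfun r (\<lambda>x. ennreal (w x)) x) t \<partial>lborel) \<le>
    ennreal (2 * 5 ^ DIM('a) * t * (2 powr (t - 1) / (t - 1))) * (\<integral>\<^sup>+x. epow (ennreal (w x)) t \<partial>lborel)"
proof -
  let ?N = "DIM('a)"
  let ?M = "maxfun r (\<lambda>x. ennreal (w x))"
  let ?wl = "\<lambda>l y. ennreal (w y) * indicator {y. ennreal (l / 2) < ennreal (w y)} y"
  have weak: "emeasure lborel {x. ennreal l < ?M x} \<le> ennreal (2 * 5 ^ ?N / l) * (\<integral>\<^sup>+y. ?wl l y \<partial>lborel)" if l: "0 < l" for l
  proof -
    have "{x. ennreal l < ?M x} \<subseteq> {x. ennreal (l / 2) < maxfun r (?wl l) x}"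
    proof
      fix x assume x: "x \<in> {x. ennreal l < ?M x}"
      show "x \<in> {x. ennreal (l / 2) < maxfun r (?wl l) x}"
      proof (rule ccontr)
        assume "x \<notin> {x. ennreal (l / 2) < maxfun r (?wl l) x}"
        then have "maxfun r (?wl l) x \<le> ennreal (l / 2)" by (simp add: not_less)
        then have "?M x \<le> ennreal (l / 2) + ennreal (l / 2)"
          using l r by (intro order_trans[OF maxfun_truncate[of "\<lambda>x. ennreal (w x)" r "l/2"]] add_mono) auto
        also have "\<dots> = ennreal l" using l by (simp add: ennreal_plus[symmetric] del: ennreal_plus)
        finally show False using x by simp
      qed
    qed
    then have "emeasure lborel {x. ennreal l < ?M x} \<le> emeasure lborel {x. ennreal (l / 2) < maxfun r (?wl l) x}"
      by (intro emeasure_mono) measurable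
    also have "\<dots> = ennreal (2 / l) * (ennreal (l / 2) * emeasure lborel {x. ennreal (l / 2) < maxfun r (?wl l) x})"
      using l by (simp add: mult.assoc[symmetric] ennreal_mult'[symmetric])
    also have "\<dots> \<le> ennreal (2 / l) * (ennreal (5 ^ ?N) * (\<integral>\<^sup>+y. ?wl l y \<partial>lborel))"
      using l r by (intro mult_left_mono maxfun_weak) auto
    also have "\<dots> = ennreal (2 * 5 ^ ?N / l) * (\<integral>\<^sup>+y. ?wl l y \<partial>lborel)"
      using l by (simp add: mult.assoc[symmetric] ennreal_mult'[symmetric] del: ennreal_power)
    finally show ?thesis .
  qed
  have "(\<integral>\<^sup>+x. epow (?M x) t \<partial>lborel) \<le> (\<integral>\<^sup>+x. (\<integral>\<^sup>+l. ennreal (t * l powr (t - 1)) * indicator {l. 0 < l \<and> ennreal l < ?M x} l \<partial>lborel) \<partial>lborel)"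
    using t by (intro nn_integral_mono layer_cake) auto
  also have "\<dots> = (\<integral>\<^sup>+l. (\<integral>\<^sup>+x. ennreal (t * l powr (t - 1)) * indicator {l. 0 < l \<and> ennreal l < ?M x} l \<partial>lborel) \<partial>lborel)"
    by (rule lborel_pair.Fubini') measurable
  \<comment> \<open>The weak estimate contributes \<open>1 / l\<close>, which lowers the exponent to
    \<open>t - 2\<close>. Tonelli's theorem then leaves the integral of
    \<open>l powr (t - 2)\<close> up to \<open>2 * w y\<close>; it converges at 0 because
    \<open>t > 1\<close> and gives the constant \<open>2 powr (t - 1) / (t - 1)\<close>.\<close>
  also have "\<dots> \<le> (\<integral>\<^sup>+l. (\<integral>\<^sup>+y. ennreal (w y) * (ennreal (2 * 5 ^ ?N * t) * (ennreal (l powr (t - 2)) * indicator {l. 0 \<le> l \<and> l \<le> 2 * w y} l)) \<partial>lborel) \<partial>lborel)"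
  proof (rule nn_integral_mono)
    fix l :: real
    show "(\<integral>\<^sup>+x. ennreal (t * l powr (t - 1)) * indicator {l. 0 < l \<and> ennreal l < ?M x} l \<partial>lborel) \<le>
      (\<integral>\<^sup>+y. ennreal (w y) * (ennreal (2 * 5 ^ ?N * t) * (ennreal (l powr (t - 2)) * indicator {l. 0 \<le> l \<and> l \<le> 2 * w y} l)) \<partial>lborel)"
    proof (cases "0 < l")
      case False
      then have "(\<integral>\<^sup>+x. ennreal (t * l powr (t - 1)) * indicator {l. 0 < l \<and> ennreal l < ?M x} l \<partial>lborel) = 0"
        by (simp add: indicator_def)
      then show ?thesis by simp
    next
      case l: True
      have "(\<integral>\<^sup>+x. ennreal (t * l powr (t - 1)) * indicator {l. 0 < l \<and> ennreal l < ?M x} l \<partial>lborel) =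
         (\<integral>\<^sup>+x. ennreal (t * l powr (t - 1)) * indicator {x. ennreal l < ?M x} x \<partial>lborel)"
        using l by (intro nn_integral_cong) (auto simp: indicator_def)
      also have "\<dots> = ennreal (t * l powr (t - 1)) * emeasure lborel {x. ennreal l < ?M x}"
        by (intro nn_integral_cmult_indicator) measurable
      also have "\<dots> \<le> ennreal (t * l powr (t - 1)) * (ennreal (2 * 5 ^ ?N / l) * (\<integral>\<^sup>+y. ?wl l y \<partial>lborel))"
        by (intro mult_left_mono weak l) auto
      also have "\<dots> = ennreal (t * l powr (t - 1) * (2 * 5 ^ ?N / l)) * (\<integral>\<^sup>+y. ?wl l y \<partial>lborel)"
        using t l by (simp add: mult.assoc[symmetric] ennreal_mult''[symmetric] del: ennreal_power)
      also have "t * l powr (t - 1) * (2 * 5 ^ ?N / l) = 2 * 5 ^ ?N * t * l powr (t - 2)"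
      proof -
        have "l powr (t - 1) / l = l powr (t - 2)" using l powr_diff[of l "t - 1" 1] by simp
        moreover have "t * l powr (t - 1) * (2 * 5 ^ ?N / l) = 2 * 5 ^ ?N * t * (l powr (t - 1) / l)" by simp
        ultimately show ?thesis by (simp only:)
      qed
      also have "ennreal (2 * 5 ^ ?N * t * l powr (t - 2)) * (\<integral>\<^sup>+y. ?wl l y \<partial>lborel) = (\<integral>\<^sup>+y. ennreal (2 * 5 ^ ?N * t * l powr (t - 2)) * ?wl l y \<partial>lborel)"
        by (rule nn_integral_cmult[symmetric]) measurable
      also have "\<dots> \<le> (\<integral>\<^sup>+y. ennreal (w y) * (ennreal (2 * 5 ^ ?N * t) * (ennreal (l powr (t - 2)) * indicator {l. 0 \<le> l \<and> l \<le> 2 * w y} l)) \<partial>lborel)"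
      proof (rule nn_integral_mono)
        fix y
        have "ennreal (2 * 5 ^ ?N * t * l powr (t - 2)) = ennreal (2 * 5 ^ ?N * t) * ennreal (l powr (t - 2))"
          using t by (intro ennreal_mult) auto
        moreover have "indicator {y. ennreal (l / 2) < ennreal (w y)} y \<le> (indicator {l. 0 \<le> l \<and> l \<le> 2 * w y} l :: ennreal)"
          using l by (auto simp: indicator_def ennreal_less_iff)
        ultimately show "ennreal (2 * 5 ^ ?N * t * l powr (t - 2)) * ?wl l y \<le> ennreal (w y) * (ennreal (2 * 5 ^ ?N * t) * (ennreal (l powr (t - 2)) * indicator {l. 0 \<le> l \<and> l \<le> 2 * w y} l))"
          by (simp only: mult.assoc mult.left_commute[of _ "ennreal (w y)"]) (intro mult_left_mono; simp)
      qed
      finally show ?thesis .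
    qed
  qed
  also have "\<dots> = (\<integral>\<^sup>+y. (\<integral>\<^sup>+l. ennreal (w y) * (ennreal (2 * 5 ^ ?N * t) * (ennreal (l powr (t - 2)) * indicator {l. 0 \<le> l \<and> l \<le> 2 * w y} l)) \<partial>lborel) \<partial>lborel)"
    by (rule lborel_pair.Fubini') measurable
  also have "\<dots> = (\<integral>\<^sup>+y. ennreal (2 * 5 ^ ?N * t * (2 powr (t - 1) / (t - 1))) * epow (ennreal (w y)) t \<partial>lborel)"
  proof (rule nn_integral_cong)
    fix y
    have "(\<integral>\<^sup>+l. ennreal (w y) * (ennreal (2 * 5 ^ ?N * t) * (ennreal (l powr (t - 2)) * indicator {l. 0 \<le> l \<and> l \<le> 2 * w y} l)) \<partial>lborel) =
       ennreal (w y) * (ennreal (2 * 5 ^ ?N * t) * ennreal ((2 * w y) powr (t - 1) / (t - 1)))"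
    proof -
      have "{l. 0 \<le> l \<and> l \<le> 2 * w y} = {0..2 * w y}" by auto
      then show ?thesis
        using nn_integral_powr_0[of "t - 2" "2 * w y"] t w[of y] by (simp add: nn_integral_cmult)
    qed
    also have "\<dots> = ennreal (w y * (2 * 5 ^ ?N * t * ((2 * w y) powr (t - 1) / (t - 1))))"
      using t w[of y] by (simp add: ennreal_mult'[symmetric] del: ennreal_power)
    also have "w y * (2 * 5 ^ ?N * t * ((2 * w y) powr (t - 1) / (t - 1))) = 2 * 5 ^ ?N * t * (2 powr (t - 1) / (t - 1)) * w y powr t"
    proof -
      have "w y * w y powr (t - 1) = w y powr t" using w[of y] t by (cases "w y = 0") (auto simp: powr_mult_base)
      then show ?thesis using w[of y] by (simp add: powr_mult field_simps)
    qed
    also have "ennreal (2 * 5 ^ ?N * t * (2 powr (t - 1) / (t - 1)) * w y powr t) = ennreal (2 * 5 ^ ?N * t * (2 powr (t - 1) / (t - 1))) * epow (ennreal (w y)) t"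
      using t w[of y] by (subst ennreal_mult) (auto simp: epow_ennreal)
    finally show "(\<integral>\<^sup>+l. ennreal (w y) * (ennreal (2 * 5 ^ ?N * t) * (ennreal (l powr (t - 2)) * indicator {l. 0 \<le> l \<and> l \<le> 2 * w y} l)) \<partial>lborel) = \<dots>" .
  qed
  also have "\<dots> = ennreal (2 * 5 ^ ?N * t * (2 powr (t - 1) / (t - 1))) * (\<integral>\<^sup>+y. epow (ennreal (w y)) t \<partial>lborel)"
    by (rule nn_integral_cmult) measurable
  finally show ?thesis .
qed

section \<open>Morrey's estimate\<close>

text \<open>Truncation to a large ball gives bounded support; mollification of the truncated
  function gives continuity and enlarges the support only by the mollification radius. The bound
  \<open>d\<close> for each error is chosen to absorb the factor \<open>2 powr p\<close>.\<close>

lemma ex_Cc_approx: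
  fixes F :: "'a::euclidean_space \<Rightarrow> 'b::euclidean_space"
  assumes p: "1 \<le> p" and [measurable]: "F \<in> borel_measurable borel" and fin: "pint p F < top" and e: "0 < e"
  shows "\<exists>G R. continuous_on UNIV G \<and> (\<forall>x. x \<notin> cball 0 R \<longrightarrow> G x = 0) \<and> pint p (\<lambda>x. F x - G x) \<le> ennreal e"
proof -
  let ?c = "2 powr p :: real"
  define d where "d = e / (2 * ?c)"
  have d: "0 < d" using e by (simp add: d_def)
  let ?T = "\<lambda>n x. indicator (cball 0 (real n)) x *\<^sub>R F x"
  have "(\<lambda>n. pint p (\<lambda>x. F x - ?T n x)) \<longlonglongrightarrow> (\<integral>\<^sup>+(x::'a). 0 \<partial>lborel)"
    unfolding pint_def
  proof (rule nn_integral_dominated_convergence)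
    show "AE x in lborel. epow (ennreal (norm (F x - ?T n x))) p \<le> epow (ennreal (norm (F x))) p" for n
      using p by (auto simp: indicator_def)
    show "(\<integral>\<^sup>+x. epow (ennreal (norm (F x))) p \<partial>lborel) < \<infinity>" using fin by (simp add: pint_def)
    show "AE x in lborel. (\<lambda>n. epow (ennreal (norm (F x - ?T n x))) p) \<longlonglongrightarrow> 0"
    proof (intro AE_I2 tendsto_eventually)
      fix x :: 'a
      obtain m :: nat where "norm x \<le> real m" using real_arch_simple by blast
      then show "\<forall>\<^sub>F n in sequentially. epow (ennreal (norm (F x - ?T n x))) p = 0"
        using p by (intro eventually_sequentiallyI[of m]) (auto simp: indicator_def)
    qed
  qed measurable
  then have "\<forall>\<^sub>F n in sequentially. pint p (\<lambda>x. F x - ?T n x) < ennreal d"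
    using d by (intro order_tendstoD(2)) auto
  then obtain n where n: "pint p (\<lambda>x. F x - ?T n x) < ennreal d" by (auto simp: eventually_sequentially)
  have finT: "pint p (?T n) < top"
    using p by (intro le_less_trans[OF pint_mono fin]) (auto simp: indicator_def)
  have T_meas: "?T n \<in> borel_measurable borel" by measurable
  obtain d0 where d0: "0 < d0" "\<And>\<delta>. 0 < \<delta> \<Longrightarrow> \<delta> \<le> d0 \<Longrightarrow> pint p (\<lambda>x. mollify \<delta> (?T n) x - ?T n x) \<le> ennreal d"
    using ex_pint_mollify_small[OF p T_meas finT, of "ennreal d"] d by auto
  let ?G = "mollify d0 (?T n)"
  have lT: "locally_integrable (?T n)" by (rule locally_integrable_pint[OF p T_meas finT])
  have cont: "continuous_on UNIV ?G" by (rule continuous_mollify[OF d0(1) lT])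
  then have [measurable]: "?G \<in> borel_measurable borel" by (rule borel_measurable_continuous_onI)
  have supp: "?G x = 0" if x: "x \<notin> cball 0 (real n + d0)" for x
  proof -
    have "mollifier d0 (x - y) *\<^sub>R ?T n y = 0" for y
    proof (cases "y \<in> cball 0 (real n)")
      case True
      then have "d0 \<le> norm (x - y)" using x norm_triangle_ineq2[of x y] by auto
      then show ?thesis by (simp add: mollifier_eq_0[OF d0(1)])
    qed simp
    then show ?thesis unfolding mollify_def by (simp only: Bochner_Integration.integral_zero)
  qed
  have "pint p (\<lambda>x. F x - ?G x) = pint p (\<lambda>x. (F x - ?T n x) - (?G x - ?T n x))" by simp
  also have "\<dots> \<le> ennreal ?c * (pint p (\<lambda>x. F x - ?T n x) + pint p (\<lambda>x. ?G x - ?T n x))"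
    using p by (intro pint_diff) auto
  also have "\<dots> \<le> ennreal ?c * (ennreal d + ennreal d)"
    using n d0 by (intro mult_left_mono add_mono) auto
  also have "\<dots> = ennreal e"
    using d by (simp add: ennreal_plus[symmetric] ennreal_mult'[symmetric] d_def del: ennreal_plus)
  finally show ?thesis using cont supp by blast
qed

section \<open>Morrey's inequality for smooth functions and for Sobolev functions\<close>

lemma nn_integral_affine:
  fixes F :: "'a::euclidean_space \<Rightarrow> ennreal"
  assumes [measurable]: "F \<in> borel_measurable borel" and t: "0 < t"
  shows "(\<integral>\<^sup>+x. F x \<partial>lborel) = ennreal (t ^ DIM('a)) * (\<integral>\<^sup>+x. F (c + t *\<^sub>R x) \<partial>lborel)"
proof -
  have "(\<integral>\<^sup>+x. F x \<partial>lborel) = (\<integral>\<^sup>+x. F x \<partial>density (distr lborel borel (\<lambda>x. c + t *\<^sub>R x)) (\<lambda>_. ennreal (\<bar>t\<bar> ^ DIM('a))))"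
    using lborel_affine[of t c] t by simp
  also have "\<dots> = ennreal (t ^ DIM('a)) * (\<integral>\<^sup>+x. F (c + t *\<^sub>R x) \<partial>lborel)"
    using t by (simp add: nn_integral_density nn_integral_distr nn_integral_cmult)
  finally show ?thesis .
qed

text \<open>Increments are integrated along segments from \<open>y\<close>. For fixed
  \<open>t\<close> the contraction towards \<open>y\<close> maps the ball into itself by convexity
  and has Jacobian \<open>t ^ N\<close>, so Jensen's inequality with exponent \<open>s\<close>
  yields the factor \<open>t powr (- (N / s))\<close>. It is integrable at 0 because
  \<open>s > N\<close>, with integral \<open>1 / (1 - N / s)\<close>; the length of the segments is
  at most \<open>2 * r\<close>.\<close>

lemma morrey_average:
  fixes u :: "'a::euclidean_space \<Rightarrow> real"
  assumes u: "has_gradient u g" and s: "real DIM('a) < s" and r: "0 < r" and y: "y \<in> ball x r"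
  defines "c \<equiv> 1 / (unit_ball_vol (real DIM('a)) * r ^ DIM('a))"
  shows "(\<integral>\<^sup>+z. ennreal \<bar>u z - u y - a \<bullet> (z - y)\<bar> * (ennreal c * indicator (ball x r) z) \<partial>lborel) \<le>
    ennreal (2 * r / (1 - real DIM('a) / s)) * epow (ennreal c * (\<integral>\<^sup>+z\<in>ball x r. epow (ennreal (norm (g z - a))) s \<partial>lborel)) (1 / s)"
proof -
  note [measurable] = has_gradient_measurable[OF u]
  let ?N = "DIM('a)"
  have s1: "1 < s" using s DIM_positive[where 'a='a] by linarith
  let ?k = "\<lambda>z. ennreal c * indicator (ball x r) z"
  have k1: "(\<integral>\<^sup>+z. ?k z \<partial>lborel) = 1" unfolding c_def by (rule nn_integral_ball_weight[OF r])
  define Q where "Q = ennreal c * (\<integral>\<^sup>+z\<in>ball x r. epow (ennreal (norm (g z - a))) s \<partial>lborel)"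
  have inner: "(\<integral>\<^sup>+z. ennreal (norm (g (y + t *\<^sub>R (z - y)) - a)) * ?k z \<partial>lborel) \<le> ennreal (t powr (- (real ?N / s))) * epow Q (1 / s)"
    if t: "0 < t" "t \<le> 1" for t
  proof -
    let ?H = "\<lambda>w. epow (ennreal (norm (g w - a))) s * indicator (ball x r) w"
    have "epow (\<integral>\<^sup>+z. ennreal (norm (g (y + t *\<^sub>R (z - y)) - a)) * ?k z \<partial>lborel) s \<le>
      epow (\<integral>\<^sup>+z. ?k z \<partial>lborel) (s - 1) * (\<integral>\<^sup>+z. epow (ennreal (norm (g (y + t *\<^sub>R (z - y)) - a))) s * ?k z \<partial>lborel)"
      using s1 by (intro nn_integral_Jensen) auto
    also have "\<dots> \<le> (\<integral>\<^sup>+z. ennreal c * ?H ((1 - t) *\<^sub>R y + t *\<^sub>R z) \<partial>lborel)"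
      unfolding k1 epow_one mult_1_left
    proof (rule nn_integral_mono)
      fix z
      have e: "y + t *\<^sub>R (z - y) = (1 - t) *\<^sub>R y + t *\<^sub>R z" by (simp add: algebra_simps)
      have "z \<in> ball x r \<Longrightarrow> (1 - t) *\<^sub>R y + t *\<^sub>R z \<in> ball x r"
        using t y convex_ball[of x r] by (intro convexD) auto
      then show "epow (ennreal (norm (g (y + t *\<^sub>R (z - y)) - a))) s * ?k z \<le> ennreal c * ?H ((1 - t) *\<^sub>R y + t *\<^sub>R z)"
        unfolding e by (auto simp: indicator_def mult_ac)
    qed
    also have "\<dots> = ennreal c * (\<integral>\<^sup>+z. ?H ((1 - t) *\<^sub>R y + t *\<^sub>R z) \<partial>lborel)"
      by (rule nn_integral_cmult) measurable
    also have "\<dots> = ennreal (1 / t ^ ?N) * Q"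
    proof -
      have "Q = ennreal c * (ennreal (t ^ ?N) * (\<integral>\<^sup>+z. ?H ((1 - t) *\<^sub>R y + t *\<^sub>R z) \<partial>lborel))"
        unfolding Q_def by (subst nn_integral_affine[OF _ t(1), of _ "(1 - t) *\<^sub>R y"]) auto
      then have "ennreal (1 / t ^ ?N) * Q = (ennreal (1 / t ^ ?N) * ennreal (t ^ ?N)) * (ennreal c * (\<integral>\<^sup>+z. ?H ((1 - t) *\<^sub>R y + t *\<^sub>R z) \<partial>lborel))"
        by (simp only: mult_ac)
      also have "ennreal (1 / t ^ ?N) * ennreal (t ^ ?N) = 1" using t by (simp add: ennreal_mult'[symmetric] del: ennreal_power)
      finally show ?thesis by simp
    qed
    finally have "(\<integral>\<^sup>+z. ennreal (norm (g (y + t *\<^sub>R (z - y)) - a)) * ?k z \<partial>lborel) \<le> epow (ennreal (1 / t ^ ?N) * Q) (1 / s)"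
      using s1 by (subst (asm) epow_le_iff) auto
    also have "\<dots> = ennreal ((1 / t ^ ?N) powr (1 / s)) * epow Q (1 / s)"
      using s1 t by (simp add: epow_mult epow_ennreal_pos)
    also have "(1 / t ^ ?N) powr (1 / s) = t powr (- (real ?N / s))"
    proof -
      have "1 / t ^ ?N = t powr (- real ?N)" using t by (simp add: powr_minus powr_realpow field_simps)
      then show ?thesis by (simp add: powr_powr)
    qed
    finally show ?thesis .
  qed
  have "(\<integral>\<^sup>+z. ennreal \<bar>u z - u y - a \<bullet> (z - y)\<bar> * ?k z \<partial>lborel) \<le>
     (\<integral>\<^sup>+z. (\<integral>\<^sup>+t. ennreal (2 * r) * indicator {0..1} t * (ennreal (norm (g (y + t *\<^sub>R (z - y)) - a)) * ?k z) \<partial>lborel) \<partial>lborel)"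
  proof (rule nn_integral_mono)
    fix z
    show "ennreal \<bar>u z - u y - a \<bullet> (z - y)\<bar> * ?k z \<le>
      (\<integral>\<^sup>+t. ennreal (2 * r) * indicator {0..1} t * (ennreal (norm (g (y + t *\<^sub>R (z - y)) - a)) * ?k z) \<partial>lborel)"
    proof (cases "z \<in> ball x r")
      case True
      have "norm (z - y) \<le> 2 * r"
        using dist_triangle[of z y x] True y by (simp add: dist_norm norm_minus_commute)
      have "ennreal \<bar>u z - u y - a \<bullet> (z - y)\<bar> \<le> (\<integral>\<^sup>+t. ennreal (norm (z - y)) * ennreal (norm (g (y + t *\<^sub>R (z - y)) - a)) * indicator {0..1} t \<partial>lborel)"
        using has_gradient_remainder_le[OF u, of y "z - y" a] by simp
      also have "\<dots> \<le> (\<integral>\<^sup>+t. ennreal (2 * r) * ennreal (norm (g (y + t *\<^sub>R (z - y)) - a)) * indicator {0..1} t \<partial>lborel)"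
        using \<open>norm (z - y) \<le> 2 * r\<close> by (intro nn_integral_mono mult_right_mono ennreal_leI) auto
      finally have "ennreal \<bar>u z - u y - a \<bullet> (z - y)\<bar> * ?k z \<le> (\<integral>\<^sup>+t. ennreal (2 * r) * ennreal (norm (g (y + t *\<^sub>R (z - y)) - a)) * indicator {0..1} t \<partial>lborel) * ?k z"
        by (intro mult_right_mono) auto
      also have "\<dots> = (\<integral>\<^sup>+t. ennreal (2 * r) * ennreal (norm (g (y + t *\<^sub>R (z - y)) - a)) * indicator {0..1} t * ?k z \<partial>lborel)"
        by (rule nn_integral_multc[symmetric]) measurable
      finally show ?thesis by (simp only: mult_ac)
    qed simp
  qed
  also have "\<dots> = (\<integral>\<^sup>+t. (\<integral>\<^sup>+z. ennreal (2 * r) * indicator {0..1} t * (ennreal (norm (g (y + t *\<^sub>R (z - y)) - a)) * ?k z) \<partial>lborel) \<partial>lborel)"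
    by (rule lborel_pair.Fubini') measurable
  also have "\<dots> = (\<integral>\<^sup>+t. ennreal (2 * r) * indicator {0..1} t * (\<integral>\<^sup>+z. ennreal (norm (g (y + t *\<^sub>R (z - y)) - a)) * ?k z \<partial>lborel) \<partial>lborel)"
    by (intro nn_integral_cong nn_integral_cmult) measurable
  also have "\<dots> \<le> (\<integral>\<^sup>+t. (ennreal (2 * r) * epow Q (1 / s)) * (ennreal (t powr (- (real ?N / s))) * indicator {0..1} t) \<partial>lborel)"
  proof (rule nn_integral_mono_AE)
    \<comment> \<open>At \<open>t = 0\<close> the default value \<open>0 powr b = 0\<close> would
      make the right-hand side 0, so this point is discarded.\<close>
    show "AE t in lborel. ennreal (2 * r) * indicator {0..1} t * (\<integral>\<^sup>+z. ennreal (norm (g (y + t *\<^sub>R (z - y)) - a)) * ?k z \<partial>lborel) \<le>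
      (ennreal (2 * r) * epow Q (1 / s)) * (ennreal (t powr (- (real ?N / s))) * indicator {0..1} t)"
      using AE_lborel_singleton[of 0]
    proof eventually_elim
      case (elim t)
      show ?case
      proof (cases "t \<in> {0..1}")
        case True
        then have t: "0 < t" "t \<le> 1" using elim by auto
        from mult_left_mono[OF inner[OF t], of "ennreal (2 * r)"] True show ?thesis by (simp add: mult_ac)
      qed simp
    qed
  qed
  also have "\<dots> = (ennreal (2 * r) * epow Q (1 / s)) * (\<integral>\<^sup>+t. ennreal (t powr (- (real ?N / s))) * indicator {0..1} t \<partial>lborel)"
    by (rule nn_integral_cmult) measurable
  also have "(\<integral>\<^sup>+t. ennreal (t powr (- (real ?N / s))) * indicator {0..1::real} t \<partial>lborel) = ennreal (1 / (1 - real ?N / s))"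
  proof -
    have "-1 < - (real ?N / s)" using s s1 by (simp add: field_simps)
    then show ?thesis using nn_integral_powr_0[of "- (real ?N / s)" 1] by (simp add: algebra_simps)
  qed
  also have "ennreal (2 * r) * epow Q (1 / s) * ennreal (1 / (1 - real ?N / s)) = ennreal (2 * r / (1 - real ?N / s)) * epow Q (1 / s)"
  proof -
    have "ennreal (2 * r) * ennreal (1 / (1 - real ?N / s)) = ennreal (2 * r / (1 - real ?N / s))"
      using r by (subst ennreal_mult'[symmetric]) auto
    then show ?thesis by (simp only: mult.assoc mult.commute[of "epow Q (1 / s)"]) (simp only: mult.assoc[symmetric])
  qed
  finally show ?thesis unfolding Q_def .
qed

text \<open>Both \<open>x\<close> and \<open>y\<close> are compared with an average over
  \<open>z\<close> in the ball; each comparison costs a factor \<open>2 * r\<close>, whence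
  \<open>4 * r\<close>.\<close>

lemma morrey:
  fixes u :: "'a::euclidean_space \<Rightarrow> real"
  assumes u: "has_gradient u g" and s: "real DIM('a) < s" and r: "0 < r" and y: "y \<in> ball x r"
  defines "c \<equiv> 1 / (unit_ball_vol (real DIM('a)) * r ^ DIM('a))"
  shows "epow (ennreal \<bar>u y - u x - a \<bullet> (y - x)\<bar>) s \<le>
    ennreal ((4 * r / (1 - real DIM('a) / s)) powr s) * (ennreal c * (\<integral>\<^sup>+z\<in>ball x r. epow (ennreal (norm (g z - a))) s \<partial>lborel))"
proof -
  note [measurable] = has_gradient_measurable[OF u]
  let ?N = "DIM('a)"
  have s1: "1 < s" using s DIM_positive[where 'a='a] by linarith
  let ?k = "\<lambda>z. ennreal c * indicator (ball x r) z"
  have k1: "(\<integral>\<^sup>+z. ?k z \<partial>lborel) = 1" unfolding c_def by (rule nn_integral_ball_weight[OF r])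
  define Q where "Q = ennreal c * (\<integral>\<^sup>+z\<in>ball x r. epow (ennreal (norm (g z - a))) s \<partial>lborel)"
  let ?K = "2 * r / (1 - real ?N / s)"
  have K: "0 \<le> ?K" using r s s1 by (simp add: field_simps)
  have "ennreal \<bar>u y - u x - a \<bullet> (y - x)\<bar> = (\<integral>\<^sup>+z. ennreal \<bar>u y - u x - a \<bullet> (y - x)\<bar> * ?k z \<partial>lborel)"
    by (subst nn_integral_cmult) (simp_all add: k1)
  also have "\<dots> \<le> (\<integral>\<^sup>+z. ennreal \<bar>u z - u x - a \<bullet> (z - x)\<bar> * ?k z + ennreal \<bar>u z - u y - a \<bullet> (z - y)\<bar> * ?k z \<partial>lborel)"
    unfolding distrib_right[symmetric]
    by (intro nn_integral_mono mult_right_mono) (auto simp: ennreal_plus[symmetric] inner_diff_right simp del: ennreal_plus intro!: ennreal_leI)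
  also have "\<dots> = (\<integral>\<^sup>+z. ennreal \<bar>u z - u x - a \<bullet> (z - x)\<bar> * ?k z \<partial>lborel) + (\<integral>\<^sup>+z. ennreal \<bar>u z - u y - a \<bullet> (z - y)\<bar> * ?k z \<partial>lborel)"
    by (rule nn_integral_add) measurable
  also have "\<dots> \<le> ennreal ?K * epow Q (1/s) + ennreal ?K * epow Q (1/s)"
    unfolding Q_def c_def by (intro add_mono morrey_average[OF u s r] y) (use r in auto)
  also have "\<dots> = ennreal (4 * r / (1 - real ?N / s)) * epow Q (1/s)"
    using K by (simp add: distrib_right[symmetric] ennreal_plus[symmetric] del: ennreal_plus)
  finally have "epow (ennreal \<bar>u y - u x - a \<bullet> (y - x)\<bar>) s \<le> epow (ennreal (4 * r / (1 - real ?N / s)) * epow Q (1/s)) s"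
    using s1 by (intro epow_mono) auto
  also have "\<dots> = ennreal ((4 * r / (1 - real ?N / s)) powr s) * Q"
    using s1 K r by (simp add: epow_mult epow_epow epow_ennreal)
  finally show ?thesis unfolding Q_def .
qed

text \<open>\<open>P\<close> singles out the points at which the smooth approximations converge. The
  inequality holds for all pairs of such points, so the exceptional set depends neither on the pair
  nor on \<open>a\<close> and \<open>r\<close>.\<close>

lemma morrey_sobolev:
  fixes f :: "'a::euclidean_space \<Rightarrow> real"
  assumes p: "1 \<le> p" and s: "real DIM('a) < s" "s \<le> p" and fv: "sobolev_pair p f v"
  obtains P where "AE x in lborel. P x"
    "\<And>x y a r. P x \<Longrightarrow> P y \<Longrightarrow> 0 < r \<Longrightarrow> y \<in> ball x r \<Longrightarrow> epow (ennreal \<bar>f y - f x - a \<bullet> (y - x)\<bar>) s \<le>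
    ennreal ((4 * r / (1 - real DIM('a) / s)) powr s) * (ennreal (2 powr s) * (ennreal (1 / (unit_ball_vol (real DIM('a)) * r ^ DIM('a))) *
      (\<integral>\<^sup>+z\<in>ball x r. epow (ennreal (norm (v z - a))) s \<partial>lborel)))"
proof -
  note D = sobolev_pairD[OF fv]
  note [measurable] = D(1,2)
  obtain F V where FV: "\<And>n::nat. has_gradient (F n) (V n)"
    "\<And>n. pint p (\<lambda>x. F n x - f x) \<le> ennreal ((1/2) ^ n)" "\<And>n. pint p (\<lambda>x. V n x - v x) \<le> ennreal ((1/2) ^ n)"
    "AE x in lborel. (\<lambda>n. F n x) \<longlonglongrightarrow> f x" "AE x in lborel. (\<lambda>n. V n x) \<longlonglongrightarrow> v x"
    using sobolev_approximation[OF p D] by blast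
  have [measurable]: "F n \<in> borel_measurable borel" "V n \<in> borel_measurable borel" for n
    using has_gradient_measurable[OF FV(1)] by auto
  have s1: "1 < s" using s DIM_positive[where 'a='a] by linarith
  show ?thesis
  proof (rule that[OF FV(4)])
    fix x y a :: 'a and r :: real
    assume x: "(\<lambda>n. F n x) \<longlonglongrightarrow> f x" and y: "(\<lambda>n. F n y) \<longlonglongrightarrow> f y" and r: "0 < r" "y \<in> ball x r"
    let ?K = "ennreal ((4 * r / (1 - real DIM('a) / s)) powr s)" and ?c = "ennreal (1 / (unit_ball_vol (real DIM('a)) * r ^ DIM('a)))"
    let ?I = "\<lambda>u. \<integral>\<^sup>+z\<in>ball x r. epow (ennreal (norm (u z))) s \<partial>lborel"
    let ?W = "emeasure lborel (ball x r)"
    \<comment> \<open>Hoelder's inequality on the ball turns the error in \<open>L^p\<close> into an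
      error with exponent \<open>s\<close>.\<close>
    define e where "e n = epow (ennreal ((1/2) ^ n)) (s / p) * epow ?W (1 - s / p)" for n :: nat
    have e: "e \<longlonglongrightarrow> 0"
    proof -
      have "(\<lambda>n. epow ?W (1 - s / p) * epow (ennreal ((1/2) ^ n)) (s / p)) \<longlonglongrightarrow> epow ?W (1 - s / p) * epow 0 (s / p)"
      proof (intro ennreal_tendsto_cmult tendsto_epow tendsto_half_power_ennreal)
        have "?W = ennreal (unit_ball_vol (real DIM('a)) * r ^ DIM('a))" using r by (simp add: emeasure_lborel_ball)
        moreover have "0 < unit_ball_vol (real DIM('a)) * r ^ DIM('a)" using r by simp
        ultimately show "epow ?W (1 - s / p) < top" by (simp only: epow_ennreal_pos) simp
      qed (use s s1 in auto)
      then show ?thesis using s s1 by (simp add: e_def[abs_def] mult.commute)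
    qed
    have en: "?I (\<lambda>z. V n z - v z) \<le> e n" for n
    proof -
      \<comment> \<open>For \<open>s = p\<close> the last exponent is 0 and
        \<open>epow 0 0 = 1\<close>, so the indicator would no longer restrict to the ball; that
        case is treated separately.\<close>
      have "?I (\<lambda>z. V n z - v z) = (\<integral>\<^sup>+z. epow (epow (ennreal (norm (V n z - v z))) p) (s / p) * epow (indicator (ball x r) z) (1 - s / p) \<partial>lborel)" if "s < p"
        using that s1 by (intro nn_integral_cong) (auto simp: indicator_def epow_epow)
      moreover have "\<dots> \<le> epow (pint p (\<lambda>z. V n z - v z)) (s / p) * epow (\<integral>\<^sup>+z. indicator (ball x r) z \<partial>lborel) (1 - s / p)"
        unfolding pint_def using s s1 by (intro nn_integral_Holder2) auto
      moreover have "\<dots> \<le> e n"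
        unfolding e_def using FV(3)[of n] s s1 by (intro mult_mono epow_mono) auto
      moreover have "?I (\<lambda>z. V n z - v z) \<le> e n" if "s = p"
      proof -
        have "?I (\<lambda>z. V n z - v z) \<le> pint p (\<lambda>z. V n z - v z)"
          unfolding pint_def using that by (intro nn_integral_mono) (auto simp: indicator_def)
        then show ?thesis using FV(3)[of n] that s1 by (simp add: e_def)
      qed
      ultimately show ?thesis using s(2) by (cases "s = p") (auto intro: order_trans)
    qed
    have le: "epow (ennreal \<bar>F n y - F n x - a \<bullet> (y - x)\<bar>) s \<le> ?K * (?c * (ennreal (2 powr s) * (e n + ?I (\<lambda>z. v z - a))))" for n
    proof -
      have "?I (\<lambda>z. V n z - a) \<le> (\<integral>\<^sup>+z. ennreal (2 powr s) * (epow (ennreal (norm (V n z - v z))) s * indicator (ball x r) z + epow (ennreal (norm (v z - a))) s * indicator (ball x r) z) \<partial>lborel)"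
      proof (rule nn_integral_mono)
        fix z show "epow (ennreal (norm (V n z - a))) s * indicator (ball x r) z \<le>
          ennreal (2 powr s) * (epow (ennreal (norm (V n z - v z))) s * indicator (ball x r) z + epow (ennreal (norm (v z - a))) s * indicator (ball x r) z)"
          using epow_norm_add[of s "V n z - v z" "v z - a"] s1 by (auto simp: indicator_def)
      qed
      also have "\<dots> = ennreal (2 powr s) * (?I (\<lambda>z. V n z - v z) + ?I (\<lambda>z. v z - a))"
        by (simp add: nn_integral_cmult nn_integral_add)
      also have "\<dots> \<le> ennreal (2 powr s) * (e n + ?I (\<lambda>z. v z - a))"
        by (intro mult_left_mono add_right_mono en) auto
      finally have "?I (\<lambda>z. V n z - a) \<le> ennreal (2 powr s) * (e n + ?I (\<lambda>z. v z - a))" .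
      then show ?thesis
        by (intro order_trans[OF morrey[OF FV(1) s(1) r]] mult_left_mono) auto
    qed
    have lim1: "(\<lambda>n. epow (ennreal \<bar>F n y - F n x - a \<bullet> (y - x)\<bar>) s) \<longlonglongrightarrow> epow (ennreal \<bar>f y - f x - a \<bullet> (y - x)\<bar>) s"
      using s1 by (intro tendsto_epow tendsto_ennrealI tendsto_intros x y) auto
    have lim2: "(\<lambda>n. ?K * (?c * (ennreal (2 powr s) * (e n + ?I (\<lambda>z. v z - a))))) \<longlonglongrightarrow> ?K * (?c * (ennreal (2 powr s) * (0 + ?I (\<lambda>z. v z - a))))"
      by (intro ennreal_tendsto_cmult tendsto_add e tendsto_const) auto
    have "epow (ennreal \<bar>f y - f x - a \<bullet> (y - x)\<bar>) s \<le> ?K * (?c * (ennreal (2 powr s) * (0 + ?I (\<lambda>z. v z - a))))"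
      by (rule LIMSEQ_le[OF lim1 lim2]) (use le in blast)
    then show "epow (ennreal \<bar>f y - f x - a \<bullet> (y - x)\<bar>) s \<le> ?K * (ennreal (2 powr s) * (?c * ?I (\<lambda>z. v z - a)))"
      by (simp only: mult.left_commute[of ?c] add_0)
  qed
qed

text \<open>The subtracted value is taken at the centre itself. Hence this is not the maximal
  function of one fixed function, and the maximal inequality does not apply to it directly.\<close>

definition oscillation :: "real \<Rightarrow> ('a::euclidean_space \<Rightarrow> 'b::euclidean_space) \<Rightarrow> real \<Rightarrow> 'a \<Rightarrow> ennreal" where
  "oscillation s v r x = maxfun r (\<lambda>y. epow (ennreal (norm (v y - v x))) s) x"

lemma measurable_oscillation [measurable]:
  assumes [measurable]: "v \<in> borel_measurable borel" shows "oscillation s v r \<in> borel_measurable borel"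
  unfolding oscillation_def[abs_def] maxfun_def by measurable

text \<open>The centre \<open>x\<close> is fixed and the comparison is made only on the ball around
  it, so \<open>u\<close>, \<open>w\<close> and \<open>b\<close> may depend on \<open>x\<close>, as
  they must for \<open>oscillation\<close>.\<close>

lemma maxfun_le_add:
  fixes u w :: "'a::euclidean_space \<Rightarrow> ennreal"
  assumes [measurable]: "u \<in> borel_measurable borel" "w \<in> borel_measurable borel" and r: "0 < r"
    and le: "\<And>h. h \<in> ball 0 r \<Longrightarrow> u (x + h) \<le> K * (w (x + h) + b)"
  shows "maxfun r u x \<le> K * (maxfun r w x + b)"
  unfolding maxfun_def
proof (rule SUP_least)
  fix k :: nat
  let ?N = "DIM('a)" and ?B = "ball (0::'a) (r / 2 ^ k)"
  define V where "V = unit_ball_vol (real ?N)"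
  have V: "0 < V" by (simp add: V_def)
  define c where "c = V * (r / 2 ^ k) ^ ?N"
  have c: "0 < c" using V r by (simp add: c_def)
  have B: "?B \<subseteq> ball 0 r" using r by (intro subset_ball) (auto simp: field_simps)
  have "(\<integral>\<^sup>+h\<in>?B. u (x + h) \<partial>lborel) \<le> (\<integral>\<^sup>+h. K * (w (x + h) * indicator ?B h + b * indicator ?B h) \<partial>lborel)"
    using le B by (intro nn_integral_mono) (auto simp: indicator_def)
  also have "\<dots> = K * ((\<integral>\<^sup>+h\<in>?B. w (x + h) \<partial>lborel) + b * emeasure lborel ?B)"
    by (simp add: nn_integral_cmult nn_integral_add nn_integral_cmult_indicator)
  also have "emeasure lborel ?B = ennreal c" using r by (simp add: emeasure_lborel_ball c_def V_def)
  finally have "ennreal (1 / c) * (\<integral>\<^sup>+h\<in>?B. u (x + h) \<partial>lborel) \<le>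
      ennreal (1 / c) * (K * ((\<integral>\<^sup>+h\<in>?B. w (x + h) \<partial>lborel) + b * ennreal c))"
    by (intro mult_left_mono) auto
  also have "\<dots> = K * (ennreal (1 / c) * (\<integral>\<^sup>+h\<in>?B. w (x + h) \<partial>lborel) + b * (ennreal (1 / c) * ennreal c))"
    by (simp only: distrib_left mult_ac)
  also have "ennreal (1 / c) * ennreal c = 1" using c by (simp add: ennreal_mult'[symmetric])
  also have "K * (ennreal (1 / c) * (\<integral>\<^sup>+h\<in>?B. w (x + h) \<partial>lborel) + b * 1) \<le>
     K * ((SUP k. ennreal (1 / (V * (r / 2 ^ k) ^ ?N)) * (\<integral>\<^sup>+h\<in>ball 0 (r / 2 ^ k). w (x + h) \<partial>lborel)) + b)"
    unfolding c_def mult_1_right by (intro mult_left_mono add_right_mono SUP_upper) auto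
  finally show "ennreal (1 / (unit_ball_vol (real ?N) * (r / 2 ^ k) ^ ?N)) * (\<integral>\<^sup>+h\<in>?B. u (x + h) \<partial>lborel) \<le>
     K * ((SUP k. ennreal (1 / (unit_ball_vol (real ?N) * (r / 2 ^ k) ^ ?N)) * (\<integral>\<^sup>+h\<in>ball 0 (r / 2 ^ k). w (x + h) \<partial>lborel)) + b)"
    unfolding c_def V_def .
qed

text \<open>The indicator keeps the bound integrable to every power: a shift shorter than 1 cannot
  lead from outside the ball of radius \<open>R + 1\<close> into the support.\<close>

lemma uniformly_small_increment:
  fixes g :: "'a::euclidean_space \<Rightarrow> 'b::euclidean_space"
  assumes g: "continuous_on UNIV g" and z: "\<And>x. x \<notin> cball 0 R \<Longrightarrow> g x = 0" and e: "0 < e"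
  shows "\<exists>d>0. d \<le> 1 \<and> (\<forall>x h. norm h < d \<longrightarrow> norm (g (x + h) - g x) \<le> e * indicator (cball 0 (R + 1)) x)"
proof -
  have "uniformly_continuous_on (cball 0 (R + 2)) g"
    using g by (intro compact_uniformly_continuous) (auto intro: continuous_on_subset)
  then obtain d where d: "0 < d" "\<And>x y. x \<in> cball 0 (R + 2) \<Longrightarrow> y \<in> cball 0 (R + 2) \<Longrightarrow> dist y x < d \<Longrightarrow> dist (g y) (g x) < e"
    using e unfolding uniformly_continuous_on_def by metis
  show ?thesis
  proof (intro exI[of _ "min d 1"] conjI allI impI)
    fix x h :: 'a assume h: "norm h < min d 1"
    show "norm (g (x + h) - g x) \<le> e * indicator (cball 0 (R + 1)) x"
    proof (cases "x \<in> cball 0 (R + 1)")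
      case True
      then have "x + h \<in> cball 0 (R + 2)" using h norm_triangle_ineq[of x h] by auto
      then show ?thesis using True h d(2)[of x "x + h"] by (auto simp: dist_norm)
    next
      case False
      then have "x + h \<notin> cball 0 R" "x \<notin> cball 0 R" using h norm_triangle_ineq2[of x "- h"] by auto
      then show ?thesis using z False by simp
    qed
  qed (use d in auto)
qed

text \<open>The part \<open>v - G\<close> is small in \<open>L^p\<close> and is treated, uniformly
  in the radius, by the maximal inequality with exponent \<open>p / s\<close> for the s-th power of
  its norm. The increments of the continuous part \<open>G\<close> are uniformly small once the
  radius is small.\<close>

lemma nn_integral_oscillation_tendsto:
  fixes v :: "'a::euclidean_space \<Rightarrow> 'b::euclidean_space"
  assumes s: "0 < s" "s < p" and p: "1 \<le> p" and [measurable]: "v \<in> borel_measurable borel" and fin: "pint p v < top"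
  shows "((\<lambda>r. \<integral>\<^sup>+x. epow (oscillation s v r x) (p / s) \<partial>lborel) \<longlongrightarrow> 0) (at_right 0)"
proof -
  let ?N = "DIM('a)"
  define t where "t = p / s"
  have t: "1 < t" "s * t = p" using s by (auto simp: t_def)
  define Ct where "Ct = 2 * 5 ^ ?N * t * (2 powr (t - 1) / (t - 1))"
  have Ct: "0 \<le> Ct" using t by (simp add: Ct_def)
  \<comment> \<open>\<open>A\<close> is the cost of one splitting into two summands:
    \<open>2 powr s\<close> raised to \<open>p / s\<close> is \<open>2 powr p\<close>, and the sum
    raised to \<open>t\<close> costs \<open>2 powr t\<close>. Two splittings are nested in
    \<open>K\<close>, first into \<open>v - G\<close> and \<open>G\<close>, then into the values of
    \<open>v - G\<close> at two points.\<close>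
  define A where "A = 2 powr p * 2 powr t"
  define K where "K = A * (A * (Ct + 1) + 1)"
  have A: "0 \<le> A" by (simp add: A_def)
  show ?thesis
  proof (rule tendsto_0_ennrealI[where K=K])
    fix d :: real assume d: "0 < d"
    obtain G R where G: "continuous_on UNIV G" "\<And>x. x \<notin> cball 0 R \<Longrightarrow> G x = 0" "pint p (\<lambda>x. v x - G x) \<le> ennreal d"
      using ex_Cc_approx[OF p assms(4) fin d] by blast
    have [measurable]: "G \<in> borel_measurable borel" using G(1) by (rule borel_measurable_continuous_onI)
    let ?D = "\<lambda>x. v x - G x"
    define W where "W = measure lborel (cball (0::'a) (R + 1))"
    have W: "emeasure lborel (cball (0::'a) (R + 1)) = ennreal W" "0 \<le> W"
      using emeasure_bounded_finite[of "cball (0::'a) (R + 1)"] by (auto simp: W_def emeasure_eq_ennreal_measure)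
    \<comment> \<open>Chosen so that the constant \<eta>, raised to the power \<open>p\<close> and
      integrated over a ball of measure \<open>W\<close>, gives at most \<open>d\<close>.\<close>
    define \<eta> where "\<eta> = (d / (W + 1)) powr (1 / p)"
    have \<eta>: "0 < \<eta>" "\<eta> powr p = d / (W + 1)" using d W p by (auto simp: \<eta>_def powr_powr)
    obtain r0 where r0: "0 < r0" "\<And>x h. norm h < r0 \<Longrightarrow> norm (G (x + h) - G x) \<le> \<eta> * indicator (cball 0 (R + 1)) x"
      using uniformly_small_increment[OF G(1,2) \<eta>(1)] by blast
    have "\<forall>\<^sub>F r in at_right 0. 0 < r \<and> r < r0"
      using r0(1) eventually_at_right_real[of 0 r0] by (auto elim!: eventually_mono)
    then show "\<forall>\<^sub>F r in at_right 0. (\<integral>\<^sup>+x. epow (oscillation s v r x) (p / s) \<partial>lborel) \<le> ennreal K * ennreal d"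
    proof eventually_elim
      case (elim r)
      then have r: "0 < r" "r < r0" by auto
      let ?w = "\<lambda>y. epow (ennreal (norm (?D y))) s"
      let ?c = "ennreal (2 powr s)"
      define O' where "O' x = ennreal (\<eta> powr s) * indicator (cball (0::'a) (R + 1)) x" for x
      define Z where "Z x = ?c * (maxfun r ?w x + ?w x)" for x
      have [measurable]: "O' \<in> borel_measurable borel" "Z \<in> borel_measurable borel" unfolding O'_def[abs_def] Z_def[abs_def] by measurable
      have osc: "oscillation s v r x \<le> ?c * (Z x + O' x)" for x
      proof -
        have "maxfun r (\<lambda>y. epow (ennreal (norm (?D y - ?D x))) s) x \<le> Z x"
          unfolding Z_def
        proof (rule maxfun_le_add)
          fix h :: 'a
          show "epow (ennreal (norm (?D (x + h) - ?D x))) s \<le> ?c * (?w (x + h) + ?w x)"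
            using epow_norm_add[of s "?D (x + h)" "- ?D x"] s by (simp only: norm_minus_cancel diff_conv_add_uminus)
        qed (use r in auto)
        moreover have "oscillation s v r x \<le> ?c * (maxfun r (\<lambda>y. epow (ennreal (norm (?D y - ?D x))) s) x + O' x)"
          unfolding oscillation_def
        proof (rule maxfun_le_add)
          fix h :: 'a assume h: "h \<in> ball 0 r"
          have "epow (ennreal (norm (G (x + h) - G x))) s \<le> epow (ennreal (\<eta> * indicator (cball 0 (R + 1)) x)) s"
            using r0(2)[of h x] h r s by (intro epow_mono ennreal_leI) auto
          also have "\<dots> = O' x" using s \<eta> by (auto simp: O'_def indicator_def epow_ennreal)
          finally have 1: "epow (ennreal (norm (G (x + h) - G x))) s \<le> O' x" .
          have "v (x + h) - v x = (?D (x + h) - ?D x) + (G (x + h) - G x)" by simp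
          then have "epow (ennreal (norm (v (x + h) - v x))) s \<le> ?c * (epow (ennreal (norm (?D (x + h) - ?D x))) s + epow (ennreal (norm (G (x + h) - G x))) s)"
            using epow_norm_add[of s "?D (x + h) - ?D x" "G (x + h) - G x"] s by (simp only:)
          also have "\<dots> \<le> ?c * (epow (ennreal (norm (?D (x + h) - ?D x))) s + O' x)"
            by (intro mult_left_mono add_left_mono 1) auto
          finally show "epow (ennreal (norm (v (x + h) - v x))) s \<le> \<dots>" .
        qed (use r in auto)
        ultimately show ?thesis by (meson add_right_mono mult_left_mono order_trans zero_le)
      qed
      have pw: "epow (?c * (a + b)) t \<le> ennreal A * (epow a t + epow b t)" for a b
      proof -
        have "epow (?c * (a + b)) t = ennreal (2 powr p) * epow (a + b) t"
          using t s by (simp add: epow_mult epow_ennreal powr_powr)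
        also have "\<dots> \<le> ennreal (2 powr p) * (ennreal (2 powr t) * (epow a t + epow b t))"
          using t by (intro mult_left_mono epow_double_add) auto
        finally show ?thesis by (simp add: A_def ennreal_mult mult.assoc)
      qed
      have wt: "epow (?w x) t = epow (ennreal (norm (?D x))) p" for x
        using s t by (simp add: epow_epow)
      have w_eq: "?w = (\<lambda>y. ennreal (norm (?D y) powr s))" using s by (simp add: epow_ennreal)
      have M: "(\<integral>\<^sup>+x. epow (maxfun r ?w x) t \<partial>lborel) \<le> ennreal Ct * ennreal d"
      proof -
        have "(\<integral>\<^sup>+x. epow (maxfun r ?w x) t \<partial>lborel) \<le> ennreal Ct * (\<integral>\<^sup>+x. epow (ennreal (norm (?D x) powr s)) t \<partial>lborel)"
          unfolding w_eq Ct_def by (intro maxfun_strong t r) auto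
        also have "(\<integral>\<^sup>+x. epow (ennreal (norm (?D x) powr s)) t \<partial>lborel) = pint p ?D"
          unfolding pint_def using s t p by (intro nn_integral_cong) (simp add: epow_ennreal powr_powr)
        also have "ennreal Ct * pint p ?D \<le> ennreal Ct * ennreal d" using G(3) by (intro mult_left_mono) auto
        finally show ?thesis .
      qed
      have Zt: "(\<integral>\<^sup>+x. epow (Z x) t \<partial>lborel) \<le> ennreal (A * (Ct + 1)) * ennreal d"
      proof -
        have "(\<integral>\<^sup>+x. epow (Z x) t \<partial>lborel) \<le> (\<integral>\<^sup>+x. ennreal A * (epow (maxfun r ?w x) t + epow (?w x) t) \<partial>lborel)"
          unfolding Z_def by (intro nn_integral_mono pw)
        also have "\<dots> = ennreal A * ((\<integral>\<^sup>+x. epow (maxfun r ?w x) t \<partial>lborel) + pint p ?D)"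
          unfolding wt pint_def by (simp add: nn_integral_cmult nn_integral_add)
        also have "\<dots> \<le> ennreal A * (ennreal Ct * ennreal d + ennreal d)"
          by (intro mult_left_mono add_mono M G) auto
        also have "\<dots> = ennreal (A * (Ct + 1)) * ennreal d"
          using A Ct d by (simp add: ennreal_mult'[symmetric] ennreal_plus[symmetric] algebra_simps del: ennreal_plus)
        finally show ?thesis .
      qed
      have Ot: "(\<integral>\<^sup>+x. epow (O' x) t \<partial>lborel) \<le> ennreal d"
      proof -
        have "(\<integral>\<^sup>+x. epow (O' x) t \<partial>lborel) = (\<integral>\<^sup>+x. ennreal (\<eta> powr p) * indicator (cball (0::'a) (R + 1)) x \<partial>lborel)"
          using t \<eta> by (intro nn_integral_cong) (auto simp: O'_def indicator_def epow_ennreal powr_powr)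
        also have "\<dots> = ennreal (\<eta> powr p) * ennreal W"
          by (subst nn_integral_cmult_indicator) (auto simp: W)
        also have "\<dots> = ennreal (d / (W + 1) * W)" using W d by (simp only: \<eta>(2), subst ennreal_mult'') auto
        also have "\<dots> \<le> ennreal d" using W d by (intro ennreal_leI) (simp add: field_simps)
        finally show ?thesis .
      qed
      have "(\<integral>\<^sup>+x. epow (oscillation s v r x) t \<partial>lborel) \<le> (\<integral>\<^sup>+x. ennreal A * (epow (Z x) t + epow (O' x) t) \<partial>lborel)"
        using t by (intro nn_integral_mono order_trans[OF epow_mono[OF osc] pw]) auto
      also have "\<dots> = ennreal A * ((\<integral>\<^sup>+x. epow (Z x) t \<partial>lborel) + (\<integral>\<^sup>+x. epow (O' x) t \<partial>lborel))"
        by (simp add: nn_integral_cmult nn_integral_add)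
      also have "\<dots> \<le> ennreal A * (ennreal (A * (Ct + 1)) * ennreal d + ennreal d)"
        by (intro mult_left_mono add_mono Zt Ot) auto
      also have "\<dots> = ennreal K * ennreal d"
        using A Ct d by (simp add: K_def ennreal_mult'[symmetric] ennreal_plus[symmetric] algebra_simps del: ennreal_plus)
      finally show ?case by (simp add: t_def)
    qed
  qed
qed

text \<open>For each \<open>h\<close> Morrey's estimate is used on a dyadic ball around
  \<open>x\<close> whose radius lies between \<open>|h|\<close> and \<open>2 |h|\<close>, so
  dividing by \<open>|h|\<close> costs only a constant factor. Stating a domination by
  \<open>G\<close> for almost every \<open>h\<close>, rather than a bound for an essential supremum,
  makes the result serve finite \<open>q\<close> as well.\<close>

lemma sup_remainder:
  fixes f :: "'a::euclidean_space \<Rightarrow> real"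
  assumes p: "1 \<le> p" "real DIM('a) < p" and fv: "sobolev_pair p f v"
  shows "\<exists>G. (\<forall>\<epsilon>>0. AE x in lborel. AE h in lborel. h \<in> ball 0 \<epsilon> \<longrightarrow> epow (ennreal (\<bar>f (x + h) - f x - v x \<bullet> h\<bar> / norm h)) p \<le> G \<epsilon> x)
    \<and> ((\<lambda>\<epsilon>. \<integral>\<^sup>+x. G \<epsilon> x \<partial>lborel) \<longlongrightarrow> 0) (at_right 0)"
proof -
  let ?N = "DIM('a)"
  note D = sobolev_pairD[OF fv]
  note [measurable] = D(1,2)
  define s where "s = (real ?N + p) / 2"
  have s: "real ?N < s" "s < p" "1 < s"
  proof -
    show N: "real ?N < s" and "s < p" using p by (simp_all add: s_def)
    have "1 \<le> real ?N" by (simp add: Suc_le_eq)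
    then show "1 < s" using N by (rule le_less_trans)
  qed
  obtain P where P: "AE x in lborel. P x"
    "\<And>x y a r. P x \<Longrightarrow> P y \<Longrightarrow> 0 < r \<Longrightarrow> y \<in> ball x r \<Longrightarrow> epow (ennreal \<bar>f y - f x - a \<bullet> (y - x)\<bar>) s \<le>
    ennreal ((4 * r / (1 - real ?N / s)) powr s) * (ennreal (2 powr s) * (ennreal (1 / (unit_ball_vol (real ?N) * r ^ ?N)) *
      (\<integral>\<^sup>+z\<in>ball x r. epow (ennreal (norm (v z - a))) s \<partial>lborel)))"
    using that by (rule morrey_sobolev[OF p(1) s(1) less_imp_le[OF s(2)] fv])
  define \<kappa> where "\<kappa> = 4 / (1 - real ?N / s)"
  have \<kappa>: "0 < \<kappa>" using s by (simp add: \<kappa>_def field_simps)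
  \<comment> \<open>The factor 2 next to \<kappa> accounts for a radius of at most
    \<open>2 |h|\<close>, and \<open>2 powr s\<close> is the factor from
    \<open>morrey_sobolev\<close>.\<close>
  define K where "K = (2 * \<kappa>) powr s * 2 powr s"
  define G where "G \<epsilon> x = epow (ennreal K * oscillation s v \<epsilon> x) (p / s)" for \<epsilon> x
  show ?thesis
  proof (intro exI[of _ G] conjI allI impI)
    fix \<epsilon> :: real assume \<epsilon>: "0 < \<epsilon>"
    show "AE x in lborel. AE h in lborel. h \<in> ball 0 \<epsilon> \<longrightarrow> epow (ennreal (\<bar>f (x + h) - f x - v x \<bullet> h\<bar> / norm h)) p \<le> G \<epsilon> x"
      using P(1)
    proof eventually_elim
      case (elim x)
      \<comment> \<open>Morrey's estimate needs \<open>P\<close> at \<open>x\<close> and at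
        \<open>x + h\<close>; for fixed \<open>x\<close> the latter holds for almost every
        \<open>h\<close> by translation invariance.\<close>
      show ?case using AE_lborel_shift[OF P(1), of x]
      proof eventually_elim
        case (elim h)
        show ?case
        proof
          assume h: "h \<in> ball 0 \<epsilon>"
          show "epow (ennreal (\<bar>f (x + h) - f x - v x \<bullet> h\<bar> / norm h)) p \<le> G \<epsilon> x"
          proof (cases "h = 0")
            case True
            then show ?thesis using p by simp
          next
            case False
            let ?w = "\<bar>f (x + h) - f x - v x \<bullet> h\<bar>"
            obtain k where k: "norm h < \<epsilon> / 2 ^ k" "\<epsilon> / 2 ^ k \<le> 2 * norm h"
              using dyadic_shell[of "norm h" \<epsilon>] False h by auto
            define r where "r = \<epsilon> / 2 ^ k"
            have r: "0 < r" "norm h < r" "r \<le> 2 * norm h" using \<epsilon> k by (auto simp: r_def)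
            let ?J = "ennreal (1 / (unit_ball_vol (real ?N) * r ^ ?N)) * (\<integral>\<^sup>+z\<in>ball x r. epow (ennreal (norm (v z - v x))) s \<partial>lborel)"
            have J: "?J \<le> oscillation s v \<epsilon> x"
              unfolding oscillation_def maxfun_def
              by (subst nn_integral_ball_shift[symmetric]) (auto simp: r_def intro!: SUP_upper2[of k])
            have "epow (ennreal ?w) s \<le> ennreal ((\<kappa> * r) powr s) * (ennreal (2 powr s) * ?J)"
              using P(2)[OF \<open>P x\<close> elim r(1), of "v x"] r by (simp add: \<kappa>_def dist_norm)
            also have "\<dots> \<le> ennreal ((\<kappa> * (2 * norm h)) powr s) * (ennreal (2 powr s) * oscillation s v \<epsilon> x)"
              using s r \<kappa> by (intro mult_mono mult_left_mono J ennreal_leI powr_mono2) auto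
            finally have w: "epow (ennreal ?w) s \<le> ennreal ((\<kappa> * (2 * norm h)) powr s) * (ennreal (2 powr s) * oscillation s v \<epsilon> x)" .
            have "epow (ennreal (?w / norm h)) s = ennreal (1 / norm h powr s) * epow (ennreal ?w) s"
              using s False by (simp add: epow_ennreal powr_divide ennreal_mult'[symmetric])
            also have "\<dots> \<le> ennreal (1 / norm h powr s) * (ennreal ((\<kappa> * (2 * norm h)) powr s) * (ennreal (2 powr s) * oscillation s v \<epsilon> x))"
              by (intro mult_left_mono w) auto
            also have "\<dots> = ennreal K * oscillation s v \<epsilon> x"
            proof -
              have "1 / norm h powr s * ((\<kappa> * (2 * norm h)) powr s * 2 powr s) = K"
                using False \<kappa> by (simp add: K_def powr_mult)
              then show ?thesis
                by (simp only: mult.assoc[symmetric] ennreal_mult'[symmetric] divide_nonneg_nonneg zero_le_one powr_ge_zero mult_nonneg_nonneg)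
            qed
            finally have "epow (epow (ennreal (?w / norm h)) s) (p / s) \<le> G \<epsilon> x"
              unfolding G_def using s p by (intro epow_mono) auto
            then show ?thesis using s p by (simp add: epow_epow)
          qed
        qed
      qed
    qed
  next
    have "((\<lambda>\<epsilon>. epow (ennreal K) (p / s) * (\<integral>\<^sup>+x. epow (oscillation s v \<epsilon> x) (p / s) \<partial>lborel)) \<longlongrightarrow> epow (ennreal K) (p / s) * 0) (at_right 0)"
      using s p D by (intro ennreal_tendsto_cmult nn_integral_oscillation_tendsto) (auto simp: epow_ennreal K_def)
    then show "((\<lambda>\<epsilon>. \<integral>\<^sup>+x. G \<epsilon> x \<partial>lborel) \<longlongrightarrow> 0) (at_right 0)"
      unfolding G_def using s p by (simp add: epow_mult nn_integral_cmult)
  qed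
qed

section \<open>From the limit to the weak gradient\<close>

lemma integral_shift:
  fixes F :: "'a::euclidean_space \<Rightarrow> 'b::{banach, second_countable_topology}"
  assumes "F \<in> borel_measurable borel"
  shows "(LINT x|lborel. F (c + x)) = (LINT x|lborel. F x)"
  using integral_distr[of "(+) c" lborel borel F] assms by (simp add: lborel_distr_plus)

lemma locally_integrable_diff:
  assumes f: "locally_integrable f" and g: "locally_integrable g"
  shows "locally_integrable (\<lambda>x. f x - g x)"
proof -
  have [measurable]: "f \<in> borel_measurable borel" "g \<in> borel_measurable borel" using f g by (auto simp: locally_integrable_def)
  have "(\<integral>\<^sup>+x. ennreal (norm (f x - g x)) * indicator (cball 0 M) x \<partial>lborel) < top" for M
  proof -
    have "(\<integral>\<^sup>+x. ennreal (norm (f x - g x)) * indicator (cball 0 M) x \<partial>lborel) \<le>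
      (\<integral>\<^sup>+x. ennreal (norm (f x)) * indicator (cball 0 M) x + ennreal (norm (g x)) * indicator (cball 0 M) x \<partial>lborel)"
      unfolding distrib_right[symmetric]
      by (intro nn_integral_mono mult_right_mono) (auto simp: ennreal_plus[symmetric] norm_triangle_ineq4 simp del: ennreal_plus intro!: ennreal_leI)
    also have "\<dots> = (\<integral>\<^sup>+x. ennreal (norm (f x)) * indicator (cball 0 M) x \<partial>lborel) + (\<integral>\<^sup>+x. ennreal (norm (g x)) * indicator (cball 0 M) x \<partial>lborel)"
      by (rule nn_integral_add) measurable
    also have "\<dots> < top" using f g by (simp add: locally_integrable_def)
    finally show ?thesis .
  qed
  then show ?thesis by (simp add: locally_integrable_def)
qed

lemma linear_eq_inner:
  fixes A :: "'a::euclidean_space \<Rightarrow> real"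
  assumes "linear A" shows "A h = (\<Sum>b\<in>Basis. A b *\<^sub>R b) \<bullet> h"
proof -
  have "A h = A (\<Sum>b\<in>Basis. (h \<bullet> b) *\<^sub>R b)" by (simp add: euclidean_representation)
  also have "\<dots> = (\<Sum>b\<in>Basis. (h \<bullet> b) * A b)" using assms by (simp add: linear_sum linear_scale)
  also have "\<dots> = (\<Sum>b\<in>Basis. A b *\<^sub>R b) \<bullet> h"
    by (simp add: inner_sum_left inner_commute[of h] mult.commute)
  finally show ?thesis .
qed

text \<open>If \<open>a > d\<close>, then \<open>a\<close> is \<open>a powr (1 - p)\<close> times
  \<open>a powr p\<close>, and the first factor is at most \<open>d powr (1 - p)\<close>. This
  trades the first power for the p-th at the price of a small additive error.\<close>

lemma young_power:
  fixes a d p :: real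
  assumes "0 \<le> a" "0 < d" "1 \<le> p"
  shows "a \<le> d + d powr (1 - p) * a powr p"
proof (cases "a \<le> d")
  case True
  then show ?thesis using assms by (simp add: add_increasing2)
next
  case False
  then have "a powr (1 - p) \<le> d powr (1 - p)" using assms by (intro powr_mono2') auto
  then have "a powr (1 - p) * a powr p \<le> d powr (1 - p) * a powr p" by (intro mult_right_mono) auto
  then show ?thesis using False assms by (simp add: powr_add[symmetric])
qed

text \<open>With \<open>L h\<close> the remainder tested against \<phi>, the sum of
  \<open>L h\<close> and the inner product of \<open>w\<close> and \<open>h\<close> is the
  first-order Taylor remainder of \<Phi>. If \<open>w\<close> were nonzero,
  \<open>|L h| / |h|\<close> would be at least \<open>|w| / 2\<close> on a fixed proportion of every
  small ball, whereas \<open>young_power\<close> bounds it by \<open>|w| / 4\<close> plus a multiple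
  of \<open>g h\<close>, whose averages tend to 0.\<close>

lemma weak_gradient_of_remainder:
  fixes f :: "'a::euclidean_space \<Rightarrow> real"
  assumes p: "1 \<le> p" and fm[measurable]: "f \<in> borel_measurable borel" and vm[measurable]: "v \<in> borel_measurable borel"
    and fin: "pint p f < top" "pint p v < top"
    and lim: "((\<lambda>\<epsilon>. \<integral>\<^sup>+x. lrem p 1 f v \<epsilon> x \<partial>lborel) \<longlongrightarrow> 0) (at_right 0)"
  shows "weak_gradient f v"
  unfolding weak_gradient_def
proof (intro ballI)
  let ?N = "DIM('a)"
  fix \<phi> :: "'a \<Rightarrow> real" and b :: 'a assume \<phi>: "\<phi> \<in> test_functions" and b: "b \<in> Basis"
  have lf: "locally_integrable f" and lv: "locally_integrable v"
    using fin by (auto intro: locally_integrable_pint[OF p])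
  have \<phi>g: "has_gradient \<phi> (grad \<phi>)" by (rule test_function_gradient[OF \<phi>])
  note [measurable] = has_gradient_measurable[OF \<phi>g]
  obtain M where M: "0 < M" "\<And>x. x \<notin> cball 0 M \<Longrightarrow> \<phi> x = 0" "\<And>x. x \<notin> cball 0 M \<Longrightarrow> grad \<phi> x = 0"
    using test_function_support[OF \<phi>] by metis
  obtain B where B: "0 < B" "\<And>x. \<bar>\<phi> x\<bar> \<le> B"
    using continuous_bounded_of_support[OF has_gradient_continuous[OF \<phi>g] M(2)] by (metis real_norm_def)
  have int: "integrable lborel (\<lambda>x. \<phi> x *\<^sub>R g x)" if "locally_integrable g" for g :: "'a \<Rightarrow> 'c::euclidean_space"
    using that by (rule integrable_locally_integrable_times(1)) (use M B in auto)
  let ?R = "\<lambda>h x. f (x + h) - f x - v x \<bullet> h"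
  have lshift: "locally_integrable (\<lambda>x. f (x + h))" for h
    using fin pint_shift[OF fm, of p h] by (intro locally_integrable_pint[OF p]) auto
  have lR: "locally_integrable (?R h)" for h
    by (intro locally_integrable_diff lshift lf locally_integrable_inner lv)
  define A where "A h = (LINT y|lborel. (grad \<phi> y \<bullet> h) * f y)" for h
  define \<Phi> where "\<Phi> h = (LINT y|lborel. \<phi> (y - h) * f y)" for h
  define z where "z = (LINT x|lborel. \<phi> x *\<^sub>R v x)"
  define L where "L h = (LINT x|lborel. \<phi> x *\<^sub>R ?R h x)" for h
  have \<Phi>: "(\<Phi> has_derivative (\<lambda>h. - A h)) (at 0)"
    unfolding \<Phi>_def[abs_def] A_def by (rule convolution_has_derivative[OF lf \<phi>g M(2)])
  then have "linear (\<lambda>h. - A h)" by (rule has_derivative_linear)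
  then have "linear A" using linear_compose_neg[of "\<lambda>h. - A h"] by simp
  define w where "w = (\<Sum>b\<in>Basis. A b *\<^sub>R b) + z"
  have L_eq: "L h = \<Phi> h - \<Phi> 0 - z \<bullet> h" for h
  proof -
    have "L h = (LINT x|lborel. \<phi> x *\<^sub>R f (x + h) - \<phi> x *\<^sub>R f x - \<phi> x *\<^sub>R (v x \<bullet> h))"
      unfolding L_def by (simp add: algebra_simps)
    also have "\<dots> = (LINT x|lborel. \<phi> x *\<^sub>R f (x + h)) - (LINT x|lborel. \<phi> x *\<^sub>R f x) - (LINT x|lborel. \<phi> x *\<^sub>R (v x \<bullet> h))"
      using int[OF lshift] int[OF lf] int[OF locally_integrable_inner[OF lv]]
      by (simp add: Bochner_Integration.integral_diff)
    also have "(LINT x|lborel. \<phi> x *\<^sub>R (v x \<bullet> h)) = z \<bullet> h"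
      unfolding z_def using integral_inner_left[OF int[OF lv], of h] by simp
    also have "(LINT x|lborel. \<phi> x *\<^sub>R f (x + h)) = \<Phi> h"
      using integral_shift[of "\<lambda>y. \<phi> (y - h) * f y" h] by (simp add: \<Phi>_def add.commute)
    finally show ?thesis by (simp add: \<Phi>_def)
  qed
  have "w = 0"
  proof (rule ccontr)
    assume w: "w \<noteq> 0"
    then have w0: "0 < norm w" by simp
    from \<Phi> have "\<exists>d>0. \<forall>h. norm (h - 0) < d \<longrightarrow> norm (\<Phi> h - \<Phi> 0 - - A (h - 0)) \<le> (norm w / 10) * norm (h - 0)"
      unfolding has_derivative_at_alt using w0 by (metis divide_pos_pos zero_less_numeral)
    then obtain d where d: "0 < d" "\<And>h. norm h < d \<Longrightarrow> \<bar>\<Phi> h - \<Phi> 0 + A h\<bar> \<le> (norm w / 10) * norm h" by auto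
    have Lw: "\<bar>L h + w \<bullet> h\<bar> \<le> (norm w / 10) * norm h" if "norm h < d" for h
    proof -
      have "L h + w \<bullet> h = \<Phi> h - \<Phi> 0 + A h"
        using linear_eq_inner[OF \<open>linear A\<close>, of h] by (simp add: L_eq w_def inner_add_left)
      then show ?thesis using d(2)[OF that] by (simp only:)
    qed
    define W where "W = measure lborel (cball (0::'a) M)"
    have W: "emeasure lborel (cball (0::'a) M) = ennreal W" "0 \<le> W"
      using emeasure_bounded_finite[of "cball (0::'a) M"] by (auto simp: W_def emeasure_eq_ennreal_measure)
    \<comment> \<open>Chosen so that the additive error of \<open>young_power\<close>, integrated
      over the support ball and multiplied by the bound \<open>B\<close> of \<phi>, is at most
      \<open>|w| / 4\<close>.\<close>
    define \<delta> where "\<delta> = norm w / (4 * B * (W + 1))"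
    have \<delta>: "0 < \<delta>" using w0 B W by (simp add: \<delta>_def)
    have \<delta>W: "B * \<delta> * W \<le> norm w / 4"
    proof -
      have "B * \<delta> * W = norm w / 4 * (W / (W + 1))" using B W by (simp add: \<delta>_def)
      also have "\<dots> \<le> norm w / 4 * 1" using W w0 by (intro mult_left_mono) (auto simp: field_simps)
      finally show ?thesis by simp
    qed
    define \<beta> where "\<beta> = B * \<delta> powr (1 - p)"
    have \<beta>: "0 < \<beta>" using B \<delta> by (simp add: \<beta>_def)
    define g where "g h = (\<integral>\<^sup>+x. epow (ennreal (\<bar>?R h x\<bar> / norm h)) p \<partial>lborel)" for h
    have L_le: "ennreal (\<bar>L h\<bar> / norm h) \<le> ennreal (norm w / 4) + ennreal \<beta> * g h" if h: "h \<noteq> 0" for h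
    proof -
      let ?I = "\<integral>\<^sup>+x. ennreal (norm (?R h x)) * indicator (cball 0 M) x \<partial>lborel"
      have "norm (L h) \<le> B * enn2real ?I"
        unfolding L_def by (rule integrable_locally_integrable_times(2)[OF lR]) (use M B in auto)
      moreover have "?I < top" using lR[of h] by (simp add: locally_integrable_def)
      moreover from this have "ennreal (B * enn2real ?I) = ennreal B * ?I"
        using B(1) by (simp add: ennreal_mult)
      ultimately have "ennreal \<bar>L h\<bar> \<le> ennreal B * ?I"
        using ennreal_leI[of "\<bar>L h\<bar>" "B * enn2real ?I"] by (simp only: real_norm_def)
      also have "?I \<le> (\<integral>\<^sup>+x. ennreal (norm h) * (ennreal \<delta> * indicator (cball 0 M) x + ennreal (\<delta> powr (1 - p)) * epow (ennreal (\<bar>?R h x\<bar> / norm h)) p) \<partial>lborel)"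
      proof (rule nn_integral_mono)
        fix x
        have "\<bar>?R h x\<bar> / norm h \<le> \<delta> + \<delta> powr (1 - p) * (\<bar>?R h x\<bar> / norm h) powr p"
          using \<delta> p by (intro young_power) auto
        then have "\<bar>?R h x\<bar> \<le> norm h * (\<delta> + \<delta> powr (1 - p) * (\<bar>?R h x\<bar> / norm h) powr p)"
          using h by (simp add: field_simps)
        then have "ennreal \<bar>?R h x\<bar> \<le> ennreal (norm h * (\<delta> + \<delta> powr (1 - p) * (\<bar>?R h x\<bar> / norm h) powr p))"
          by (rule ennreal_leI)
        also have "\<dots> = ennreal (norm h) * (ennreal \<delta> + ennreal (\<delta> powr (1 - p)) * epow (ennreal (\<bar>?R h x\<bar> / norm h)) p)"
          using p \<delta> by (simp add: ennreal_mult epow_ennreal)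
        finally show "ennreal (norm (?R h x)) * indicator (cball 0 M) x \<le> ennreal (norm h) * (ennreal \<delta> * indicator (cball 0 M) x + ennreal (\<delta> powr (1 - p)) * epow (ennreal (\<bar>?R h x\<bar> / norm h)) p)"
          by (auto simp: indicator_def)
      qed
      also have "\<dots> = ennreal (norm h) * (ennreal \<delta> * ennreal W + ennreal (\<delta> powr (1 - p)) * g h)"
        unfolding g_def by (simp add: nn_integral_cmult nn_integral_add nn_integral_cmult_indicator W(1))
      finally have "ennreal \<bar>L h\<bar> \<le> ennreal B * (ennreal (norm h) * (ennreal \<delta> * ennreal W + ennreal (\<delta> powr (1 - p)) * g h))"
        by (simp add: mult_left_mono)
      then have "ennreal (1 / norm h) * ennreal \<bar>L h\<bar> \<le> ennreal (1 / norm h) * (ennreal B * (ennreal (norm h) * (ennreal \<delta> * ennreal W + ennreal (\<delta> powr (1 - p)) * g h)))"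
        by (rule mult_left_mono) simp
      also have "\<dots> = (ennreal (1 / norm h) * ennreal (norm h)) * (ennreal B * ennreal \<delta> * ennreal W + ennreal B * ennreal (\<delta> powr (1 - p)) * g h)"
        by (simp only: distrib_left mult_ac)
      also have "ennreal (1 / norm h) * ennreal (norm h) = 1" using h by (simp add: ennreal_mult'[symmetric])
      also have "ennreal B * ennreal \<delta> * ennreal W = ennreal (B * \<delta> * W)" using B \<delta> W by (simp add: ennreal_mult)
      also have "ennreal B * ennreal (\<delta> powr (1 - p)) = ennreal \<beta>" using B by (simp add: \<beta>_def ennreal_mult)
      also have "1 * (ennreal (B * \<delta> * W) + ennreal \<beta> * g h) \<le> ennreal (norm w / 4) + ennreal \<beta> * g h"
        using \<delta>W by (simp add: add_right_mono ennreal_leI)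
      finally show ?thesis by (simp add: ennreal_mult'[symmetric])
    qed
    define c0 where "c0 = norm w / (4 * \<beta>)"
    have c0: "0 < c0" using w0 \<beta> by (simp add: c0_def)
    \<comment> \<open>A positive lower bound independent of \<epsilon>, which contradicts the limit
      0.\<close>
    have lower: "ennreal (c0 / 8 ^ ?N) \<le> (\<integral>\<^sup>+x. lrem p 1 f v \<epsilon> x \<partial>lborel)" if \<epsilon>: "0 < \<epsilon>" "\<epsilon> < d" for \<epsilon>
    proof -
      \<comment> \<open>The point at distance \<open>\<epsilon> / 2\<close> from 0 in the direction
        of \<open>w\<close>. The ball of radius \<open>\<epsilon> / 8\<close> around it stays inside
        the ball of radius \<epsilon>, fills the proportion \<open>1 / 8 ^ ?N\<close> of it, and
        contains only vectors close to the direction of \<open>w\<close>.\<close>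
      define a where "a = (\<epsilon> / (2 * norm w)) *\<^sub>R w"
      have na: "norm a = \<epsilon> / 2" using \<epsilon> w0 by (simp add: a_def)
      let ?B = "ball a (\<epsilon> / 8)"
      have gB: "ennreal c0 \<le> g h" if h: "h \<in> ?B" for h
      proof -
        define k where "k = h - a"
        have k: "norm k < \<epsilon> / 8" "h = a + k" using h by (auto simp: k_def dist_norm norm_minus_commute)
        have nh: "norm h \<le> 5 / 8 * \<epsilon>" "3 / 8 * \<epsilon> \<le> norm h"
          using norm_triangle_ineq[of a k] norm_triangle_ineq2[of a "- k"] k na by auto
        have "w \<bullet> a = \<epsilon> / 2 * norm w" using w0 by (simp add: a_def power2_norm_eq_inner[symmetric] power2_eq_square)
        moreover have "\<bar>w \<bullet> k\<bar> \<le> norm w * (\<epsilon> / 8)"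
          using Cauchy_Schwarz_ineq2[of w k] k w0 by (intro order_trans[OF Cauchy_Schwarz_ineq2 mult_left_mono]) auto
        ultimately have wh: "3 / 8 * \<epsilon> * norm w \<le> w \<bullet> h" using k by (simp add: inner_add_right algebra_simps)
        have h0: "h \<noteq> 0" using nh \<epsilon> by auto
        have "norm h < d" using nh \<epsilon> by linarith
        \<comment> \<open>The constants fit: \<open>3/8 * \<epsilon>\<close> is at least
          \<open>3/5\<close> of \<open>|h|\<close>, since \<open>|h|\<close> is at most
          \<open>5/8 * \<epsilon>\<close>. The Taylor error takes away \<open>1/10\<close>, which
          leaves \<open>1/2\<close>.\<close>
        from Lw[OF this] wh have "3 / 8 * \<epsilon> * norm w - norm w / 10 * norm h \<le> \<bar>L h\<bar>" by linarith
        moreover have "3 / 5 * norm h * norm w \<le> 3 / 8 * \<epsilon> * norm w"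
          using nh w0 by (intro mult_right_mono) auto
        ultimately have "norm w / 2 * norm h \<le> \<bar>L h\<bar>" by (simp add: algebra_simps)
        then have "norm w / 2 \<le> \<bar>L h\<bar> / norm h" using h0 by (simp add: field_simps)
        then have "ennreal (norm w / 4) + ennreal (norm w / 4) \<le> ennreal (norm w / 4) + ennreal \<beta> * g h"
          using order_trans[OF ennreal_leI L_le[OF h0]] by (simp add: ennreal_plus[symmetric] del: ennreal_plus)
        then have le: "ennreal (norm w / 4) \<le> ennreal \<beta> * g h"
          by (simp add: ennreal_add_left_cancel_le)
        have "ennreal c0 = ennreal (1 / \<beta>) * ennreal (norm w / 4)" using \<beta> by (simp add: c0_def ennreal_mult'[symmetric])
        also have "\<dots> \<le> ennreal (1 / \<beta>) * (ennreal \<beta> * g h)" by (intro mult_left_mono le) auto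
        also have "\<dots> = g h" using \<beta> by (simp add: mult.assoc[symmetric] ennreal_mult'[symmetric])
        finally show ?thesis .
      qed
      define V where "V = unit_ball_vol (real ?N)"
      have V: "0 < V" by (simp add: V_def)
      let ?c = "1 / (V * \<epsilon> ^ ?N)"
      have sub: "?B \<subseteq> ball 0 \<epsilon>"
      proof
        fix h assume "h \<in> ?B"
        then show "h \<in> ball 0 \<epsilon>" using na \<epsilon> norm_triangle_sub[of h a] by (auto simp: dist_norm norm_minus_commute)
      qed
      have "ennreal (c0 / 8 ^ ?N) = ennreal ?c * (ennreal c0 * emeasure lborel ?B)"
        using \<epsilon> V c0 by (simp add: emeasure_lborel_ball V_def[symmetric] ennreal_mult'[symmetric] power_divide)
      also have "ennreal c0 * emeasure lborel ?B = (\<integral>\<^sup>+h\<in>?B. ennreal c0 \<partial>lborel)"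
        by (rule nn_integral_cmult_indicator[symmetric]) auto
      also have "\<dots> \<le> (\<integral>\<^sup>+h\<in>ball 0 \<epsilon>. g h \<partial>lborel)"
        using gB sub by (intro nn_integral_mono) (auto simp: indicator_def)
      also have "\<dots> = (\<integral>\<^sup>+h. (\<integral>\<^sup>+x. epow (ennreal (\<bar>?R h x\<bar> / norm h)) p * indicator (ball 0 \<epsilon>) h \<partial>lborel) \<partial>lborel)"
        unfolding g_def by (intro nn_integral_cong nn_integral_multc[symmetric]) measurable
      also have "\<dots> = (\<integral>\<^sup>+x. (\<integral>\<^sup>+h\<in>ball 0 \<epsilon>. epow (ennreal (\<bar>?R h x\<bar> / norm h)) p \<partial>lborel) \<partial>lborel)"
        by (rule lborel_pair.Fubini') measurable
      also have "ennreal ?c * \<dots> = (\<integral>\<^sup>+x. ennreal ?c * (\<integral>\<^sup>+h\<in>ball 0 \<epsilon>. epow (ennreal (\<bar>?R h x\<bar> / norm h)) p \<partial>lborel) \<partial>lborel)"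
        by (rule nn_integral_cmult[symmetric]) measurable
      also have "\<dots> = (\<integral>\<^sup>+x. lrem p 1 f v \<epsilon> x \<partial>lborel)"
        by (simp add: lrem_def V_def)
      finally show ?thesis by (simp add: mult_left_mono)
    qed
    have "\<forall>\<^sub>F \<epsilon> in at_right 0. (\<integral>\<^sup>+x. lrem p 1 f v \<epsilon> x \<partial>lborel) < ennreal (c0 / 8 ^ ?N)"
      using c0 by (intro order_tendstoD(2)[OF lim]) auto
    moreover have "\<forall>\<^sub>F \<epsilon> in at_right 0. 0 < \<epsilon> \<and> \<epsilon> < d"
      using d(1) eventually_at_right_real[of 0 d] by (auto elim!: eventually_mono)
    ultimately have "\<forall>\<^sub>F \<epsilon> in at_right (0::real). False"
      by eventually_elim (use lower in \<open>auto simp: not_less[symmetric]\<close>)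
    then show False by simp
  qed
  then have "w \<bullet> b = 0" by simp
  then have "A b + z \<bullet> b = 0" using linear_eq_inner[OF \<open>linear A\<close>, of b] by (simp add: w_def inner_add_left)
  moreover have "A b = (LINT x|lborel. f x * partial_deriv b \<phi> x)"
    using b by (simp add: A_def grad_inner_Basis mult.commute)
  moreover have "z \<bullet> b = (LINT x|lborel. (v x \<bullet> b) * \<phi> x)"
    unfolding z_def using integral_inner_left[OF int[OF lv], of b] by (simp add: mult.commute)
  ultimately show "(LINT x|lborel. f x * partial_deriv b \<phi> x) = - (LINT x|lborel. (v x \<bullet> b) * \<phi> x)" by simp
qed

section \<open>Lebesgue measurable functions\<close>

text \<open>Each of the finitely many coordinates has a Borel representative, and the exceptional
  null sets are united.\<close>

lemma ex_borel_representative: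
  fixes g :: "'a::euclidean_space \<Rightarrow> 'b::euclidean_space"
  assumes g: "g \<in> borel_measurable lebesgue"
  shows "\<exists>g'. g' \<in> borel_measurable borel \<and> (AE x in lborel. g x = g' x)"
proof -
  have "\<exists>c. c \<in> borel_measurable borel \<and> (AE x in lborel. g x \<bullet> b = c x)" for b
  proof -
    have "(\<lambda>x. g x \<bullet> b) \<in> borel_measurable lebesgue" using g by simp
    from completion_ex_borel_measurable_real[OF this] show ?thesis by auto
  qed
  then obtain c where c: "\<And>b. c b \<in> borel_measurable borel" "\<And>b. AE x in lborel. g x \<bullet> b = c b x" by metis
  have "AE x in lborel. \<forall>b\<in>Basis. g x \<bullet> b = c b x"
    by (intro AE_finite_allI c) auto
  then have "AE x in lborel. g x = (\<Sum>b\<in>Basis. c b x *\<^sub>R b)"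
  proof eventually_elim
    case (elim x)
    have "g x = (\<Sum>b\<in>Basis. (g x \<bullet> b) *\<^sub>R b)" by (simp add: euclidean_representation)
    also have "\<dots> = (\<Sum>b\<in>Basis. c b x *\<^sub>R b)" using elim by (intro sum.cong) auto
    finally show ?case .
  qed
  moreover have "(\<lambda>x. \<Sum>b\<in>Basis. c b x *\<^sub>R b) \<in> borel_measurable borel"
    using c(1) by (intro borel_measurable_sum borel_measurable_scaleR) auto
  ultimately show ?thesis by blast
qed

lemma Lp_pint_finite:
  assumes f: "f \<in> Lp p" and p: "0 < p" and f': "f' \<in> borel_measurable borel" "AE x in lborel. f x = f' x"
  shows "pint p f' < top"
proof -
  have "integrable lebesgue (\<lambda>x. norm (f x) powr p)" using f by (simp add: Lp_def)
  then have "(\<integral>\<^sup>+x. ennreal (norm (f x) powr p) \<partial>lebesgue) < \<infinity>"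
    by (simp add: integrable_iff_bounded)
  also have "(\<integral>\<^sup>+x. ennreal (norm (f x) powr p) \<partial>lebesgue) = (\<integral>\<^sup>+x. ennreal (norm (f x) powr p) \<partial>lborel)"
    by (rule nn_integral_completion)
  also have "\<dots> = pint p f'"
    unfolding pint_def using f'(2) p by (intro nn_integral_cong_AE) (auto simp: epow_ennreal)
  finally show ?thesis by simp
qed

lemma distributional_gradient_iff_weak:
  assumes f: "f \<in> borel_measurable lebesgue" "f' \<in> borel_measurable borel" "AE x in lborel. f x = f' x"
    and g: "g \<in> borel_measurable lebesgue" "g' \<in> borel_measurable borel" "AE x in lborel. g x = g' x"
  shows "distributional_gradient f g \<longleftrightarrow> weak_gradient f' g'"
proof -
  have int: "(LINT x|lebesgue. u x * \<psi> x) = (LINT x|lborel. u' x * \<psi> x)"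
    if u: "u \<in> borel_measurable lebesgue" "u' \<in> borel_measurable borel" "AE x in lborel. u x = u' x"
      and \<psi>: "\<psi> \<in> borel_measurable borel" for u u' \<psi> :: "'a \<Rightarrow> real"
  proof -
    have \<psi>l: "\<psi> \<in> borel_measurable lebesgue" using \<psi> by (intro measurable_completion) simp
    have u'l: "u' \<in> borel_measurable lebesgue" using u(2) by (intro measurable_completion) simp
    have "(LINT x|lebesgue. u x * \<psi> x) = (LINT x|lebesgue. u' x * \<psi> x)"
      using u \<psi>l u'l AE_completion[OF u(3)] by (intro integral_cong_AE) (auto elim!: eventually_mono)
    also have "\<dots> = (LINT x|lborel. u' x * \<psi> x)"
      using u(2) \<psi> by (intro integral_completion) simp
    finally show ?thesis .
  qed
  have "(LINT x|lebesgue. f x * partial_deriv b \<phi> x) = (LINT x|lborel. f' x * partial_deriv b \<phi> x)"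
    "(LINT x|lebesgue. (g x \<bullet> b) * \<phi> x) = (LINT x|lborel. (g' x \<bullet> b) * \<phi> x)"
    if \<phi>: "\<phi> \<in> test_functions" and b: "b \<in> Basis" for \<phi> b
  proof -
    note m = has_gradient_measurable[OF test_function_gradient[OF \<phi>]]
    have "(\<lambda>x. grad \<phi> x \<bullet> b) \<in> borel_measurable borel" using m(2) by simp
    then have "partial_deriv b \<phi> \<in> borel_measurable borel" using b by (simp add: grad_inner_Basis)
    then show "(LINT x|lebesgue. f x * partial_deriv b \<phi> x) = (LINT x|lborel. f' x * partial_deriv b \<phi> x)"
      by (intro int f)
    show "(LINT x|lebesgue. (g x \<bullet> b) * \<phi> x) = (LINT x|lborel. (g' x \<bullet> b) * \<phi> x)"
      using g by (intro int m(1)) auto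
  qed
  then show ?thesis unfolding distributional_gradient_def weak_gradient_def by simp
qed

text \<open>For almost every \<open>x\<close> the values at \<open>x\<close> agree. For such
  \<open>x\<close> the functions of \<open>h\<close> agree almost everywhere by translation
  invariance, although the exceptional null set moves with \<open>x\<close>.\<close>

lemma local_remainder_eq_lrem:
  fixes f :: "'a::euclidean_space \<Rightarrow> real"
  assumes p: "1 \<le> p" and q: "1 \<le> q" and \<epsilon>: "0 < \<epsilon>"
    and f: "AE x in lborel. f x = f' x" and v: "AE x in lborel. v x = v' x"
  shows "(\<integral>\<^sup>+x. local_remainder p (ereal q) f v \<epsilon> x \<partial>lebesgue) = (\<integral>\<^sup>+x. lrem p q f' v' \<epsilon> x \<partial>lborel)"
proof -
  let ?N = "DIM('a)"
  have "AE x in lborel. local_remainder p (ereal q) f v \<epsilon> x = lrem p q f' v' \<epsilon> x"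
    using f v
  proof eventually_elim
    case (elim x)
    have "(\<integral>\<^sup>+h\<in>ball 0 \<epsilon>. ennreal (\<bar>f (x + h) - f x - v x \<bullet> h\<bar> powr (p * q) / norm h powr (p * q)) \<partial>lebesgue) =
      (\<integral>\<^sup>+h\<in>ball 0 \<epsilon>. ennreal (\<bar>f (x + h) - f x - v x \<bullet> h\<bar> powr (p * q) / norm h powr (p * q)) \<partial>lborel)"
      by (rule nn_integral_completion)
    also have "\<dots> = (\<integral>\<^sup>+h\<in>ball 0 \<epsilon>. epow (ennreal (\<bar>f' (x + h) - f' x - v' x \<bullet> h\<bar> / norm h)) (p * q) \<partial>lborel)"
    proof (rule nn_integral_cong_AE)
      show "AE h in lborel. ennreal (\<bar>f (x + h) - f x - v x \<bullet> h\<bar> powr (p * q) / norm h powr (p * q)) * indicator (ball 0 \<epsilon>) h =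
        epow (ennreal (\<bar>f' (x + h) - f' x - v' x \<bullet> h\<bar> / norm h)) (p * q) * indicator (ball 0 \<epsilon>) h"
        using AE_lborel_shift[OF f, of x] by eventually_elim (use p q elim in \<open>simp add: epow_ennreal powr_divide\<close>)
    qed
    finally have eq: "(\<integral>\<^sup>+h\<in>ball 0 \<epsilon>. ennreal (\<bar>f (x + h) - f x - v x \<bullet> h\<bar> powr (p * q) / norm h powr (p * q)) \<partial>lebesgue) =
      (\<integral>\<^sup>+h\<in>ball 0 \<epsilon>. epow (ennreal (\<bar>f' (x + h) - f' x - v' x \<bullet> h\<bar> / norm h)) (p * q) \<partial>lborel)" .
    define V where "V = unit_ball_vol (real ?N)"
    have V: "0 < V" by (simp add: V_def)
    have c: "1 / emeasure lebesgue (ball (0::'a) \<epsilon>) = ennreal (1 / (V * \<epsilon> ^ ?N))"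
    proof -
      have "emeasure lebesgue (ball (0::'a) \<epsilon>) = ennreal (V * \<epsilon> ^ ?N)"
        using \<epsilon> by (simp add: emeasure_lborel_ball V_def)
      moreover have "0 < V * \<epsilon> ^ ?N" using V \<epsilon> by simp
      ultimately show ?thesis
        using divide_ennreal[of 1 "V * \<epsilon> ^ ?N"] by simp
    qed
    show ?case
      unfolding local_remainder_def lrem_def real_of_ereal.simps eq c V_def[symmetric]
      using q by (simp add: epow_eq_ennpowr)
  qed
  then show ?thesis unfolding nn_integral_completion by (rule nn_integral_cong_AE)
qed

lemma local_remainder_infinity_le:
  fixes f :: "'a::euclidean_space \<Rightarrow> real"
  assumes p: "1 \<le> p" and f: "f' \<in> borel_measurable borel" "AE x in lborel. f x = f' x" and v: "AE x in lborel. v x = v' x"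
    and G: "AE x in lborel. AE h in lborel. h \<in> ball 0 \<epsilon> \<longrightarrow> epow (ennreal (\<bar>f' (x + h) - f' x - v' x \<bullet> h\<bar> / norm h)) p \<le> G x"
  shows "(\<integral>\<^sup>+x. local_remainder p \<infinity> f v \<epsilon> x \<partial>lebesgue) \<le> (\<integral>\<^sup>+x. G x \<partial>lborel)"
  unfolding nn_integral_completion
proof (rule nn_integral_mono_AE)
  note [measurable] = f(1)
  show "AE x in lborel. local_remainder p \<infinity> f v \<epsilon> x \<le> G x"
    using f(2) v G
  proof eventually_elim
    case (elim x)
    let ?F = "\<lambda>h. ennreal (\<bar>f (x + h) - f x - v x \<bullet> h\<bar> / norm h)"
    let ?F' = "\<lambda>h. ennreal (\<bar>f' (x + h) - f' x - v' x \<bullet> h\<bar> / norm h)"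
    have eq: "AE h in lborel. ?F h = ?F' h"
      using AE_lborel_shift[OF f(2), of x] by eventually_elim (use elim in simp)
    have F'm: "?F' \<in> borel_measurable lborel" by measurable
    \<comment> \<open>\<open>esssup_I\<close> asks for measurability of the quotient. The translate
      of \<open>f\<close> agrees almost everywhere with that of the Borel function \<open>f'\<close>
      and is therefore Lebesgue measurable.\<close>
    have Fm: "?F \<in> borel_measurable lebesgue"
    proof -
      have "(\<lambda>h. f' (x + h)) \<in> borel_measurable lebesgue" by (intro measurable_completion) measurable
      moreover have "AE h in lebesgue. f' (x + h) = f (x + h)"
        using AE_lborel_shift[OF f(2), of x] by (intro AE_completion) (auto elim!: eventually_mono)
      ultimately have [measurable]: "(\<lambda>h. f (x + h)) \<in> borel_measurable lebesgue" by (rule borel_measurable_AE)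
      have [measurable]: "(\<lambda>h::'a. h) \<in> borel_measurable lebesgue" by (intro measurable_completion) simp
      show ?thesis by measurable
    qed
    have "AE h in lborel. h \<in> ball 0 \<epsilon> \<longrightarrow> ?F h \<le> epow (G x) (1 / p)"
      using elim(3) eq by eventually_elim (use p in \<open>auto simp: epow_le_iff\<close>)
    then have "AE h in restrict_space lebesgue (ball 0 \<epsilon>). ?F h \<le> epow (G x) (1 / p)"
      by (subst AE_restrict_space_iff) (auto intro: AE_completion)
    then have "esssup (restrict_space lebesgue (ball 0 \<epsilon>)) ?F \<le> epow (G x) (1 / p)"
      using Fm by (intro esssup_I) (auto intro: measurable_restrict_space1)
    then have "epow (esssup (restrict_space lebesgue (ball 0 \<epsilon>)) ?F) p \<le> G x"
      using p by (simp add: epow_le_iff)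
    then show ?case using p by (simp add: local_remainder_def epow_eq_ennpowr)
  qed
qed

text \<open>The average over the ball of a quantity bounded by \<open>epow G q\<close> is bounded by
  the same number, and the root \<open>1 / q\<close> restores \<open>G\<close>.\<close>

lemma lrem_le_of_AE:
  fixes f :: "'a::euclidean_space \<Rightarrow> real"
  assumes p: "1 \<le> p" and q: "1 \<le> q" and \<epsilon>: "0 < \<epsilon>"
    and G: "AE h in lborel. h \<in> ball 0 \<epsilon> \<longrightarrow> epow (ennreal (\<bar>f (x + h) - f x - v x \<bullet> h\<bar> / norm h)) p \<le> G"
  shows "lrem p q f v \<epsilon> x \<le> G"
proof -
  let ?N = "DIM('a)"
  define V where "V = unit_ball_vol (real ?N)"
  have V: "0 < V" by (simp add: V_def)
  let ?F = "\<lambda>h. ennreal (\<bar>f (x + h) - f x - v x \<bullet> h\<bar> / norm h)"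
  have "(\<integral>\<^sup>+h\<in>ball 0 \<epsilon>. epow (?F h) (p * q) \<partial>lborel) \<le> (\<integral>\<^sup>+h\<in>ball (0::'a) \<epsilon>. epow G q \<partial>lborel)"
  proof (rule nn_integral_mono_AE)
    show "AE h in lborel. epow (?F h) (p * q) * indicator (ball 0 \<epsilon>) h \<le> epow G q * indicator (ball 0 \<epsilon>) h"
      using G
    proof eventually_elim
      case (elim h)
      then show ?case using p q epow_mono[of "epow (?F h) p" G q] by (auto simp: indicator_def epow_epow)
    qed
  qed
  also have "\<dots> = epow G q * ennreal (V * \<epsilon> ^ ?N)"
    using \<epsilon> by (subst nn_integral_cmult_indicator) (auto simp: emeasure_lborel_ball V_def)
  finally have "lrem p q f v \<epsilon> x \<le> epow (ennreal (1 / (V * \<epsilon> ^ ?N)) * (epow G q * ennreal (V * \<epsilon> ^ ?N))) (1 / q)"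
    unfolding lrem_def V_def[symmetric] using q by (intro epow_mono mult_left_mono) auto
  also have "ennreal (1 / (V * \<epsilon> ^ ?N)) * (epow G q * ennreal (V * \<epsilon> ^ ?N)) = epow G q * (ennreal (1 / (V * \<epsilon> ^ ?N)) * ennreal (V * \<epsilon> ^ ?N))"
    by (simp only: mult_ac)
  also have "ennreal (1 / (V * \<epsilon> ^ ?N)) * ennreal (V * \<epsilon> ^ ?N) = 1"
    using V \<epsilon> by (simp add: ennreal_mult'[symmetric])
  finally show ?thesis using q by (simp add: epow_epow)
qed

text \<open>For \<open>p < N\<close> the largest admissible exponent dominates all smaller ones; for
  \<open>p = N\<close> every finite exponent is covered directly; for \<open>p > N\<close> the
  domination behind the case of infinite \<open>q\<close> bounds all power means.\<close>

lemma nn_integral_lrem_tendsto_all: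
  fixes f :: "'a::euclidean_space \<Rightarrow> real" and p q :: real
  assumes p: "1 \<le> p" and q: "1 \<le> q" and le: "p < DIM('a) \<Longrightarrow> q \<le> real DIM('a) / (real DIM('a) - p)"
    and fv: "sobolev_pair p f v"
  shows "((\<lambda>\<epsilon>. \<integral>\<^sup>+x. lrem p q f v \<epsilon> x \<partial>lborel) \<longlongrightarrow> 0) (at_right 0)"
proof -
  note [measurable] = sobolev_pairD(1,2)[OF fv]
  have sandwich: ?thesis
    if lim: "((\<lambda>\<epsilon>. \<integral>\<^sup>+x. H \<epsilon> x \<partial>lborel) \<longlongrightarrow> 0) (at_right 0)"
      and H: "\<And>\<epsilon>. 0 < \<epsilon> \<Longrightarrow> (\<integral>\<^sup>+x. lrem p q f v \<epsilon> x \<partial>lborel) \<le> (\<integral>\<^sup>+x. H \<epsilon> x \<partial>lborel)" for H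
    by (rule tendsto_sandwich[OF _ _ tendsto_const lim]) (auto simp: eventually_at_filter H)
  consider "p < DIM('a)" | "p = DIM('a)" | "DIM('a) < p" by linarith
  then show ?thesis
  proof cases
    case 1
    define q' where "q' = real DIM('a) / (real DIM('a) - p)"
    have "q \<le> q'" using le[OF 1] by (simp add: q'_def)
    have "((\<lambda>\<epsilon>. \<integral>\<^sup>+x. lrem p q' f v \<epsilon> x \<partial>lborel) \<longlongrightarrow> 0) (at_right 0)"
      using p q 1 fv \<open>q \<le> q'\<close> by (intro nn_integral_lrem_tendsto) (auto simp: q'_def)
    then show ?thesis
    proof (rule sandwich)
      fix \<epsilon> :: real assume "0 < \<epsilon>"
      then show "(\<integral>\<^sup>+x. lrem p q f v \<epsilon> x \<partial>lborel) \<le> (\<integral>\<^sup>+x. lrem p q' f v \<epsilon> x \<partial>lborel)"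
        by (intro nn_integral_mono lrem_mono p q \<open>q \<le> q'\<close>) auto
    qed
  next
    case 2
    then show ?thesis using p q fv by (intro nn_integral_lrem_tendsto) auto
  next
    case 3
    obtain G where G: "\<And>\<epsilon>. 0 < \<epsilon> \<Longrightarrow> AE x in lborel. AE h in lborel. h \<in> ball 0 \<epsilon> \<longrightarrow> epow (ennreal (\<bar>f (x + h) - f x - v x \<bullet> h\<bar> / norm h)) p \<le> G \<epsilon> x"
      "((\<lambda>\<epsilon>. \<integral>\<^sup>+x. G \<epsilon> x \<partial>lborel) \<longlongrightarrow> 0) (at_right 0)"
      using sup_remainder[OF p 3 fv] by blast
    show ?thesis
    proof (rule sandwich[OF G(2)])
      fix \<epsilon> :: real assume \<epsilon>: "0 < \<epsilon>"
      show "(\<integral>\<^sup>+x. lrem p q f v \<epsilon> x \<partial>lborel) \<le> (\<integral>\<^sup>+x. G \<epsilon> x \<partial>lborel)"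
        using G(1)[OF \<epsilon>] by (intro nn_integral_mono_AE) (auto elim!: eventually_mono intro!: lrem_le_of_AE p q \<epsilon>)
    qed
  qed
qed

theorem theorem1p3:
  fixes f :: "real ^ 'n \<Rightarrow> real" and p :: real
  assumes "1 \<le> p" and "f \<in> Lp p"
  shows "f \<in> W1 p \<longleftrightarrow>
    (\<exists>v :: real ^ 'n \<Rightarrow> real ^ 'n. v \<in> Lp p \<and>
      (\<forall>q :: ereal.
         1 \<le> q \<and>
         (p < real CARD('n) \<longrightarrow> q \<le> ereal (real CARD('n) / (real CARD('n) - p))) \<and>
         (p = real CARD('n) \<longrightarrow> q < \<infinity>) \<and>
         (p > real CARD('n) \<longrightarrow> q \<le> \<infinity>) \<longrightarrow>
         ((\<lambda>\<epsilon>. \<integral>\<^sup>+x. local_remainder p q f v \<epsilon> x \<partial>lebesgue) \<longlongrightarrow> 0) (at_right 0)))"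
    (is "_ \<longleftrightarrow> (\<exists>v. v \<in> Lp p \<and> (\<forall>q. ?adm q \<longrightarrow> ?lim v q))")
proof -
  have p: "1 \<le> p" "0 < p" using assms(1) by auto
  have fl: "f \<in> borel_measurable lebesgue" using assms(2) by (simp add: Lp_def)
  obtain f' where f': "f' \<in> borel_measurable borel" "AE x in lborel. f x = f' x"
    using ex_borel_representative[OF fl] by blast
  have finf: "pint p f' < top" by (rule Lp_pint_finite[OF assms(2) p(2) f'])
  have lim_iff: "?lim v (ereal r) \<longleftrightarrow> ((\<lambda>\<epsilon>. \<integral>\<^sup>+x. lrem p r f' v' \<epsilon> x \<partial>lborel) \<longlongrightarrow> 0) (at_right 0)"
    if "1 \<le> r" "AE x in lborel. v x = v' x" for v v' r
  proof (rule filterlim_cong[OF refl refl])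
    show "\<forall>\<^sub>F \<epsilon> in at_right 0. (\<integral>\<^sup>+x. local_remainder p (ereal r) f v \<epsilon> x \<partial>lebesgue) = (\<integral>\<^sup>+x. lrem p r f' v' \<epsilon> x \<partial>lborel)"
      using eventually_at_right_less[of 0]
      by eventually_elim (intro local_remainder_eq_lrem p(1) that f'(2))
  qed
  show ?thesis
  proof
    assume "f \<in> W1 p"
    then obtain g where g: "g \<in> Lp p" "distributional_gradient f g" by (auto simp: W1_def)
    have gl: "g \<in> borel_measurable lebesgue" using g(1) by (simp add: Lp_def)
    obtain g' where g': "g' \<in> borel_measurable borel" "AE x in lborel. g x = g' x"
      using ex_borel_representative[OF gl] by blast
    have "sobolev_pair p f' g'"
      unfolding sobolev_pair_def using f'(1) g'(1) finf Lp_pint_finite[OF g(1) p(2) g'] g(2)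
        distributional_gradient_iff_weak[OF fl f' gl g'] by blast
    note fg = this
    have "?lim g q" if q: "?adm q" for q
    proof (cases q)
      case (real r)
      then have "1 \<le> r" "p < DIM(real ^ 'n) \<Longrightarrow> r \<le> real DIM(real ^ 'n) / (real DIM(real ^ 'n) - p)"
        using q by (auto simp: one_ereal_def)
      then show ?thesis
        unfolding real using fg p(1) by (subst lim_iff[OF _ g'(2)]) (auto intro: nn_integral_lrem_tendsto_all)
    next
      case PInf
      \<comment> \<open>Infinite \<open>q\<close> violates the upper bound imposed for
        \<open>p < N\<close> and the strict one for \<open>p = N\<close>.\<close>
      have "\<not> p \<le> CARD('n)" using q PInf by (cases "p < CARD('n)") auto
      then have "real DIM(real ^ 'n) < p" by simp
      from sup_remainder[OF p(1) this fg] obtain G where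
        G: "\<And>\<epsilon>. 0 < \<epsilon> \<Longrightarrow> AE x in lborel. AE h in lborel. h \<in> ball 0 \<epsilon> \<longrightarrow> epow (ennreal (\<bar>f' (x + h) - f' x - g' x \<bullet> h\<bar> / norm h)) p \<le> G \<epsilon> x"
        "((\<lambda>\<epsilon>. \<integral>\<^sup>+x. G \<epsilon> x \<partial>lborel) \<longlongrightarrow> 0) (at_right 0)" by blast
      show ?thesis
      proof (rule tendsto_sandwich[OF _ _ tendsto_const G(2)])
        show "\<forall>\<^sub>F \<epsilon> in at_right 0. (\<integral>\<^sup>+x. local_remainder p q f g \<epsilon> x \<partial>lebesgue) \<le> (\<integral>\<^sup>+x. G \<epsilon> x \<partial>lborel)"
          using eventually_at_right_less[of 0] unfolding PInf
          by eventually_elim (rule local_remainder_infinity_le[OF p(1) f' g'(2) G(1)])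
      qed simp
    next
      case MInf
      then show ?thesis using q by simp
    qed
    with g(1) show "\<exists>v. v \<in> Lp p \<and> (\<forall>q. ?adm q \<longrightarrow> ?lim v q)" by blast
  next
    assume "\<exists>v. v \<in> Lp p \<and> (\<forall>q. ?adm q \<longrightarrow> ?lim v q)"
    then obtain v where v: "v \<in> Lp p" "\<And>q. ?adm q \<Longrightarrow> ?lim v q" by blast
    have vl: "v \<in> borel_measurable lebesgue" using v(1) by (simp add: Lp_def)
    obtain v' where v': "v' \<in> borel_measurable borel" "AE x in lborel. v x = v' x"
      using ex_borel_representative[OF vl] by blast
    \<comment> \<open>The exponent 1 is admissible in all three ranges of \<open>p\<close>, because
      \<open>1 \<le> N / (N - p)\<close> for \<open>p < N\<close>.\<close>
    have "?adm (ereal 1)" using p by (auto simp: one_ereal_def)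
    from v(2)[OF this] have "((\<lambda>\<epsilon>. \<integral>\<^sup>+x. lrem p 1 f' v' \<epsilon> x \<partial>lborel) \<longlongrightarrow> 0) (at_right 0)"
      by (subst (asm) lim_iff[OF _ v'(2)]) auto
    then have "weak_gradient f' v'"
      by (intro weak_gradient_of_remainder[OF p(1) f'(1) v'(1) finf Lp_pint_finite[OF v(1) p(2) v']])
    then have "distributional_gradient f v"
      using distributional_gradient_iff_weak[OF fl f' vl v'] by blast
    then show "f \<in> W1 p" using assms(2) v(1) by (auto simp: W1_def)
  qed
qed

end
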